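(* Let $\nu,\eta>0$ with $\nu+\eta<1$, and let $N\to\infty$ with integers $n=n_N$, $x=x_N$ satisfying $1\le n<N$, $1\le x\le N-n+1$, $\frac{n}{N}\to\nu$ and $\frac{x-1}{N}\to\eta$. Let $a<b$ and $\psi$ be as in the context and assume $0\in(a,b)$. Let $y_1<\cdots<y_n$ be the (rescaled) bus arrival times with the joint density given in the context, and for $\ell>0$ let $H_{N,n,x}(\ell)$ be the variance of the number of $y_j$ in the interval $[-\ell/2,\ell/2]$. Then for every $s>0$ the limit $$H_\infty(s)=\lim_{N\to\infty}H_{N,n,x}\left(\frac{s}{n\psi(0)}\right)$$ exists, and $H_\infty(s)$ is precisely the number variance of the Gaussian Unitary Ensemble, namely $$H_\infty(s)=s-\int_0^s\int_0^s\left(\frac{\sin\pi(\xi-\rho)}{\pi(\xi-\rho)}\right)^2d\xi\,d\rho.$$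
   Context: Bus model: $L^{(1)},\dots,L^{(n)}$ are independent rate 1 Poisson processes on $\mathbb{Z}$ with $L^{(i)}_0=1-i$, conditioned not to intersect on $[0,T]$ and to satisfy $L^{(i)}_T=N+1-i$; $t_i$ is the time at which $L^{(i)}$ jumps from $x-1$ to $x$, and $y_i=2t_i/T-1$. The joint density of $(y_1,\dots,y_n)$ on $-1<y_1<\cdots<y_n<1$ is proportional to $\prod_{i<j}(y_j-y_i)^2\prod_{j=1}^n(1+y_j)^{x-1}(1-y_j)^{N-x-(n-1)}$. Equilibrium measure: $-1<a<b<1$ are determined by $$\frac{\eta}{\sqrt{(1+a)(1+b)}}=\frac{1-\eta-\nu}{\sqrt{(1-a)(1-b)}},\qquad 1+\nu=\frac{\eta}{\sqrt{(1+a)(1+b)}}+\frac{1-\eta-\nu}{\sqrt{(1-a)(1-b)}},$$ and $\psi(u)\,du$ is the probability measure on $[a,b]$ with density $$\psi(u)=\frac{\eta\sqrt{(u-a)(b-u)}}{\nu\,\pi\sqrt{(1+a)(1+b)}\,(1-u^2)}.$$ The number variance of the Gaussian Unitary Ensemble (in the unfolded bulk scaling limit) is the variance of the number of points in an interval of length $s$ of the determinantal point process on $\mathbb{R}$ with the sine kernel $\frac{\sin\pi(\xi-\rho)}{\pi(\xi-\rho)}$ (value 1 on the diagonal). *)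

theory Defs
  imports "HOL-Probability.Probability" "Jordan_Normal_Form.Determinant"
begin

definition ordered_chamber :: "nat \<Rightarrow> (nat \<Rightarrow> real) set" where
  "ordered_chamber n = {y. (\<forall>j\<in>{1..n}. -1 < y j \<and> y j < 1) \<and> strict_mono_on {1..n} y}"

(* The exponent N - x - (n - 1) is a subtraction on nat; it is the true difference
   whenever n and x are at least 1 and x \<le> N - n + 1. *)
definition bus_weight :: "nat \<Rightarrow> nat \<Rightarrow> nat \<Rightarrow> (nat \<Rightarrow> real) \<Rightarrow> real" where
  "bus_weight N n x y =
     indicator (ordered_chamber n) y *
     (\<Prod>j\<in>{1..n}. \<Prod>i\<in>{1..<j}. (y j - y i)\<^sup>2) *
     (\<Prod>j\<in>{1..n}. (1 + y j) ^ (x - 1) * (1 - y j) ^ (N - x - (n - 1)))"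

(* "Proportional to": the constant c is forced, since the density has total mass 1. *)
definition bus_arrival_times ::
  "'a measure \<Rightarrow> nat \<Rightarrow> nat \<Rightarrow> nat \<Rightarrow> (nat \<Rightarrow> 'a \<Rightarrow> real) \<Rightarrow> bool" where
  "bus_arrival_times M N n x Y \<longleftrightarrow>
     prob_space M \<and>
     (\<exists>c>0. distributed M (\<Pi>\<^sub>M j\<in>{1..n}. lborel) (\<lambda>\<omega>. \<lambda>j\<in>{1..n}. Y j \<omega>)
              (\<lambda>y. ennreal (c * bus_weight N n x y)))"

definition bus_number_variance ::
  "'a measure \<Rightarrow> nat \<Rightarrow> (nat \<Rightarrow> 'a \<Rightarrow> real) \<Rightarrow> real \<Rightarrow> real" where
  "bus_number_variance M n Y l =
     prob_space.variance M (\<lambda>\<omega>. real (card {j\<in>{1..n}. Y j \<omega> \<in> {- l / 2 .. l / 2}}))"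

definition equilibrium_endpoints :: "real \<Rightarrow> real \<Rightarrow> real \<Rightarrow> real \<Rightarrow> bool" where
  "equilibrium_endpoints \<nu> \<eta> a b \<longleftrightarrow>
     -1 < a \<and> a < b \<and> b < 1 \<and>
     \<eta> / sqrt ((1 + a) * (1 + b)) = (1 - \<eta> - \<nu>) / sqrt ((1 - a) * (1 - b)) \<and>
     1 + \<nu> = \<eta> / sqrt ((1 + a) * (1 + b)) + (1 - \<eta> - \<nu>) / sqrt ((1 - a) * (1 - b))"

definition equilibrium_density :: "real \<Rightarrow> real \<Rightarrow> real \<Rightarrow> real \<Rightarrow> real \<Rightarrow> real" where
  "equilibrium_density \<nu> \<eta> a b u =
     (if u \<in> {a..b}
      then \<eta> * sqrt ((u - a) * (b - u)) / (\<nu> * pi * sqrt ((1 + a) * (1 + b)) * (1 - u\<^sup>2))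
      else 0)"

definition sine_kernel :: "real \<Rightarrow> real \<Rightarrow> real" where
  "sine_kernel \<xi> \<rho> = (if \<xi> = \<rho> then 1 else sin (pi * (\<xi> - \<rho>)) / (pi * (\<xi> - \<rho>)))"

definition simple_point_process :: "'b measure \<Rightarrow> ('b \<Rightarrow> real set) \<Rightarrow> bool" where
  "simple_point_process P X \<longleftrightarrow>
     prob_space P \<and>
     (\<forall>B\<in>sets borel. bounded B \<longrightarrow>
        (\<forall>\<omega>\<in>space P. finite (X \<omega> \<inter> B)) \<and>
        (\<lambda>\<omega>. card (X \<omega> \<inter> B)) \<in> P \<rightarrow>\<^sub>M count_space UNIV)"

(* The k-th correlation function is the density of the k-th factorial moment measure,
   which counts ordered k-tuples of distinct points of the process. *)
definition determinantal_point_process ::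
  "'b measure \<Rightarrow> ('b \<Rightarrow> real set) \<Rightarrow> (real \<Rightarrow> real \<Rightarrow> real) \<Rightarrow> bool" where
  "determinantal_point_process P X K \<longleftrightarrow>
     simple_point_process P X \<and>
     (\<forall>k B. (\<forall>i<k. B i \<in> sets borel \<and> bounded (B i)) \<longrightarrow>
        (\<integral>\<^sup>+\<omega>. of_nat (card {p \<in> (\<Pi>\<^sub>E i\<in>{..<k}. X \<omega> \<inter> B i). inj_on p {..<k}}) \<partial>P) =
        (\<integral>\<^sup>+p\<in>(\<Pi>\<^sub>E i\<in>{..<k}. B i).
            ennreal (Determinant.det (mat k k (\<lambda>(i, j). K (p i) (p j))))
          \<partial>(\<Pi>\<^sub>M i\<in>{..<k}. lborel)))"

end

theory Submission imports Defs begin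

hide_const (open) Module.smult

text \<open>For a determinantal ensemble the variance of a counting statistic is
  \<open>tr G - tr (G * G)\<close>, where \<open>G\<close> is the Gram matrix of the weighted orthonormal polynomials on
  the interval; so only the Christoffel-Darboux kernel near 0 matters. The differential ladder relation
  turns this kernel into an expression in the single function \<open>\<phi>\<close> (the weighted Jacobi polynomial of
  degree \<open>n\<close>) and \<open>D = (1 - x\<^sup>2) \<phi>'\<close>. To leading order \<open>\<phi>\<close>, \<open>D\<close> satisfy the
  equations of an oscillator whose squared frequency is proportional to \<open>(x - a) (b - x)\<close>, and near 0
  that is a rotation, so the kernel is locally a constant times \<open>sin\<close> over the difference.

  The constant is the oscillator energy at 0. It is found without Plancherel-Rotach asymptotics: a virial
  identity shows that the moments of \<open>\<phi>\<^sup>2\<close> tend to those of the arcsine law on \<open>[a, b]\<close>;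
  equipartition converts the mass near 0 into mean energy, and the energy varies slowly. Comparison
  with the equations for the endpoints shows that this is the normalisation by \<open>\<psi> 0\<close>.\<close>

section \<open>Orthogonal polynomials of a positive functional\<close>

text \<open>Near 0 the polynomial of degree n has no pointwise limit, because its phase depends on N
  in an uncontrolled way. Hence only phase-free quantities are followed: the energy \<open>E\<close>
  and the antisymmetric combination of \<open>\<phi>\<close> and \<open>D\<close> in the kernel. A
  second obstacle is a gap between scales. The arcsine limit is a weak limit and sees windows of
  fixed width \<open>d\<close>, whereas the kernel matters at distances of order 1/n from 0. The gap
  is bridged by the bound \<open>lip * E\<close> for the derivative of \<open>E\<close>: its rate
  does not depend on \<open>\<kappa>\<close>, although \<open>\<phi>\<close> oscillates at a
  frequency of order \<open>\<kappa>\<close>. So N tends to infinity at fixed \<open>d\<close>, and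
  \<open>d\<close> shrinks afterwards.

  The constants close up as follows. Let \<open>R0\<close> be the limit of the squared frequency
  over \<open>\<kappa>^2\<close> at 0, that is - a b. The arcsine density at 0 is 1 / (pi sqrt R0),
  equipartition makes the scaled energy \<open>T0\<close> equal to 2 R0 times this density, the
  squared amplitude tends to T0 / R0, and the prefactor of the kernel tends to sqrt R0 / 2.
  Amplitude times prefactor times the slope pi of the sine at 0 is 1, the diagonal value of the sine
  kernel.\<close>

locale positive_functional =
  fixes L :: "real poly \<Rightarrow> real"
  assumes L_add: "L (p + q) = L p + L q"
    and L_smult: "L (smult c p) = c * L p"
    and L_pos: "p \<noteq> 0 \<Longrightarrow> L (p * p) > 0"
begin

lemma L_0 [simp]: "L 0 = 0"
  using L_smult[of 0 0] by simp

lemma L_diff: "L (p - q) = L p - L q"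
  using L_add[of "p - q" q] by simp

text \<open>The Stieltjes procedure: the three-term recurrence is taken as the definition, so that
  it holds by construction and all polynomials are monic; orthogonality is what remains to be
  proved.\<close>

fun opoly :: "nat \<Rightarrow> real poly" where
  "opoly 0 = 1"
| "opoly (Suc 0) = [:- L [:0, 1:] / L 1, 1:]"
| "opoly (Suc (Suc n)) =
     [:- L ([:0, 1:] * (opoly (Suc n) * opoly (Suc n))) / L (opoly (Suc n) * opoly (Suc n)), 1:] * opoly (Suc n)
     - smult (L (opoly (Suc n) * opoly (Suc n)) / L (opoly n * opoly n)) (opoly n)"

definition hnorm :: "nat \<Rightarrow> real" where
  "hnorm n = L (opoly n * opoly n)"

lemma degree_split:
  fixes p q :: "real poly"
  assumes "degree p = k" "coeff p k = 1" "degree q \<le> k"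
  obtains c r where "q = smult c p + r" "r = 0 \<or> degree r < k"
proof -
  define r where "r = q - smult (coeff q k) p"
  have "degree r \<le> k" unfolding r_def using assms by (intro degree_diff_le) auto
  moreover have "coeff r k = 0" using assms by (simp add: r_def)
  ultimately have "r = 0 \<or> degree r < k"
    by (metis le_neq_implies_less leading_coeff_0_iff)
  moreover have "q = smult (coeff q k) p + r" by (simp add: r_def)
  ultimately show ?thesis using that by blast
qed

text \<open>The two coefficients are exactly those that make the new polynomial orthogonal to its
  two predecessors. Orthogonality to lower degrees is automatic, since multiplication by x can be
  moved to the other factor and raises its degree by only one.\<close>

lemma opoly_aux:
  "degree (opoly n) = n \<and> coeff (opoly n) n = 1 \<and> (\<forall>q. degree q < n \<longrightarrow> L (opoly n * q) = 0)"
proof (induction n rule: opoly.induct)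
  case 1
  then show ?case by simp
next
  case 2
  have "L (opoly (Suc 0) * q) = 0" if q: "degree q < Suc 0" for q
  proof -
    have "L 1 \<noteq> 0" using L_pos[of 1] by simp
    obtain c where c: "q = [:c:]" using q degree_eq_zeroE[of q] by auto
    have "opoly (Suc 0) * q = smult c ([:0, 1:] - smult (L [:0, 1:] / L 1) 1)"
      unfolding c by (simp add: one_pCons)
    then show ?thesis using \<open>L 1 \<noteq> 0\<close> by (simp only: L_smult L_diff) simp
  qed
  then show ?case by auto
next
  case (3 n)
  define p where "p = opoly (Suc n)"
  define u where "u = opoly n"
  define B where "B = L ([:0, 1:] * (p * p)) / L (p * p)"
  define A where "A = L (p * p) / L (u * u)"
  define P where "P = opoly (Suc (Suc n))"
  have P: "P = [:- B, 1:] * p - smult A u"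
    by (simp add: P_def B_def A_def p_def u_def)
  from 3 have p: "degree p = Suc n" "coeff p (Suc n) = 1" "\<And>q. degree q < Suc n \<Longrightarrow> L (p * q) = 0"
    and u: "degree u = n" "coeff u n = 1" "\<And>q. degree q < n \<Longrightarrow> L (u * q) = 0"
    by (auto simp: p_def u_def)
  have pp: "L (p * p) \<noteq> 0" and uu: "L (u * u) \<noteq> 0"
    using L_pos[of p] L_pos[of u] p u by fastforce+
  have P2: "P = [:0, 1:] * p - smult B p - smult A u"
    by (simp add: P)
  have cP: "coeff P (Suc (Suc n)) = 1"
    unfolding P2 using p u by (simp add: coeff_eq_0)
  have "degree P \<le> Suc (Suc n)"
    unfolding P using p(1) u(1)
    by (intro degree_diff_le order.trans[OF degree_mult_le]) (auto intro: order.trans[OF degree_smult_le])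
  with cP have dP: "degree P = Suc (Suc n)"
    by (metis le_antisym le_degree zero_neq_one)
  have LP: "L (P * q) = L (p * ([:0, 1:] * q)) - B * L (p * q) - A * L (u * q)" for q
  proof -
    have "P * q = p * ([:0, 1:] * q) - smult B (p * q) - smult A (u * q)"
      unfolding P2 by (simp add: algebra_simps)
    then show ?thesis by (simp add: L_diff L_smult)
  qed
  have up: "L (u * p) = 0" "L (p * u) = 0" using p(3)[of u] u(1) by (simp_all add: mult.commute)
  have LPp: "L (P * p) = 0"
    unfolding LP using up pp by (simp add: B_def mult.left_commute)
  \<comment> \<open>x u is monic of degree \<open>Suc n\<close>, hence equals \<open>p\<close> up to
    lower degree. This gives \<open>L (p * p)\<close> for its product with \<open>p\<close>, the
    value for which \<open>A\<close> was chosen.\<close>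
  have "degree ([:0, 1:] * u) \<le> Suc n" using u(1) by (simp add: degree_pCons_le)
  then obtain c r where cr: "[:0, 1:] * u = smult c p + r" "r = 0 \<or> degree r < Suc n"
    using degree_split[OF p(1,2)] by blast
  have "coeff ([:0, 1:] * u) (Suc n) = 1" using u by simp
  moreover have "coeff r (Suc n) = 0" using cr(2) by (auto simp: coeff_eq_0)
  ultimately have c1: "c = 1" using p(2) unfolding cr(1) by simp
  have "L (p * ([:0, 1:] * u)) = L (p * p)"
  proof -
    have "p * ([:0, 1:] * u) = p * p + p * r" unfolding cr(1) c1 by (simp add: algebra_simps)
    then show ?thesis using cr(2) p(3)[of r] by (auto simp: L_add)
  qed
  then have LPu: "L (P * u) = 0"
    unfolding LP using up uu by (simp add: A_def)
  have "L (P * q) = 0" if q: "degree q < Suc (Suc n)" for q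
  proof -
    from q have "degree q \<le> Suc n" by simp
    then obtain c1 r1 where 1: "q = smult c1 p + r1" "r1 = 0 \<or> degree r1 < Suc n"
      using degree_split[OF p(1,2)] by blast
    then have "degree r1 \<le> n" by auto
    then obtain c2 r2 where 2: "r1 = smult c2 u + r2" "r2 = 0 \<or> degree r2 < n"
      using degree_split[OF u(1,2)] by blast
    have "L (P * r2) = 0"
    proof (cases "r2 = 0")
      case False
      then have d: "degree r2 < n" using 2 by simp
      then have "degree ([:0, 1:] * r2) < Suc n" by (simp add: degree_pCons_eq_if)
      then have "L (p * ([:0, 1:] * r2)) = 0" by (rule p(3))
      moreover have "L (p * r2) = 0" using d by (intro p(3)) simp
      moreover have "L (u * r2) = 0" using d by (rule u(3))
      ultimately show ?thesis unfolding LP by (simp only: mult_zero_right diff_self)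
    qed simp
    then show ?thesis
      unfolding 1(1) 2(1) by (simp add: distrib_left L_add L_smult LPp LPu)
  qed
  then show ?case using cP dP unfolding P_def by blast
qed

lemma degree_opoly [simp]: "degree (opoly n) = n"
  and coeff_opoly [simp]: "coeff (opoly n) n = 1"
  and opoly_orthogonal: "degree q < n \<Longrightarrow> L (opoly n * q) = 0"
  using opoly_aux by blast+

lemma opoly_nonzero [simp]: "opoly n \<noteq> 0"
  using coeff_opoly[of n] by fastforce

lemma hnorm_pos: "hnorm n > 0"
  unfolding hnorm_def by (rule L_pos) simp

lemma opoly_orthogonal':
  assumes "m \<noteq> n" shows "L (opoly m * opoly n) = 0"
  using assms opoly_orthogonal[of "opoly n" m] opoly_orthogonal[of "opoly m" n]
  by (cases m n rule: linorder_cases) (auto simp: mult.commute)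

text \<open>The tool for identifying polynomials that arise from differentiation: orthogonality to
  all lower degrees replaces any explicit formula, and only one coefficient has to be
  computed.\<close>

lemma opoly_unique:
  assumes "degree q \<le> n" "\<And>r. degree r < n \<Longrightarrow> L (q * r) = 0"
  shows "q = smult (coeff q n) (opoly n)"
proof -
  obtain c r where cr: "q = smult c (opoly n) + r" "r = 0 \<or> degree r < n"
    using degree_split[of "opoly n" n q] assms(1) by auto
  have "r = 0"
  proof (rule ccontr)
    assume r: "r \<noteq> 0"
    then have "degree r < n" using cr by auto
    then have "L (q * r) = 0" "L (opoly n * r) = 0" using assms opoly_orthogonal by auto
    then have "L (r * r) = 0" unfolding cr(1) by (simp add: distrib_right L_add L_smult)
    then show False using L_pos[OF r] by simp
  qed
  then show ?thesis using cr(1) by simp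
qed

lemma L_mult_opoly:
  assumes "degree q \<le> n" shows "L (opoly n * q) = coeff q n * hnorm n"
proof -
  obtain c r where cr: "q = smult c (opoly n) + r" "r = 0 \<or> degree r < n"
    using degree_split[of "opoly n" n q] assms(1) by auto
  have "coeff r n = 0" using cr(2) by (auto simp: coeff_eq_0)
  then have "coeff q n = c" unfolding cr(1) by simp
  moreover have "L (opoly n * q) = c * hnorm n"
    unfolding cr(1) using cr(2) opoly_orthogonal[of r n] by (auto simp: distrib_left L_add L_smult hnorm_def)
  ultimately show ?thesis by simp
qed

lemma opoly_recurrence:
  obtains B where
    "[:0, 1:] * opoly (Suc n) = opoly (Suc (Suc n)) + smult B (opoly (Suc n)) + smult (hnorm (Suc n) / hnorm n) (opoly n)"
proof -
  define B where "B = L ([:0, 1:] * (opoly (Suc n) * opoly (Suc n))) / L (opoly (Suc n) * opoly (Suc n))"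
  have "[:0, 1:] * opoly (Suc n) = opoly (Suc (Suc n)) + smult B (opoly (Suc n)) + smult (hnorm (Suc n) / hnorm n) (opoly n)"
    by (simp add: B_def hnorm_def)
  then show ?thesis using that by blast
qed

definition cd_kernel :: "nat \<Rightarrow> real \<Rightarrow> real \<Rightarrow> real" where
  "cd_kernel n x y = (\<Sum>k<n. poly (opoly k) x * poly (opoly k) y / hnorm k)"

text \<open>The recurrence makes the sum telescope; its diagonal coefficient cancels by
  antisymmetry. Keeping the factor x - y on the left avoids a division on the diagonal.\<close>

lemma christoffel_darboux:
  "(x - y) * cd_kernel (Suc n) x y * hnorm n =
     poly (opoly (Suc n)) x * poly (opoly n) y - poly (opoly n) x * poly (opoly (Suc n)) y"
proof (induction n)
  case 0
  have "hnorm 0 \<noteq> 0" using hnorm_pos[of 0] by simp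
  then show ?case by (simp add: cd_kernel_def)
next
  case (Suc n)
  let ?p = "\<lambda>k. poly (opoly k)"
  obtain B where B: "[:0, 1:] * opoly (Suc n) = opoly (Suc (Suc n)) + smult B (opoly (Suc n)) + smult (hnorm (Suc n) / hnorm n) (opoly n)"
    by (rule opoly_recurrence)
  have rec: "t * ?p (Suc n) t = ?p (Suc (Suc n)) t + B * ?p (Suc n) t + hnorm (Suc n) / hnorm n * ?p n t" for t
    using arg_cong[OF B, of "\<lambda>q. poly q t"] by simp
  have h: "hnorm n > 0" "hnorm (Suc n) > 0" by (rule hnorm_pos)+
  have "(x - y) * cd_kernel (Suc (Suc n)) x y * hnorm (Suc n) =
     hnorm (Suc n) / hnorm n * ((x - y) * cd_kernel (Suc n) x y * hnorm n) + (x - y) * ?p (Suc n) x * ?p (Suc n) y"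
    using h by (simp add: cd_kernel_def field_simps)
  also have "\<dots> = hnorm (Suc n) / hnorm n * (?p (Suc n) x * ?p n y - ?p n x * ?p (Suc n) y)
      + (x * ?p (Suc n) x) * ?p (Suc n) y - ?p (Suc n) x * (y * ?p (Suc n) y)"
    unfolding Suc by (simp add: algebra_simps)
  also have "\<dots> = ?p (Suc (Suc n)) x * ?p (Suc n) y - ?p (Suc n) x * ?p (Suc (Suc n)) y"
    unfolding rec by (simp add: algebra_simps)
  finally show ?case .
qed

end

section \<open>Jacobi polynomials\<close>

locale jacobi =
  fixes \<alpha> \<beta> :: nat
begin

text \<open>\<open>\<alpha>\<close> is the exponent at -1 and \<open>\<beta>\<close> the exponent at
  1, the reverse of the usual naming for Jacobi polynomials. With natural exponents the weight is
  itself a polynomial, so products, derivatives and integrals of it need no further theory.\<close>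

definition W :: "real poly" where
  "W = [:1, 1:] ^ \<alpha> * [:1, -1:] ^ \<beta>"

definition ip :: "real poly \<Rightarrow> real" where
  "ip p = integral {-1..1} (\<lambda>x. poly p x * poly W x)"

abbreviation \<sigma> :: "real poly" where "\<sigma> \<equiv> [:1, 0, -1:]"

text \<open>The Pearson polynomial: the derivative of \<open>\<sigma> * W\<close> is
  \<open>\<tau> * W\<close>.\<close>

definition \<tau> :: "real poly" where "\<tau> = [:real \<alpha> - real \<beta>, - (real \<alpha> + real \<beta> + 2):]"

text \<open>\<open>\<sigma>\<close> times the logarithmic derivative of the square root of the
  weight; it is what the half density contributes when a weighted polynomial is
  differentiated.\<close>

definition \<theta> :: "real poly" where "\<theta> = smult (1 / 2) [:real \<alpha> - real \<beta>, - (real \<alpha> + real \<beta>):]"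

lemma poly_W: "poly W x = (1 + x) ^ \<alpha> * (1 - x) ^ \<beta>"
  by (simp add: W_def)

lemma W_nonneg: "x \<in> {-1..1} \<Longrightarrow> poly W x \<ge> 0"
  by (simp add: poly_W)

lemma W_pos: "x \<in> {-1<..<1} \<Longrightarrow> poly W x > 0"
  by (simp add: poly_W)

lemma integrable_poly: "(\<lambda>x. poly (p::real poly) x * poly q x) integrable_on {a..b}"
  by (intro integrable_continuous_real continuous_intros)

lemma W_nonzero: "W \<noteq> 0"
  using W_pos[of 0] by auto

lemma ip_pos:
  assumes "p \<noteq> 0" shows "ip (p * p) > 0"
proof -
  let ?f = "\<lambda>x. poly (p * p) x * poly W x"
  have int: "(?f has_integral ip (p * p)) (cbox (-1) 1)"
    unfolding ip_def by (simp add: integrable_integral integrable_poly del: poly_mult)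
  have nn: "\<And>x. x \<in> {-1..1} \<Longrightarrow> ?f x \<ge> 0" using W_nonneg by simp
  have "ip (p * p) \<ge> 0" unfolding ip_def
    by (intro integral_nonneg integrable_poly) (use nn in auto)
  moreover have "ip (p * p) \<noteq> 0"
  proof
    assume 0: "ip (p * p) = 0"
    have "?f x = 0" if x: "x \<in> {-1..1}" for x
    proof (rule has_integral_0_cbox_imp_0[of "-1" 1 ?f x])
      show "continuous_on (cbox (-1) 1) ?f" by (intro continuous_intros)
    qed (use int nn x 0 in auto)
    then have "poly (p * p * W) x = 0" if "x \<in> {-1..1}" for x
      using that by simp
    then have "{-1..1} \<subseteq> {x. poly (p * p * W) x = 0}" by blast
    moreover have "finite {x. poly (p * p * W) x = 0}"
      using assms W_nonzero by (intro poly_roots_finite) auto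
    ultimately have "finite {-1..1::real}" by (rule finite_subset)
    then show False by (simp add: infinite_Icc)
  qed
  ultimately show ?thesis by simp
qed

sublocale positive_functional ip
proof
  show "ip (p + q) = ip p + ip q" for p q
    unfolding ip_def by (simp add: distrib_right integral_add integrable_poly)
  show "ip (smult c p) = c * ip p" for c p
    unfolding ip_def by (simp add: mult.assoc)
  show "p \<noteq> 0 \<Longrightarrow> ip (p * p) > 0" for p by (rule ip_pos)
qed

lemma pderiv_W: "\<sigma> * pderiv W = smult 2 \<theta> * W"
proof -
  let ?a = "[:1, 1:] :: real poly" and ?b = "[:1, -1:] :: real poly"
  have a: "?a * pderiv (?a ^ \<alpha>) = smult (real \<alpha>) (?a ^ \<alpha>)"
    unfolding pderiv_power by (cases \<alpha>) (simp_all add: pderiv_pCons mult.commute)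
  have b: "?b * pderiv (?b ^ \<beta>) = smult (- real \<beta>) (?b ^ \<beta>)"
    unfolding pderiv_power by (cases \<beta>) (simp_all add: pderiv_pCons mult.commute flip: smult_minus_left)
  have "\<sigma> = ?a * ?b" by simp
  then have "\<sigma> * pderiv W = ?b * ?b ^ \<beta> * (?a * pderiv (?a ^ \<alpha>)) + ?a * ?a ^ \<alpha> * (?b * pderiv (?b ^ \<beta>))"
    unfolding W_def pderiv_mult by (simp only: algebra_simps)
  also have "\<dots> = (smult (real \<alpha>) ?b + smult (- real \<beta>) ?a) * W"
  proof -
    have "?b * ?b ^ \<beta> * smult (real \<alpha>) (?a ^ \<alpha>) + ?a * ?a ^ \<alpha> * smult (- real \<beta>) (?b ^ \<beta>)
       = smult (real \<alpha>) (?b * (?a ^ \<alpha> * ?b ^ \<beta>)) + smult (- real \<beta>) (?a * (?a ^ \<alpha> * ?b ^ \<beta>))"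
      by (simp only: mult_smult_left mult_smult_right ac_simps)
    then show ?thesis unfolding a b W_def by (simp only: distrib_right mult_smult_left)
  qed
  also have "smult (real \<alpha>) ?b + smult (- real \<beta>) ?a = smult 2 \<theta>"
    by (simp add: \<theta>_def del: smult_pCons) simp
  finally show ?thesis .
qed

lemma tau_theta: "\<tau> = smult 2 \<theta> + pderiv \<sigma>"
  by (simp add: \<tau>_def \<theta>_def pderiv_pCons smult_smult del: smult_pCons)

text \<open>By the Pearson relation the integrand is the derivative of
  \<open>\<sigma> * W * p\<close>, and \<open>\<sigma>\<close> vanishes at both endpoints whatever
  the exponents are.\<close>

lemma ip_parts: "ip (\<sigma> * pderiv p + \<tau> * p) = 0"
proof -
  have "(\<sigma> * pderiv p + \<tau> * p) * W = pderiv (\<sigma> * W * p)"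
  proof -
    have "pderiv (\<sigma> * W * p) = \<sigma> * W * pderiv p + p * (pderiv \<sigma> * W + \<sigma> * pderiv W)"
      by (simp only: pderiv_mult algebra_simps)
    then show ?thesis unfolding pderiv_W tau_theta by (simp only: algebra_simps)
  qed
  then have *: "poly (\<sigma> * pderiv p + \<tau> * p) x * poly W x = poly (pderiv (\<sigma> * W * p)) x" for x
    by (metis poly_mult)
  have "(poly (pderiv (\<sigma> * W * p)) has_integral poly (\<sigma> * W * p) 1 - poly (\<sigma> * W * p) (-1)) {-1..1}"
    by (intro fundamental_theorem_of_calculus)
       (auto simp del: poly_mult simp flip: has_real_derivative_iff_has_vector_derivative
          intro!: poly_DERIV DERIV_subset[OF poly_DERIV])
  then show ?thesis unfolding ip_def * by (simp add: integral_unique)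
qed

section \<open>The Jacobi differential operator, its eigenvalues and the ladder relation\<close>

definition J :: "real poly \<Rightarrow> real poly" where
  "J p = \<sigma> * pderiv (pderiv p) + \<tau> * pderiv p"

lemma coeff_J:
  "coeff (J p) j = real (j + 2) * real (j + 1) * coeff p (j + 2) + (real \<alpha> - real \<beta>) * real (j + 1) * coeff p (j + 1)
     - real j * (real j + real \<alpha> + real \<beta> + 1) * coeff p j"
proof -
  consider "j = 0" | "j = 1" | k where "j = Suc (Suc k)"
    by (cases j; cases "j - 1") auto
  then show ?thesis
    by cases (simp_all add: J_def \<tau>_def coeff_pCons coeff_pderiv algebra_simps numeral_2_eq_2)
qed

lemma degree_J: "degree (J p) \<le> degree p"
  by (rule degree_le) (auto simp: coeff_J coeff_eq_0)

text \<open>Integration by parts brings both sides to the symmetric form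
  \<open>- ip (\<sigma> * pderiv p * pderiv q)\<close>.\<close>

lemma ip_J: "ip (J p * q) = ip (p * J q)"
proof -
  have 1: "ip (J p * q) = - ip (\<sigma> * pderiv p * pderiv q)" for p q
  proof -
    have "J p * q = \<sigma> * pderiv (pderiv p * q) + \<tau> * (pderiv p * q) - \<sigma> * pderiv p * pderiv q"
      unfolding J_def pderiv_mult by (simp only: algebra_simps)
    then show ?thesis using ip_parts[of "pderiv p * q"] by (simp only: L_diff)
  qed
  show ?thesis using 1[of p q] 1[of q p] by (simp only: ac_simps)
qed

text \<open>The operator is symmetric and does not raise degrees, so its value at
  \<open>opoly n\<close> is again orthogonal to all lower degrees; the eigenvalue is then read off
  from the leading coefficient.\<close>

lemma jacobi_ode: "J (opoly n) = smult (- (real n * (real n + real \<alpha> + real \<beta> + 1))) (opoly n)"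
proof -
  have "J (opoly n) = smult (coeff (J (opoly n)) n) (opoly n)"
  proof (rule opoly_unique)
    show "degree (J (opoly n)) \<le> n" using degree_J[of "opoly n"] by simp
    show "ip (J (opoly n) * r) = 0" if "degree r < n" for r
      unfolding ip_J using degree_J[of r] that by (intro opoly_orthogonal) simp
  qed
  also have "coeff (J (opoly n)) n = - (real n * (real n + real \<alpha> + real \<beta> + 1))"
    by (simp add: coeff_J coeff_eq_0)
  finally show ?thesis .
qed

definition \<kappa> :: "nat \<Rightarrow> real" where "\<kappa> n = real n + (real \<alpha> + real \<beta>) / 2"

text \<open>Integration by parts shows that the left side, once its component along
  \<open>opoly (Suc m)\<close> is removed, is orthogonal to all degrees below m, hence a multiple of
  \<open>opoly m\<close>. The number \<open>e\<close> stays implicit because it cancels in the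
  antisymmetric expression where the relation is applied.\<close>

lemma jacobi_ladder:
  obtains e where
    "\<sigma> * pderiv (opoly (Suc m)) + [:0, real (Suc m):] * opoly (Suc m)
       = smult e (opoly (Suc m)) + smult ((2 * \<kappa> (Suc m) + 1) * hnorm (Suc m) / hnorm m) (opoly m)"
proof -
  define P where "P = opoly (Suc m)"
  \<comment> \<open>The term \<open>\<sigma> * pderiv P\<close> has coefficient - (m + 1) in degree
    m + 2; the multiple of x \<open>P\<close> removes it. Subtracting \<open>smult e P\<close>
    afterwards removes degree m + 1.\<close>
  define q where "q = \<sigma> * pderiv P + [:0, real (Suc m):] * P"
  define e where "e = coeff q (Suc m)"
  define q1 where "q1 = q - smult e P"
  have dP: "degree P = Suc m" "coeff P (Suc m) = 1" by (simp_all add: P_def)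
  have cq: "coeff q j = real (j + 1) * coeff P (j + 1) + (real (Suc m) - real (j - 1)) * coeff P (j - 1)" if "j \<noteq> 0" for j
    using that by (cases j; cases "j - 1") (auto simp: q_def coeff_pCons coeff_pderiv algebra_simps)
  have "coeff q j = 0" if "j > Suc m" for j
    using that by (cases "j = Suc (Suc m)") (auto simp: cq dP coeff_eq_0)
  then have "degree q \<le> Suc m" by (intro degree_le) auto
  then have "coeff q1 j = 0" if "j > m" for j
    using that dP by (cases "j = Suc m") (auto simp: q1_def e_def coeff_eq_0)
  then have dq1: "degree q1 \<le> m" by (intro degree_le) auto
  have Lq1: "ip (q1 * r) = (real (Suc m) + real m + real \<alpha> + real \<beta> + 2) * coeff r m * hnorm (Suc m)"
    if r: "degree r \<le> m" for r
  proof -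
    have "degree (\<sigma> * pderiv r + \<tau> * r) \<le> Suc m"
      using r by (intro degree_le) (auto simp: \<tau>_def coeff_pCons coeff_pderiv coeff_eq_0 split: nat.splits)
    then have "ip (P * (\<sigma> * pderiv r + \<tau> * r)) = coeff (\<sigma> * pderiv r + \<tau> * r) (Suc m) * hnorm (Suc m)"
      unfolding P_def by (rule L_mult_opoly)
    also have "coeff (\<sigma> * pderiv r + \<tau> * r) (Suc m) = - (real m + real \<alpha> + real \<beta> + 2) * coeff r m"
      using r by (cases m) (auto simp: \<tau>_def coeff_pCons coeff_pderiv coeff_eq_0 algebra_simps)
    finally have 1: "ip (P * (\<sigma> * pderiv r + \<tau> * r)) = - (real m + real \<alpha> + real \<beta> + 2) * coeff r m * hnorm (Suc m)" .
    have "degree ([:0, 1:] * r) \<le> Suc m" using r by (simp add: degree_pCons_le)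
    then have 2: "ip (P * ([:0, 1:] * r)) = coeff r m * hnorm (Suc m)"
      unfolding P_def by (subst L_mult_opoly) auto
    have 3: "ip (P * r) = 0" unfolding P_def using r by (intro opoly_orthogonal) simp
    have "q1 * r = (\<sigma> * pderiv (P * r) + \<tau> * (P * r)) - P * (\<sigma> * pderiv r + \<tau> * r)
         + smult (real (Suc m)) (P * ([:0, 1:] * r)) - smult e (P * r)"
    proof -
      have "[:0, real (Suc m):] = smult (real (Suc m)) [:0, 1:]" by simp
      then show ?thesis unfolding q1_def q_def pderiv_mult
        by (simp only: algebra_simps mult_smult_left mult_smult_right)
    qed
    then show ?thesis using 1 2 3 ip_parts[of "P * r"]
      by (simp only: L_diff L_add L_smult) (simp add: algebra_simps)
  qed
  have "q1 = smult (coeff q1 m) (opoly m)"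
    by (rule opoly_unique[OF dq1]) (simp add: Lq1 coeff_eq_0)
  moreover have "coeff q1 m * hnorm m = (2 * \<kappa> (Suc m) + 1) * hnorm (Suc m)"
    using L_mult_opoly[OF dq1] Lq1[of "opoly m"] by (simp add: \<kappa>_def mult.commute field_simps)
  then have "coeff q1 m = (2 * \<kappa> (Suc m) + 1) * hnorm (Suc m) / hnorm m"
    using hnorm_pos[of m] by (simp add: field_simps)
  ultimately have "q = smult e P + smult ((2 * \<kappa> (Suc m) + 1) * hnorm (Suc m) / hnorm m) (opoly m)"
    unfolding q1_def by (metis add.commute diff_add_cancel)
  then show ?thesis using that unfolding q_def P_def by blast
qed

section \<open>The kernel in terms of one polynomial, and the second order equation\<close>

definition Dpoly :: "nat \<Rightarrow> real poly" where
  "Dpoly n = \<sigma> * pderiv (opoly n) + \<theta> * opoly n"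

text \<open>The ladder relation trades \<open>opoly (n - 1)\<close> for \<open>Dpoly n\<close>.
  Constant multiples of \<open>opoly n\<close> drop out of the antisymmetric difference; the
  multiples of x, with slope - n from the ladder and - (\<alpha> + \<beta>) / 2 from
  \<open>\<theta>\<close>, leave the last term with factor \<open>\<kappa> n\<close>.\<close>

lemma cd_kernel_Dpoly:
  assumes "n \<ge> 1"
  shows "(2 * \<kappa> n + 1) * hnorm n * ((x - y) * cd_kernel n x y) =
     poly (opoly n) x * poly (Dpoly n) y - poly (Dpoly n) x * poly (opoly n) y
       - \<kappa> n * (x - y) * poly (opoly n) x * poly (opoly n) y"
proof -
  obtain m where n: "n = Suc m" using assms by (cases n) auto
  obtain e where e: "\<sigma> * pderiv (opoly (Suc m)) + [:0, real (Suc m):] * opoly (Suc m)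
       = smult e (opoly (Suc m)) + smult ((2 * \<kappa> (Suc m) + 1) * hnorm (Suc m) / hnorm m) (opoly m)"
    by (rule jacobi_ladder)
  let ?g = "(2 * \<kappa> (Suc m) + 1) * hnorm (Suc m) / hnorm m"
  have h: "hnorm m > 0" by (rule hnorm_pos)
  have D: "poly (Dpoly n) t = (e - real n * t) * poly (opoly n) t + ?g * poly (opoly m) t + poly \<theta> t * poly (opoly n) t" for t
    using arg_cong[OF e, of "\<lambda>q. poly q t"] unfolding Dpoly_def n by (simp add: algebra_simps)
  have "(2 * \<kappa> n + 1) * hnorm n * ((x - y) * cd_kernel n x y) = ?g * ((x - y) * cd_kernel (Suc m) x y * hnorm m)"
    using h n by (simp add: field_simps)
  also have "\<dots> = ?g * (poly (opoly n) x * poly (opoly m) y - poly (opoly m) x * poly (opoly n) y)"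
    unfolding christoffel_darboux n ..
  also have "\<dots> = poly (opoly n) x * poly (Dpoly n) y - poly (Dpoly n) x * poly (opoly n) y
       - \<kappa> n * (x - y) * poly (opoly n) x * poly (opoly n) y"
    unfolding D by (simp add: \<theta>_def \<kappa>_def algebra_simps diff_divide_distrib add_divide_distrib)
  finally show ?thesis .
qed

text \<open>Together with \<open>radius2\<close>, the result of completing the square in the
  potential of the differential equation: midpoint and squared half length of the interval of
  oscillation. Their limits are (a + b) / 2 and ((b - a) / 2)^2.\<close>

definition center :: "nat \<Rightarrow> real" where
  "center n = (real \<alpha> - real \<beta>) * (real \<alpha> + real \<beta>) / (4 * (\<kappa> n)\<^sup>2)"

definition radius2 :: "nat \<Rightarrow> real" where
  "radius2 n = (center n)\<^sup>2 + (real n * (real n + real \<alpha> + real \<beta>) - (real \<alpha> - real \<beta>)\<^sup>2 / 4) / (\<kappa> n)\<^sup>2"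

text \<open>The eigenvalue equation as a first order system. The potential is split into a part with
  \<open>(\<kappa> n)^2\<close>, which governs the limit, and a part with \<open>\<kappa> n\<close>,
  which becomes an error term; the square is completed with the help of n (n + \<alpha> + \<beta>) +
  (\<alpha> + \<beta>)^2 / 4 = \<open>(\<kappa> n)^2\<close>.\<close>

lemma Dpoly_ode:
  assumes "n \<ge> 1"
  shows "(1 - x\<^sup>2) * poly (pderiv (Dpoly n)) x + poly \<theta> x * poly (Dpoly n) x =
     - ((\<kappa> n)\<^sup>2 * (radius2 n - (x - center n)\<^sup>2) + \<kappa> n * (1 - x\<^sup>2)) * poly (opoly n) x"
proof -
  let ?l = "real n * (real n + real \<alpha> + real \<beta> + 1)"
  let ?P = "opoly n"
  have k: "\<kappa> n > 0" using assms by (simp add: \<kappa>_def add_pos_nonneg)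
  have "\<sigma> * pderiv (Dpoly n) + \<theta> * Dpoly n = \<sigma> * J ?P + (\<sigma> * pderiv \<theta> + \<theta> * \<theta>) * ?P"
  proof -
    have "\<tau> = \<theta> + \<theta> + pderiv \<sigma>" unfolding tau_theta by (metis one_add_one smult_1_left smult_add_left)
    then show ?thesis unfolding Dpoly_def J_def pderiv_mult pderiv_add by (simp only: algebra_simps)
  qed
  also have "\<dots> = \<sigma> * smult (- ?l) ?P + (\<sigma> * pderiv \<theta> + \<theta> * \<theta>) * ?P" unfolding jacobi_ode ..
  finally have *: "(1 - x\<^sup>2) * poly (pderiv (Dpoly n)) x + poly \<theta> x * poly (Dpoly n) x
     = (- ?l * (1 - x\<^sup>2) + (1 - x\<^sup>2) * poly (pderiv \<theta>) x + (poly \<theta> x)\<^sup>2) * poly ?P x"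
    by (drule_tac arg_cong[of _ _ "\<lambda>q. poly q x"]) (simp add: algebra_simps power2_eq_square)
  have c: "(\<kappa> n)\<^sup>2 * center n = (real \<alpha> - real \<beta>) * (real \<alpha> + real \<beta>) / 4"
    using k by (simp add: center_def)
  have r: "(\<kappa> n)\<^sup>2 * radius2 n = (\<kappa> n)\<^sup>2 * (center n)\<^sup>2 + (real n * (real n + real \<alpha> + real \<beta>) - (real \<alpha> - real \<beta>)\<^sup>2 / 4)"
    using k by (simp add: radius2_def distrib_left)
  have "(\<kappa> n)\<^sup>2 * (radius2 n - (x - center n)\<^sup>2) = (\<kappa> n)\<^sup>2 * radius2 n - (\<kappa> n)\<^sup>2 * x\<^sup>2 + 2 * x * ((\<kappa> n)\<^sup>2 * center n) - (\<kappa> n)\<^sup>2 * (center n)\<^sup>2"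
    by (simp add: algebra_simps power2_eq_square)
  also have "\<dots> = (real n * (real n + real \<alpha> + real \<beta>) - (real \<alpha> - real \<beta>)\<^sup>2 / 4) - (\<kappa> n)\<^sup>2 * x\<^sup>2
      + 2 * x * ((real \<alpha> - real \<beta>) * (real \<alpha> + real \<beta>) / 4)"
    unfolding c r by simp
  finally have "(\<kappa> n)\<^sup>2 * (radius2 n - (x - center n)\<^sup>2) + \<kappa> n * (1 - x\<^sup>2)
     = ?l * (1 - x\<^sup>2) - (1 - x\<^sup>2) * poly (pderiv \<theta>) x - (poly \<theta> x)\<^sup>2"
    by (simp add: \<kappa>_def \<theta>_def pderiv_pCons power2_eq_square field_simps)
  then have "- ?l * (1 - x\<^sup>2) + (1 - x\<^sup>2) * poly (pderiv \<theta>) x + (poly \<theta> x)\<^sup>2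
     = - ((\<kappa> n)\<^sup>2 * (radius2 n - (x - center n)\<^sup>2) + \<kappa> n * (1 - x\<^sup>2))"
    by (simp only: minus_add_distrib mult_minus_left)
  then show ?thesis unfolding * by (rule arg_cong)
qed

definition phi :: "nat \<Rightarrow> real \<Rightarrow> real" where
  "phi n x = sqrt (poly W x / hnorm n) * poly (opoly n) x"

definition dphi :: "nat \<Rightarrow> real \<Rightarrow> real" where
  "dphi n x = sqrt (poly W x / hnorm n) * poly (Dpoly n) x"

text \<open>Stated for an arbitrary polynomial so that it serves twice: with \<open>opoly n\<close>
  the bracket is \<open>Dpoly n\<close>, and with \<open>Dpoly n\<close> it is the left side of
  \<open>Dpoly_ode\<close>. The endpoints are excluded since the square root of the weight need not
  be differentiable there.\<close>

lemma DERIV_weight: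
  assumes "x \<in> {-1<..<1}"
  shows "((\<lambda>x. sqrt (poly W x / hnorm n) * poly p x) has_real_derivative
     sqrt (poly W x / hnorm n) * ((1 - x\<^sup>2) * poly (pderiv p) x + poly \<theta> x * poly p x) / (1 - x\<^sup>2)) (at x)"
proof -
  define w where "w = poly W x / hnorm n"
  have w: "w > 0" unfolding w_def using W_pos[OF assms] hnorm_pos by (rule divide_pos_pos)
  have s: "1 - x\<^sup>2 > 0"
  proof -
    have "0 < (1 - x) * (1 + x)" using assms by (intro mult_pos_pos) auto
    then show ?thesis by (simp add: algebra_simps power2_eq_square)
  qed
  have "(1 - x\<^sup>2) * poly (pderiv W) x = 2 * poly \<theta> x * poly W x"
    using arg_cong[OF pderiv_W, of "\<lambda>q. poly q x"] by (simp add: algebra_simps power2_eq_square)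
  then have W': "poly (pderiv W) x / hnorm n = 2 * poly \<theta> x * w / (1 - x\<^sup>2)"
  proof -
    assume "(1 - x\<^sup>2) * poly (pderiv W) x = 2 * poly \<theta> x * poly W x"
    then have "poly (pderiv W) x = 2 * poly \<theta> x * poly W x / (1 - x\<^sup>2)"
      using s by (subst nonzero_eq_divide_eq) (auto simp: mult.commute)
    then show ?thesis by (simp add: w_def)
  qed
  have "((\<lambda>x. poly W x / hnorm n) has_real_derivative poly (pderiv W) x / hnorm n) (at x)"
    by (intro DERIV_cdivide poly_DERIV)
  from DERIV_chain2[where g = "\<lambda>x. poly W x / hnorm n" and x = x, OF DERIV_real_sqrt[OF w[unfolded w_def]] this[unfolded W']]
  have "((\<lambda>x. sqrt (poly W x / hnorm n)) has_real_derivative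
      inverse (sqrt w) / 2 * (2 * poly \<theta> x * w / (1 - x\<^sup>2))) (at x)"
    by (simp only: w_def)
  also have "inverse (sqrt w) / 2 * (2 * poly \<theta> x * w / (1 - x\<^sup>2)) = poly \<theta> x / (1 - x\<^sup>2) * (w / sqrt w)"
    by (simp only: divide_inverse inverse_mult_distrib ac_simps) simp
  also have "w / sqrt w = sqrt w"
    by (rule real_div_sqrt[OF less_imp_le[OF w]])
  finally have 1: "((\<lambda>x. sqrt (poly W x / hnorm n)) has_real_derivative poly \<theta> x / (1 - x\<^sup>2) * sqrt w) (at x)" .
  have 2: "c / t * q * y + y' * q = q * (t * y' + c * y) / t" if "t \<noteq> 0" for c t q y y' :: real
    using that by (simp add: field_simps)
  show ?thesis
    using DERIV_mult[OF 1 poly_DERIV[of p x]] s unfolding w_def[symmetric] by (simp only: 2[OF less_imp_neq[OF s, symmetric]])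
qed

end

section \<open>The oscillator equation\<close>

text \<open>Below, \<open>\<phi>\<close> is the weighted orthonormal Jacobi polynomial of degree \<open>n\<close>,
  \<open>\<kappa> = n + (\<alpha> + \<beta>) / 2\<close>, and \<open>\<rho> - (x - m)\<^sup>2\<close> is the finite \<open>N\<close> form
  of \<open>(x - a) (b - x)\<close>.\<close>

locale oscillator =
  fixes \<phi> D :: "real \<Rightarrow> real" and \<kappa> m \<rho> :: real
  assumes kappa_pos: "\<kappa> > 0"
    and phi_deriv: "x \<in> {-1<..<1} \<Longrightarrow> (\<phi> has_real_derivative D x / (1 - x\<^sup>2)) (at x)"
    and D_deriv: "x \<in> {-1<..<1} \<Longrightarrow>
      (D has_real_derivative - (\<kappa>\<^sup>2 * (\<rho> - (x - m)\<^sup>2) + \<kappa> * (1 - x\<^sup>2)) * \<phi> x / (1 - x\<^sup>2)) (at x)"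
    and phi_cont: "continuous_on {-1..1} \<phi>"
    and D_cont: "continuous_on {-1..1} D"
    and phi_ends: "\<phi> (-1) = 0" "\<phi> 1 = 0"
    and D_ends: "D (-1) = 0" "D 1 = 0"
    and phi_norm: "integral {-1..1} (\<lambda>x. (\<phi> x)\<^sup>2) = 1"
begin

text \<open>Kinetic plus potential energy in the time t with dt = dx / (1 - x^2), for the leading
  part of the potential only; the part of order \<open>\<kappa>\<close> resurfaces as the term with
  \<open>\<phi> x * D x\<close> in \<open>E_deriv\<close>.\<close>

definition E :: "real \<Rightarrow> real" where
  "E x = (D x)\<^sup>2 + \<kappa>\<^sup>2 * (\<rho> - (x - m)\<^sup>2) * (\<phi> x)\<^sup>2"

lemma derivs:
  assumes "x \<in> {-1<..<1}"
  obtains p d where "(\<phi> has_real_derivative p) (at x)" "(D has_real_derivative d) (at x)"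
    "D x = (1 - x\<^sup>2) * p" "(1 - x\<^sup>2) * d = - (\<kappa>\<^sup>2 * (\<rho> - (x - m)\<^sup>2) + \<kappa> * (1 - x\<^sup>2)) * \<phi> x"
proof -
  have "0 < (1 - x) * (1 + x)" using assms by (intro mult_pos_pos) auto
  then have s: "1 - x\<^sup>2 \<noteq> 0" by (simp add: algebra_simps power2_eq_square)
  show ?thesis
    by (rule that[OF phi_deriv[OF assms] D_deriv[OF assms]]) (use s in simp_all)
qed

text \<open>The primitive is chosen so that all terms in \<open>\<phi> \<phi>'\<close> and \<open>\<phi>'\<^sup>2\<close> cancel.\<close>

lemma virial:
  fixes h :: "real poly"
  defines "\<sigma> \<equiv> [:1, 0, -1:]"
  shows "integral {-1..1} (\<lambda>x. (poly (pderiv h) x * (2 * \<kappa>\<^sup>2 * (\<rho> - (x - m)\<^sup>2) + \<kappa> * (1 - x\<^sup>2))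
      - 2 * \<kappa>\<^sup>2 * poly h x * (x - m) + 1 / 2 * poly (pderiv (pderiv (pderiv h * \<sigma>) * \<sigma>)) x
      + \<kappa> * poly (pderiv (h * \<sigma>)) x) * (\<phi> x)\<^sup>2) = 0"
    (is "integral _ ?f = 0")
proof -
  let ?G = "pderiv (pderiv h * \<sigma>)"
  let ?P = "\<lambda>x. poly h x * E x - poly (pderiv h * \<sigma>) x * (\<phi> x * D x)
      + 1 / 2 * (poly (?G * \<sigma>) x * (\<phi> x)\<^sup>2) + \<kappa> * poly (h * \<sigma>) x * (\<phi> x)\<^sup>2"
  have "(?f has_integral ?P 1 - ?P (-1)) {-1..1}"
  proof (rule fundamental_theorem_of_calculus_interior)
    show "continuous_on {-1..1} ?P" unfolding E_def
      by (intro continuous_intros phi_cont D_cont) simp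
    fix x :: real assume "x \<in> {-1<..<1}"
    then obtain p d where pd: "(\<phi> has_real_derivative p) (at x)" "(D has_real_derivative d) (at x)"
      and D: "D x = (1 - x\<^sup>2) * p" and d: "(1 - x\<^sup>2) * d = - (\<kappa>\<^sup>2 * (\<rho> - (x - m)\<^sup>2) + \<kappa> * (1 - x\<^sup>2)) * \<phi> x"
      by (rule derivs)
    let ?h = "poly h x" and ?h1 = "poly (pderiv h) x" and ?hs1 = "poly (pderiv (h * \<sigma>)) x"
    let ?g = "poly ?G x" and ?g1 = "poly (pderiv (?G * \<sigma>)) x" and ?s = "1 - x\<^sup>2"
    have s: "poly (q * \<sigma>) x = poly q x * ?s" for q
      by (simp add: \<sigma>_def power2_eq_square algebra_simps)
    have "(?P has_real_derivative
       (?h1 * E x + ?h * (2 * D x * d + \<kappa>\<^sup>2 * (- 2 * (x - m)) * (\<phi> x)\<^sup>2 + \<kappa>\<^sup>2 * (\<rho> - (x - m)\<^sup>2) * (2 * \<phi> x * p))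
       - (?g * (\<phi> x * D x) + poly (pderiv h * \<sigma>) x * (p * D x + \<phi> x * d))
       + 1 / 2 * (?g1 * (\<phi> x)\<^sup>2 + poly (?G * \<sigma>) x * (2 * \<phi> x * p))
       + \<kappa> * (?hs1 * (\<phi> x)\<^sup>2 + poly (h * \<sigma>) x * (2 * \<phi> x * p)))) (at x)"
      unfolding E_def
      by (rule DERIV_cong, (rule derivative_intros poly_DERIV pd)+) (simp add: algebra_simps)
    also have "(?h1 * E x + ?h * (2 * D x * d + \<kappa>\<^sup>2 * (- 2 * (x - m)) * (\<phi> x)\<^sup>2 + \<kappa>\<^sup>2 * (\<rho> - (x - m)\<^sup>2) * (2 * \<phi> x * p))
       - (?g * (\<phi> x * D x) + poly (pderiv h * \<sigma>) x * (p * D x + \<phi> x * d))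
       + 1 / 2 * (?g1 * (\<phi> x)\<^sup>2 + poly (?G * \<sigma>) x * (2 * \<phi> x * p))
       + \<kappa> * (?hs1 * (\<phi> x)\<^sup>2 + poly (h * \<sigma>) x * (2 * \<phi> x * p)))
       = ?f x + (2 * ?h * p - ?h1 * \<phi> x) * (?s * d + (\<kappa>\<^sup>2 * (\<rho> - (x - m)\<^sup>2) + \<kappa> * ?s) * \<phi> x)"
      unfolding E_def D s
      by (simp add: algebra_simps power2_eq_square)
    also have "\<dots> = ?f x"
      by (simp only: d mult_minus_left add.left_inverse mult_zero_right add_0_right)
    finally show "(?P has_vector_derivative ?f x) (at x)"
      by (simp only: has_real_derivative_iff_has_vector_derivative)
  qed simp
  moreover have "?P 1 = 0" "?P (-1) = 0" by (simp_all add: E_def phi_ends D_ends)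
  ultimately show ?thesis by (simp only: diff_self integral_unique)
qed

lemma integrable_phi2:
  assumes "continuous_on {a..b} f" "-1 \<le> a" "b \<le> 1"
  shows "(\<lambda>x. f x * (\<phi> x)\<^sup>2) integrable_on {a..b}"
proof -
  have "continuous_on {a..b} \<phi>"
    by (rule continuous_on_subset[OF phi_cont]) (use assms in auto)
  then show ?thesis by (intro integrable_continuous_real continuous_intros assms(1))
qed

lemma phi2_bound:
  assumes f: "continuous_on {-1..1} f" and B: "\<And>x. x \<in> {-1..1} \<Longrightarrow> \<bar>f x\<bar> \<le> B"
  shows "\<bar>integral {-1..1} (\<lambda>x. f x * (\<phi> x)\<^sup>2)\<bar> \<le> B"
proof -
  have "norm (integral {-1..1} (\<lambda>x. f x * (\<phi> x)\<^sup>2)) \<le> integral {-1..1} (\<lambda>x. B * (\<phi> x)\<^sup>2)"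
    by (rule integral_norm_bound_integral)
       (use B f in \<open>auto intro!: integrable_phi2 simp: abs_mult mult_right_mono\<close>)
  then show ?thesis using phi_norm by simp
qed

lemma phi2_bound_sub:
  assumes f: "continuous_on {-d..d} f" and B: "\<And>x. x \<in> {-d..d} \<Longrightarrow> \<bar>f x\<bar> \<le> B" and d: "0 < d" "d < 1"
  shows "\<bar>integral {-d..d} (\<lambda>x. f x * (\<phi> x)\<^sup>2)\<bar> \<le> B"
proof -
  have "B \<ge> 0" using B[of 0] d by simp
  have "norm (integral {-d..d} (\<lambda>x. f x * (\<phi> x)\<^sup>2)) \<le> integral {-d..d} (\<lambda>x. B * (\<phi> x)\<^sup>2)"
    by (rule integral_norm_bound_integral)
       (use B f d in \<open>auto intro!: integrable_phi2 simp: abs_mult mult_right_mono\<close>)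
  also have "\<dots> \<le> integral {-1..1} (\<lambda>x. B * (\<phi> x)\<^sup>2)"
    by (rule integral_subset_le) (use d \<open>B \<ge> 0\<close> in \<open>auto intro!: integrable_phi2\<close>)
  finally show ?thesis using phi_norm by simp
qed

text \<open>The exchange between kinetic and potential energy cancels. What remains is the explicit
  x-dependence of the potential and the omitted part of order \<open>\<kappa>\<close>; both are at
  most a constant times \<open>E\<close> where the potential is bounded below.\<close>

lemma E_deriv:
  assumes "x \<in> {-1<..<1}"
  shows "(E has_real_derivative - 2 * \<kappa> * (\<phi> x * D x) - 2 * \<kappa>\<^sup>2 * (x - m) * (\<phi> x)\<^sup>2) (at x)"
proof -
  obtain p d where pd: "(\<phi> has_real_derivative p) (at x)" "(D has_real_derivative d) (at x)"
    and D: "D x = (1 - x\<^sup>2) * p" and d: "(1 - x\<^sup>2) * d = - (\<kappa>\<^sup>2 * (\<rho> - (x - m)\<^sup>2) + \<kappa> * (1 - x\<^sup>2)) * \<phi> x"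
    using assms by (rule derivs)
  let ?s = "1 - x\<^sup>2"
  have "(E has_real_derivative
       2 * D x * d + \<kappa>\<^sup>2 * (- 2 * (x - m)) * (\<phi> x)\<^sup>2 + \<kappa>\<^sup>2 * (\<rho> - (x - m)\<^sup>2) * (2 * \<phi> x * p)) (at x)"
    unfolding E_def[abs_def]
    by (rule derivative_eq_intros pd refl)+ (simp add: algebra_simps)
  also have "2 * D x * d + \<kappa>\<^sup>2 * (- 2 * (x - m)) * (\<phi> x)\<^sup>2 + \<kappa>\<^sup>2 * (\<rho> - (x - m)\<^sup>2) * (2 * \<phi> x * p)
     = - 2 * \<kappa> * (\<phi> x * D x) - 2 * \<kappa>\<^sup>2 * (x - m) * (\<phi> x)\<^sup>2
       + 2 * p * (?s * d + (\<kappa>\<^sup>2 * (\<rho> - (x - m)\<^sup>2) + \<kappa> * ?s) * \<phi> x)"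
    unfolding D by (simp add: algebra_simps power2_eq_square)
  also have "?s * d + (\<kappa>\<^sup>2 * (\<rho> - (x - m)\<^sup>2) + \<kappa> * ?s) * \<phi> x = 0"
    by (simp only: d mult_minus_left add.left_inverse)
  finally show ?thesis by simp
qed

text \<open>Obtained by integrating the derivative of (d^2 - x^2) (1 - x^2)
  \<open>\<phi> x * D x\<close>. The factor d^2 - x^2 kills the boundary terms at \<open>-d\<close>
  and \<open>d\<close>, where nothing is known about \<open>\<phi>\<close> and \<open>D\<close>;
  kinetic and potential parts thus agree up to lower order.\<close>

lemma equipartition:
  assumes "0 < d" "d < 1"
  shows "integral {-d..d} (\<lambda>x. (d\<^sup>2 - x\<^sup>2) * E x) =
     2 * \<kappa>\<^sup>2 * integral {-d..d} (\<lambda>x. (d\<^sup>2 - x\<^sup>2) * (\<rho> - (x - m)\<^sup>2) * (\<phi> x)\<^sup>2)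
     + \<kappa> * integral {-d..d} (\<lambda>x. (d\<^sup>2 - x\<^sup>2) * (1 - x\<^sup>2) * (\<phi> x)\<^sup>2)
     + integral {-d..d} (\<lambda>x. 2 * x * (1 + d\<^sup>2 - 2 * x\<^sup>2) * (\<phi> x * D x))"
proof -
  have c: "continuous_on {-d..d} \<phi>" "continuous_on {-d..d} D"
    using assms by (auto intro: continuous_on_subset[OF phi_cont] continuous_on_subset[OF D_cont])
  let ?A = "\<lambda>x. (d\<^sup>2 - x\<^sup>2) * E x"
  let ?B = "\<lambda>x. (d\<^sup>2 - x\<^sup>2) * (\<rho> - (x - m)\<^sup>2) * (\<phi> x)\<^sup>2"
  let ?C = "\<lambda>x. (d\<^sup>2 - x\<^sup>2) * (1 - x\<^sup>2) * (\<phi> x)\<^sup>2"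
  let ?F = "\<lambda>x. 2 * x * (1 + d\<^sup>2 - 2 * x\<^sup>2) * (\<phi> x * D x)"
  let ?P = "\<lambda>x. (d\<^sup>2 - x\<^sup>2) * (1 - x\<^sup>2) * (\<phi> x * D x)"
  let ?f = "\<lambda>x. ?A x - 2 * \<kappa>\<^sup>2 * ?B x - \<kappa> * ?C x - ?F x"
  have "(?f has_integral ?P d - ?P (-d)) {-d..d}"
  proof (rule fundamental_theorem_of_calculus_interior)
    show "continuous_on {-d..d} ?P"
      by (intro continuous_intros c)
    fix x assume "x \<in> {-d<..<d}"
    then have "x \<in> {-1<..<1}" using assms by auto
    then obtain p q where pd: "(\<phi> has_real_derivative p) (at x)" "(D has_real_derivative q) (at x)"
      and D: "D x = (1 - x\<^sup>2) * p" and q: "(1 - x\<^sup>2) * q = - (\<kappa>\<^sup>2 * (\<rho> - (x - m)\<^sup>2) + \<kappa> * (1 - x\<^sup>2)) * \<phi> x"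
      by (rule derivs)
    have "(?P has_real_derivative
       - 2 * x * (1 + d\<^sup>2 - 2 * x\<^sup>2) * (\<phi> x * D x) + (d\<^sup>2 - x\<^sup>2) * (1 - x\<^sup>2) * (p * D x + \<phi> x * q)) (at x)"
      by (rule derivative_eq_intros pd refl)+ (simp add: algebra_simps power2_eq_square)
    also have "- 2 * x * (1 + d\<^sup>2 - 2 * x\<^sup>2) * (\<phi> x * D x) + (d\<^sup>2 - x\<^sup>2) * (1 - x\<^sup>2) * (p * D x + \<phi> x * q)
       = - ?F x + (d\<^sup>2 - x\<^sup>2) * ((D x)\<^sup>2 + \<phi> x * ((1 - x\<^sup>2) * q))"
      unfolding D by (simp add: algebra_simps power2_eq_square)
    also have "\<dots> = ?f x"
      unfolding q E_def by (simp add: algebra_simps power2_eq_square)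
    finally show "(?P has_vector_derivative ?f x) (at x)"
      by (simp only: has_real_derivative_iff_has_vector_derivative)
  qed (use assms in simp)
  then have *: "(?f has_integral 0) {-d..d}" by simp
  have i: "?A integrable_on {-d..d}" "?B integrable_on {-d..d}" "?C integrable_on {-d..d}" "?F integrable_on {-d..d}"
    unfolding E_def by (intro integrable_continuous_real continuous_intros c)+
  have "(?f has_integral (integral {-d..d} ?A - 2 * \<kappa>\<^sup>2 * integral {-d..d} ?B - \<kappa> * integral {-d..d} ?C - integral {-d..d} ?F)) {-d..d}"
    by (intro has_integral_diff has_integral_mult_right integrable_integral i)
  from has_integral_unique[OF this *] show ?thesis by simp
qed

section \<open>Energy estimates on a window where the potential is bounded below\<close>

context
  fixes c d :: real
  assumes c: "c > 0" and d: "0 < d" "d < 1" and m: "\<bar>m\<bar> \<le> 1"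
    and Rc: "\<And>x. \<bar>x\<bar> \<le> d \<Longrightarrow> c \<le> \<rho> - (x - m)\<^sup>2"
begin

text \<open>The first summand controls the cross term \<open>\<phi> x * D x\<close>, the second the
  slope of the potential, with the bound 2 for \<bar>x - m\<bar>. No \<open>\<kappa>\<close> occurs,
  which is the slow variation of the energy.\<close>

definition lip :: real where "lip = 1 / sqrt c + 4 / c"

lemma E_lower: "\<bar>x\<bar> \<le> d \<Longrightarrow> (D x)\<^sup>2 + c * (\<kappa> * \<phi> x)\<^sup>2 \<le> E x"
proof -
  assume "\<bar>x\<bar> \<le> d"
  then have "c * (\<kappa> * \<phi> x)\<^sup>2 \<le> (\<rho> - (x - m)\<^sup>2) * (\<kappa> * \<phi> x)\<^sup>2"
    by (intro mult_right_mono Rc) auto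
  then show ?thesis by (simp add: E_def power_mult_distrib algebra_simps)
qed

lemma E_nonneg: "\<bar>x\<bar> \<le> d \<Longrightarrow> E x \<ge> 0"
proof -
  assume "\<bar>x\<bar> \<le> d"
  have "0 \<le> (D x)\<^sup>2 + c * (\<kappa> * \<phi> x)\<^sup>2" using c by simp
  also have "\<dots> \<le> E x" by (rule E_lower) fact
  finally show ?thesis .
qed

text \<open>The inequality between arithmetic and geometric means. It shows that the cross term is
  smaller than the energy by a factor \<open>\<kappa>\<close>.\<close>

lemma phiD_le: "\<bar>x\<bar> \<le> d \<Longrightarrow> 2 * \<bar>\<kappa> * (\<phi> x * D x)\<bar> \<le> E x / sqrt c"
proof -
  assume x: "\<bar>x\<bar> \<le> d"
  have "0 \<le> (\<bar>D x\<bar> - sqrt c * \<bar>\<kappa> * \<phi> x\<bar>)\<^sup>2" by simp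
  also have "\<dots> = (D x)\<^sup>2 + c * (\<kappa> * \<phi> x)\<^sup>2 - sqrt c * (2 * \<bar>\<kappa> * (\<phi> x * D x)\<bar>)"
    using c by (simp add: power2_diff power_mult_distrib abs_mult)
  finally have "sqrt c * (2 * \<bar>\<kappa> * (\<phi> x * D x)\<bar>) \<le> E x" using E_lower[OF x] by linarith
  then show ?thesis using c by (simp add: pos_le_divide_eq mult.commute)
qed

lemma phi2_le: "\<bar>x\<bar> \<le> d \<Longrightarrow> \<kappa>\<^sup>2 * (\<phi> x)\<^sup>2 \<le> E x / c"
proof -
  assume "\<bar>x\<bar> \<le> d"
  then have "c * (\<kappa> * \<phi> x)\<^sup>2 \<le> E x" using E_lower[of x] zero_le_power2[of "D x"] by linarith
  then show ?thesis using c by (simp add: pos_le_divide_eq mult.commute power_mult_distrib)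
qed

lemma E_deriv_le:
  assumes x: "\<bar>x\<bar> \<le> d"
  shows "\<bar>- 2 * \<kappa> * (\<phi> x * D x) - 2 * \<kappa>\<^sup>2 * (x - m) * (\<phi> x)\<^sup>2\<bar> \<le> lip * E x"
proof -
  have "\<bar>x - m\<bar> \<le> 2" using x d m by auto
  then have "2 * \<bar>x - m\<bar> * (\<kappa>\<^sup>2 * (\<phi> x)\<^sup>2) \<le> 2 * 2 * (E x / c)"
    using phi2_le[OF x] by (intro mult_mono) auto
  moreover have "\<bar>2 * \<kappa>\<^sup>2 * (x - m) * (\<phi> x)\<^sup>2\<bar> = 2 * \<bar>x - m\<bar> * (\<kappa>\<^sup>2 * (\<phi> x)\<^sup>2)"
    by (simp add: abs_mult)
  moreover have "\<bar>- 2 * \<kappa> * (\<phi> x * D x)\<bar> = 2 * \<bar>\<kappa> * (\<phi> x * D x)\<bar>"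
    by (simp add: abs_mult)
  moreover have "lip * E x = E x / sqrt c + 2 * 2 * (E x / c)"
    by (simp add: lip_def distrib_right)
  ultimately show ?thesis using phiD_le[OF x] by linarith
qed

text \<open>Gronwall's argument in both directions.\<close>

lemma E_exp:
  assumes "-d \<le> x" "x \<le> y" "y \<le> d"
  shows "E y * exp (- lip * y) \<le> E x * exp (- lip * x)" "E x * exp (lip * x) \<le> E y * exp (lip * y)"
proof -
  let ?e = "\<lambda>x. - 2 * \<kappa> * (\<phi> x * D x) - 2 * \<kappa>\<^sup>2 * (x - m) * (\<phi> x)\<^sup>2"
  have der: "(E has_real_derivative ?e t) (at t)" if "x \<le> t" "t \<le> y" for t
    using E_deriv[of t] that assms d by auto
  have le: "?e t \<le> lip * E t" "- (lip * E t) \<le> ?e t" if "x \<le> t" "t \<le> y" for t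
    using E_deriv_le[of t, unfolded abs_le_iff] that assms by auto
  show "E y * exp (- lip * y) \<le> E x * exp (- lip * x)"
  proof (rule DERIV_nonpos_imp_nonincreasing[OF assms(2)])
    fix t assume t: "x \<le> t" "t \<le> y"
    have 1: "((\<lambda>t. E t * exp (- lip * t)) has_real_derivative ?e t * exp (- lip * t) + (exp (- lip * t) * (- lip)) * E t) (at t)"
      by (rule DERIV_mult der t)+ (rule derivative_eq_intros refl | simp)+
    have 2: "?e t * exp (- lip * t) + (exp (- lip * t) * (- lip)) * E t = exp (- lip * t) * (?e t - lip * E t)"
      by (simp add: algebra_simps)
    have 3: "exp (- lip * t) * (?e t - lip * E t) \<le> 0"
      using le(1)[OF t] by (intro mult_nonneg_nonpos) simp_all
    show "\<exists>y. ((\<lambda>t. E t * exp (- lip * t)) has_real_derivative y) (at t) \<and> y \<le> 0"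
      using 1 3 unfolding 2[symmetric] by blast
  qed
  show "E x * exp (lip * x) \<le> E y * exp (lip * y)"
  proof (rule DERIV_nonneg_imp_nondecreasing[OF assms(2)])
    fix t assume t: "x \<le> t" "t \<le> y"
    have 1: "((\<lambda>t. E t * exp (lip * t)) has_real_derivative ?e t * exp (lip * t) + (exp (lip * t) * lip) * E t) (at t)"
      by (rule DERIV_mult der t)+ (rule derivative_eq_intros refl | simp)+
    have 2: "?e t * exp (lip * t) + (exp (lip * t) * lip) * E t = exp (lip * t) * (?e t + lip * E t)"
      by (simp add: algebra_simps)
    have 3: "exp (lip * t) * (?e t + lip * E t) \<ge> 0"
      using le(2)[OF t] by (intro mult_nonneg_nonneg) simp_all
    show "\<exists>y. ((\<lambda>t. E t * exp (lip * t)) has_real_derivative y) (at t) \<and> y \<ge> 0"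
      using 1 3 unfolding 2[symmetric] by blast
  qed
qed

lemma lip_pos: "lip > 0"
proof -
  have "1 / sqrt c > 0" "4 / c > 0" using c by simp_all
  then show ?thesis unfolding lip_def by (rule add_pos_pos)
qed

lemma E_compare:
  assumes x: "\<bar>x\<bar> \<le> d"
  shows "E x \<le> E 0 * exp (lip * d)" "E 0 * exp (- (lip * d)) \<le> E x"
proof -
  have "\<bar>x\<bar> \<le> d" using x .
  have e0: "E 0 \<ge> 0" "E x \<ge> 0" using E_nonneg d x by auto
  have k: "lip * \<bar>x\<bar> \<le> lip * d" using x lip_pos by simp
  have up: "E x \<le> E 0 * exp (lip * \<bar>x\<bar>) \<and> E 0 \<le> E x * exp (lip * \<bar>x\<bar>)"
  proof (cases "x \<ge> 0")
    case True
    then show ?thesis using E_exp[of 0 x] x d by (auto simp: exp_minus field_simps)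
  next
    case False
    then show ?thesis using E_exp[of x 0] x d by (auto simp: exp_minus field_simps)
  qed
  have "exp (lip * \<bar>x\<bar>) \<le> exp (lip * d)" using k by simp
  then have "E 0 * exp (lip * \<bar>x\<bar>) \<le> E 0 * exp (lip * d)" "E x * exp (lip * \<bar>x\<bar>) \<le> E x * exp (lip * d)"
    using e0 by (auto intro: mult_left_mono)
  then show "E x \<le> E 0 * exp (lip * d)" "E 0 * exp (- (lip * d)) \<le> E x"
    using up by (auto simp: exp_minus field_simps)
qed

text \<open>Equipartition expresses the weighted mean of the energy by the local mass
  \<open>q\<close>, and Gronwall replaces \<open>E x\<close> by \<open>E 0\<close>; 4 d^3 / 3 is the
  integral of d^2 - x^2. The other terms have relative size 1 / \<open>\<kappa>\<close>. The
  numerator 4 of \<open>C\<close> comes from the bound 4 for the factor of the cross term, the 1/2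
  in \<open>phiD_le\<close> and the length 2 d of the window, with d < 1.\<close>

lemma E_bounds:
  defines "e \<equiv> E 0 / \<kappa>\<^sup>2" and "q \<equiv> integral {-d..d} (\<lambda>x. (d\<^sup>2 - x\<^sup>2) * (\<rho> - (x - m)\<^sup>2) * (\<phi> x)\<^sup>2)"
    and "C \<equiv> 4 * exp (lip * d) / sqrt c"
  shows "e * (4 * d ^ 3 / 3) * exp (- (lip * d)) \<le> 2 * q + 1 / \<kappa> + C * e / \<kappa>"
    and "2 * q \<le> e * (4 * d ^ 3 / 3) * exp (lip * d) + C * e / \<kappa>"
proof -
  let ?A = "integral {-d..d} (\<lambda>x. (d\<^sup>2 - x\<^sup>2) * E x)"
  let ?B = "integral {-d..d} (\<lambda>x. (d\<^sup>2 - x\<^sup>2) * (1 - x\<^sup>2) * (\<phi> x)\<^sup>2)"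
  let ?F = "integral {-d..d} (\<lambda>x. 2 * x * (1 + d\<^sup>2 - 2 * x\<^sup>2) * (\<phi> x * D x))"
  have cc: "continuous_on {-d..d} \<phi>" "continuous_on {-d..d} D"
    using d by (auto intro: continuous_on_subset[OF phi_cont] continuous_on_subset[OF D_cont])
  have d2: "d\<^sup>2 \<le> 1" using d by (simp add: power_le_one)
  have xd: "x\<^sup>2 \<le> d\<^sup>2" if "x \<in> {-d..d}" for x
    using that d by (metis abs_le_square_iff abs_of_pos atLeastAtMost_iff abs_le_iff minus_le_iff)
  have H: "((\<lambda>x. d\<^sup>2 - x\<^sup>2) has_integral 4 * d ^ 3 / 3) {-d..d}"
  proof -
    have "((\<lambda>x. d\<^sup>2 - x\<^sup>2) has_integral (d\<^sup>2 * d - d ^ 3 / 3) - (d\<^sup>2 * (-d) - (-d) ^ 3 / 3)) {-d..d}"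
      using d by (intro fundamental_theorem_of_calculus)
        (auto simp flip: has_real_derivative_iff_has_vector_derivative intro!: derivative_eq_intros)
    then show ?thesis by (simp add: power2_eq_square power3_eq_cube mult.assoc)
  qed
  have iE: "(\<lambda>x. (d\<^sup>2 - x\<^sup>2) * E x) integrable_on {-d..d}"
    unfolding E_def by (intro integrable_continuous_real continuous_intros cc)
  have A1: "?A \<le> 4 * d ^ 3 / 3 * (E 0 * exp (lip * d))"
    by (rule has_integral_le[OF integrable_integral[OF iE] has_integral_mult_left[OF H]])
       (use xd E_compare in \<open>auto intro!: mult_left_mono\<close>)
  have A2: "4 * d ^ 3 / 3 * (E 0 * exp (- (lip * d))) \<le> ?A"
    by (rule has_integral_le[OF has_integral_mult_left[OF H] integrable_integral[OF iE]])
       (use xd E_compare in \<open>auto intro!: mult_left_mono\<close>)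
  have "\<bar>?B\<bar> \<le> 1"
  proof (rule phi2_bound_sub[OF _ _ d])
    show "\<bar>(d\<^sup>2 - x\<^sup>2) * (1 - x\<^sup>2)\<bar> \<le> 1" if "x \<in> {-d..d}" for x
    proof -
      have "d\<^sup>2 - x\<^sup>2 \<le> 1" "1 - x\<^sup>2 \<le> 1" "0 \<le> d\<^sup>2 - x\<^sup>2" "0 \<le> 1 - x\<^sup>2"
        using zero_le_power2[of x] d2 xd[OF that] by linarith+
      then show ?thesis unfolding abs_mult by (intro mult_le_one) (simp_all only: abs_of_nonneg abs_ge_zero)
    qed
  qed (intro continuous_intros)
  moreover have "?B \<ge> 0"
  proof (rule integral_nonneg)
    show "(\<lambda>x. (d\<^sup>2 - x\<^sup>2) * (1 - x\<^sup>2) * (\<phi> x)\<^sup>2) integrable_on {-d..d}"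
      by (intro integrable_continuous_real continuous_intros cc)
    fix x assume "x \<in> {-d..d}"
    then have "0 \<le> d\<^sup>2 - x\<^sup>2" "0 \<le> 1 - x\<^sup>2" using xd[of x] d2 by linarith+
    then show "0 \<le> (d\<^sup>2 - x\<^sup>2) * (1 - x\<^sup>2) * (\<phi> x)\<^sup>2"
      by (intro mult_nonneg_nonneg) simp_all
  qed
  ultimately have B: "0 \<le> ?B" "?B \<le> 1" by auto
  have F: "\<bar>?F\<bar> \<le> C * E 0 / \<kappa>"
  proof -
    have "norm ?F \<le> (4 * (E 0 * exp (lip * d) / (2 * \<kappa> * sqrt c))) * (d - (-d))"
    proof (rule integral_bound)
      show "continuous_on {-d..d} (\<lambda>x. 2 * x * (1 + d\<^sup>2 - 2 * x\<^sup>2) * (\<phi> x * D x))"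
        by (intro continuous_intros cc)
      fix x assume x: "x \<in> {-d..d}"
      then have x': "\<bar>x\<bar> \<le> d" by auto
      have "\<bar>2 * x * (1 + d\<^sup>2 - 2 * x\<^sup>2)\<bar> \<le> 2 * 2"
      proof -
        have "\<bar>1 + d\<^sup>2 - 2 * x\<^sup>2\<bar> \<le> 2"
          unfolding abs_le_iff using zero_le_power2[of x] zero_le_power2[of d] d2 xd[OF x] by linarith
        moreover have "\<bar>2 * x\<bar> \<le> 2" using x' d by linarith
        ultimately show ?thesis unfolding abs_mult[of "2 * x"] by (intro mult_mono) simp_all
      qed
      moreover have "\<bar>\<phi> x * D x\<bar> \<le> E 0 * exp (lip * d) / (2 * \<kappa> * sqrt c)"
      proof -
        have "2 * (\<kappa> * \<bar>\<phi> x * D x\<bar>) \<le> E x / sqrt c"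
          using phiD_le[OF x'] abs_mult[of \<kappa> "\<phi> x * D x"] abs_of_pos[OF kappa_pos] by (simp only:)
        also have "\<dots> \<le> E 0 * exp (lip * d) / sqrt c"
          using E_compare(1)[OF x'] c by (simp add: divide_right_mono)
        finally have *: "2 * (\<kappa> * \<bar>\<phi> x * D x\<bar>) \<le> E 0 * exp (lip * d) / sqrt c" .
        have "0 < sqrt c" using c by simp
        with * have "\<bar>\<phi> x * D x\<bar> * (2 * \<kappa> * sqrt c) \<le> E 0 * exp (lip * d)"
          by (simp add: pos_le_divide_eq ac_simps)
        then show ?thesis using kappa_pos \<open>0 < sqrt c\<close> by (subst pos_le_divide_eq) simp_all
      qed
      ultimately show "norm (2 * x * (1 + d\<^sup>2 - 2 * x\<^sup>2) * (\<phi> x * D x)) \<le> 4 * (E 0 * exp (lip * d) / (2 * \<kappa> * sqrt c))"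
        unfolding real_norm_def abs_mult[of "2 * x * (1 + d\<^sup>2 - 2 * x\<^sup>2)"]
        by (intro mult_mono) simp_all
    qed (use d in simp)
    also have "\<dots> = (C * E 0 / \<kappa>) * d"
      using kappa_pos c by (simp add: C_def field_simps)
    also have "\<dots> \<le> (C * E 0 / \<kappa>) * 1"
      using d c kappa_pos E_nonneg[of 0] by (intro mult_left_mono) (auto simp: C_def)
    finally show ?thesis by simp
  qed
  have eq: "?A = 2 * \<kappa>\<^sup>2 * q + \<kappa> * ?B + ?F"
    unfolding q_def by (rule equipartition[OF d])
  have k2: "\<kappa>\<^sup>2 > 0" using kappa_pos by simp
  have E0: "E 0 = e * \<kappa>\<^sup>2" using kappa_pos by (simp add: e_def)
  have P: "\<kappa>\<^sup>2 * (e * (4 * d ^ 3 / 3) * t) = 4 * d ^ 3 / 3 * (E 0 * t)" for t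
    by (simp add: E0)
  have Ce: "\<kappa>\<^sup>2 * (C * e / \<kappa>) = C * E 0 / \<kappa>" by (simp add: E0)
  have k1: "\<kappa>\<^sup>2 * (1 / \<kappa>) = \<kappa>" using kappa_pos by (simp add: power2_eq_square)
  have B': "0 \<le> \<kappa> * ?B" "\<kappa> * ?B \<le> \<kappa>"
    using B kappa_pos mult_left_mono[OF B(2), of \<kappa>] by simp_all
  have F': "?F \<le> C * E 0 / \<kappa>" "- (C * E 0 / \<kappa>) \<le> ?F" using F unfolding abs_le_iff by linarith+
  have "\<kappa>\<^sup>2 * (e * (4 * d ^ 3 / 3) * exp (- (lip * d))) \<le> \<kappa>\<^sup>2 * (2 * q + 1 / \<kappa> + C * e / \<kappa>)"
    unfolding P distrib_left Ce k1 using A2 F'(1) B'(2) eq by linarith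
  then show "e * (4 * d ^ 3 / 3) * exp (- (lip * d)) \<le> 2 * q + 1 / \<kappa> + C * e / \<kappa>"
    using k2 by (simp only: mult_le_cancel_left_pos)
  have "\<kappa>\<^sup>2 * (2 * q) \<le> \<kappa>\<^sup>2 * (e * (4 * d ^ 3 / 3) * exp (lip * d) + C * e / \<kappa>)"
    unfolding distrib_left[of "\<kappa>\<^sup>2"] P Ce using A1 F'(2) B'(1) eq by linarith
  then show "2 * q \<le> e * (4 * d ^ 3 / 3) * exp (lip * d) + C * e / \<kappa>"
    using k2 by (simp only: mult_le_cancel_left_pos)
qed

end
end

section \<open>Arcsine limit of the mass distribution\<close>

text \<open>The Wallis recursion; the virial identity produces the same recursion for the moments of
  \<open>\<phi>\<close> squared.\<close>

lemma integral_cos_power: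
  "integral {0..pi} (\<lambda>t. cos t ^ (k + 2)) = real (k + 1) / real (k + 2) * integral {0..pi} (\<lambda>t. cos t ^ k)"
proof -
  have i: "(\<lambda>t. cos t ^ j :: real) integrable_on {0..pi}" for j
    by (intro integrable_continuous_real continuous_intros)
  have "((\<lambda>t. real (k + 2) * cos t ^ (k + 2) - real (k + 1) * cos t ^ k) has_integral
      sin pi * cos pi ^ (k + 1) - sin 0 * cos 0 ^ (k + 1)) {0..pi}"
  proof (rule fundamental_theorem_of_calculus)
    fix t :: real
    have s: "sin t * sin t = 1 - cos t * cos t" using sin_squared_eq[of t] by (simp add: power2_eq_square)
    have "((\<lambda>t. cos t ^ (k + 1)) has_real_derivative (1 + real k) * (- sin t * cos t ^ k)) (at t)"
      unfolding Suc_eq_plus1[symmetric] by (rule DERIV_power_Suc[OF DERIV_cos])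
    from DERIV_mult[OF DERIV_sin this]
    have "((\<lambda>t. sin t * cos t ^ (k + 1)) has_real_derivative
        cos t * cos t ^ (k + 1) + real (k + 1) * (- sin t) * cos t ^ k * sin t) (at t)"
      by (rule DERIV_cong) (simp add: algebra_simps)
    also have "cos t * cos t ^ (k + 1) + real (k + 1) * (- sin t) * cos t ^ k * sin t
       = cos t * cos t ^ (k + 1) - real (k + 1) * cos t ^ k * (sin t * sin t)"
      by (simp add: algebra_simps)
    also have "\<dots> = real (k + 2) * cos t ^ (k + 2) - real (k + 1) * cos t ^ k"
      unfolding s by (simp add: algebra_simps)
    finally show "((\<lambda>t. sin t * cos t ^ (k + 1)) has_vector_derivative
       real (k + 2) * cos t ^ (k + 2) - real (k + 1) * cos t ^ k) (at t within {0..pi})"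
      unfolding has_real_derivative_iff_has_vector_derivative[symmetric] by (rule DERIV_subset) simp
  qed simp
  moreover have "((\<lambda>t. real (k + 2) * cos t ^ (k + 2) - real (k + 1) * cos t ^ k) has_integral
      real (k + 2) * integral {0..pi} (\<lambda>t. cos t ^ (k + 2)) - real (k + 1) * integral {0..pi} (\<lambda>t. cos t ^ k)) {0..pi}"
    by (intro has_integral_diff has_integral_mult_right integrable_integral i)
  ultimately have "real (k + 2) * integral {0..pi} (\<lambda>t. cos t ^ (k + 2)) - real (k + 1) * integral {0..pi} (\<lambda>t. cos t ^ k) = 0"
    using has_integral_unique by (metis (no_types, lifting) diff_self mult_zero_left sin_pi sin_zero)
  then show ?thesis by (simp add: field_simps del: of_nat_add)
qed

locale oscillator_limit =
  fixes \<phi> D :: "nat \<Rightarrow> real \<Rightarrow> real" and \<kappa> m \<rho> :: "nat \<Rightarrow> real" and m0 r :: real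
  assumes osc: "\<forall>\<^sub>F N in sequentially. oscillator (\<phi> N) (D N) (\<kappa> N) (m N) (\<rho> N)"
    and kappa_lim: "filterlim \<kappa> at_top sequentially"
    and m_lim: "m \<longlonglongrightarrow> m0"
    and rho_lim: "\<rho> \<longlonglongrightarrow> r\<^sup>2"
    and r_pos: "r > 0" and left: "-1 < m0 - r" and right: "m0 + r < 1" and zero_in: "\<bar>m0\<bar> < r"
begin

definition M :: "nat \<Rightarrow> (real \<Rightarrow> real) \<Rightarrow> real" where
  "M N f = integral {-1..1} (\<lambda>x. f x * (\<phi> N x)\<^sup>2)"

text \<open>Expectation under the arcsine law on the interval from m0 - r to m0 + r. Parametrising
  by a uniform angle avoids the singular density.\<close>

definition Lam :: "(real \<Rightarrow> real) \<Rightarrow> real" where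
  "Lam f = integral {0..pi} (\<lambda>t. f (m0 - r * cos t)) / pi"

lemma inv_kappa_lim: "(\<lambda>N. 1 / \<kappa> N) \<longlonglongrightarrow> 0"
  using tendsto_inverse_0_at_top[OF kappa_lim] by (simp add: inverse_eq_divide)

lemma has_M:
  assumes "oscillator (\<phi> N) (D N) (\<kappa> N) (m N) (\<rho> N)" "continuous_on {-1..1} f"
  shows "((\<lambda>x. f x * (\<phi> N x)\<^sup>2) has_integral M N f) {-1..1}"
  unfolding M_def using oscillator.integrable_phi2[OF assms(1,2)] by (simp add: integrable_integral)

lemma null_times_M:
  assumes f: "continuous_on {-1..1} f" and a: "a \<longlonglongrightarrow> 0"
  shows "(\<lambda>N. a N * M N f) \<longlonglongrightarrow> 0"
proof -
  have "compact (f ` {-1..1})" using f by (intro compact_continuous_image) auto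
  then have "bounded (f ` {-1..1})" by (rule compact_imp_bounded)
  then obtain B where B: "\<And>x. x \<in> {-1..1} \<Longrightarrow> \<bar>f x\<bar> \<le> B"
    unfolding bounded_iff by force
  have "\<forall>\<^sub>F N in sequentially. norm (M N f) \<le> B"
    using osc by eventually_elim (auto simp: M_def intro!: oscillator.phi2_bound f B)
  then have "Bfun (\<lambda>N. M N f) sequentially" by (rule BfunI)
  then show ?thesis
    using bounded_bilinear.Zfun_prod_Bfun[OF bounded_bilinear_mult a[unfolded tendsto_Zfun_iff]]
    by (simp add: tendsto_Zfun_iff)
qed

text \<open>The leading part of the virial identity after division by 2 \<open>\<kappa>\<close>^2.
  It singles out the arcsine law, because the integrand is the square root of r^2 - (x - m0)^2 times
  the derivative of h times that same root.\<close>

lemma virial_limit: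
  fixes h :: "real poly"
  shows "(\<lambda>N. M N (\<lambda>x. poly (pderiv h) x * (r\<^sup>2 - (x - m0)\<^sup>2) - poly h x * (x - m0))) \<longlonglongrightarrow> 0"
proof -
  let ?s = "[:1, 0, -1:] :: real poly"
  let ?G0 = "pderiv (h * ?s)" and ?G2 = "pderiv (pderiv (pderiv h * ?s) * ?s)"
  let ?f = "\<lambda>x. poly (pderiv h) x * (r\<^sup>2 - (x - m0)\<^sup>2) - poly h x * (x - m0)"
  \<comment> \<open>The exact difference to the virial identity: every term is a null sequence times
    a mean of a fixed polynomial, hence a null sequence.\<close>
  let ?R = "\<lambda>N. (- (1 / \<kappa> N) / 2) * M N (poly (pderiv h * ?s + ?G0)) + (- ((1 / \<kappa> N) * (1 / \<kappa> N)) / 4) * M N (poly ?G2)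
      + (r\<^sup>2 - \<rho> N + ((m N)\<^sup>2 - m0\<^sup>2)) * M N (poly (pderiv h)) + (m0 - m N) * M N (poly ([:0, 2:] * pderiv h + h))"
  have R0: "?R \<longlonglongrightarrow> 0 + 0 + 0 + 0"
  proof (intro tendsto_add null_times_M continuous_intros)
    show "(\<lambda>N. - (1 / \<kappa> N) / 2) \<longlonglongrightarrow> 0"
      using tendsto_divide[OF tendsto_minus[OF inv_kappa_lim] tendsto_const[of 2]] by simp
    show "(\<lambda>N. - ((1 / \<kappa> N) * (1 / \<kappa> N)) / 4) \<longlonglongrightarrow> 0"
      using tendsto_divide[OF tendsto_minus[OF tendsto_mult[OF inv_kappa_lim inv_kappa_lim]] tendsto_const[of 4]] by simp
    show "(\<lambda>N. r\<^sup>2 - \<rho> N + ((m N)\<^sup>2 - m0\<^sup>2)) \<longlonglongrightarrow> 0"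
      using tendsto_add[OF tendsto_diff[OF tendsto_const[of "r\<^sup>2"] rho_lim]
        tendsto_diff[OF tendsto_power[OF m_lim, of 2] tendsto_const[of "m0\<^sup>2"]]] by simp
    show "(\<lambda>N. m0 - m N) \<longlonglongrightarrow> 0"
      using tendsto_diff[OF tendsto_const[of m0] m_lim] by simp
  qed
  have "\<forall>\<^sub>F N in sequentially. ?R N = M N ?f"
    using osc
  proof eventually_elim
    case (elim N)
    interpret oscillator "\<phi> N" "D N" "\<kappa> N" "m N" "\<rho> N" by fact
    let ?k = "\<kappa> N"
    let ?V = "\<lambda>x. poly (pderiv h) x * (2 * ?k\<^sup>2 * (\<rho> N - (x - m N)\<^sup>2) + ?k * (1 - x\<^sup>2))
      - 2 * ?k\<^sup>2 * poly h x * (x - m N) + 1 / 2 * poly ?G2 x + ?k * poly ?G0 x"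
    have V0: "M N ?V = 0" unfolding M_def by (rule virial)
    have eq: "?f x = 1 / (2 * ?k\<^sup>2) * ?V x + (- (1 / ?k) / 2) * poly (pderiv h * ?s + ?G0) x
        + (- ((1 / ?k) * (1 / ?k)) / 4) * poly ?G2 x
        + (r\<^sup>2 - \<rho> N + ((m N)\<^sup>2 - m0\<^sup>2)) * poly (pderiv h) x + (m0 - m N) * poly ([:0, 2:] * pderiv h + h) x" for x
    proof -
      have s: "poly (pderiv h * ?s + ?G0) x = poly (pderiv h) x * (1 - x\<^sup>2) + poly ?G0 x"
        by (simp add: power2_eq_square algebra_simps)
      have V: "1 / (2 * ?k\<^sup>2) * ?V x = poly (pderiv h) x * (\<rho> N - (x - m N)\<^sup>2) + (1 / ?k) / 2 * (poly (pderiv h) x * (1 - x\<^sup>2))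
         - poly h x * (x - m N) + (1 / ?k) * (1 / ?k) / 4 * poly ?G2 x + (1 / ?k) / 2 * poly ?G0 x"
        (is "_ = ?rhs")
      proof -
        have "?V x = 2 * ?k\<^sup>2 * ?rhs" using kappa_pos by (simp add: distrib_left right_diff_distrib power2_eq_square)
        then show ?thesis using kappa_pos by simp
      qed
      show ?thesis unfolding s V by (simp add: algebra_simps power2_eq_square)
    qed
    have "((\<lambda>x. 1 / (2 * ?k\<^sup>2) * (?V x * (\<phi> N x)\<^sup>2) + (- (1 / ?k) / 2) * (poly (pderiv h * ?s + ?G0) x * (\<phi> N x)\<^sup>2)
        + (- ((1 / ?k) * (1 / ?k)) / 4) * (poly ?G2 x * (\<phi> N x)\<^sup>2)
        + (r\<^sup>2 - \<rho> N + ((m N)\<^sup>2 - m0\<^sup>2)) * (poly (pderiv h) x * (\<phi> N x)\<^sup>2)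
        + (m0 - m N) * (poly ([:0, 2:] * pderiv h + h) x * (\<phi> N x)\<^sup>2)) has_integral
        1 / (2 * ?k\<^sup>2) * M N ?V + (- (1 / ?k) / 2) * M N (poly (pderiv h * ?s + ?G0))
        + (- ((1 / ?k) * (1 / ?k)) / 4) * M N (poly ?G2)
        + (r\<^sup>2 - \<rho> N + ((m N)\<^sup>2 - m0\<^sup>2)) * M N (poly (pderiv h))
        + (m0 - m N) * M N (poly ([:0, 2:] * pderiv h + h))) {-1..1}" (is "(?F has_integral ?I) _")
      by (intro has_integral_add has_integral_mult_right has_M elim continuous_intros)
    moreover have "?F = (\<lambda>x. ?f x * (\<phi> N x)\<^sup>2)"
      unfolding eq by (simp only: distrib_right mult.assoc)
    moreover have "?I = ?R N" unfolding V0 by simp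
    ultimately show "?R N = M N ?f" unfolding M_def[of N ?f] by (simp only: integral_unique)
  qed
  from Lim_transform_eventually[OF R0 this] show ?thesis by simp
qed

lemma M_const: "\<forall>\<^sub>F N in sequentially. M N (\<lambda>x. 1) = 1"
  using osc by eventually_elim (simp add: M_def oscillator.phi_norm)

text \<open>The choice h = (x - m0)^(j+1) in the virial limit links moment j + 2 to moment j just as
  Wallis does for the cosine. Even moments start from the normalisation, odd ones from h =
  1.\<close>

lemma power_M_lim: "(\<lambda>N. M N (\<lambda>x. (x - m0) ^ k)) \<longlonglongrightarrow> (- r) ^ k * integral {0..pi} (\<lambda>t. cos t ^ k) / pi"
proof (induction k rule: less_induct)
  case (less k)
  let ?t = "[:- m0, 1:] :: real poly"
  have pt: "poly (?t ^ j) x = (x - m0) ^ j" for j x by (simp add: algebra_simps)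
  consider "k = 0" | "k = 1" | j where "k = j + 2" by (metis One_nat_def add_2_eq_Suc' not0_implies_Suc)
  then show ?case
  proof cases
    case 1
    have "integral {0..pi} (\<lambda>t. cos t ^ 0) = pi" by simp
    then show ?thesis unfolding 1 using M_const by (simp add: tendsto_eventually)
  next
    case 2
    have "((\<lambda>t. cos t) has_integral sin pi - sin 0) {0..pi}"
      by (rule fundamental_theorem_of_calculus)
        (auto intro!: derivative_eq_intros simp flip: has_real_derivative_iff_has_vector_derivative)
    then have "integral {0..pi} (\<lambda>t. cos t ^ 1) = 0" by (simp add: integral_unique)
    moreover have "(\<lambda>N. - M N (\<lambda>x. - (x - m0))) \<longlonglongrightarrow> - 0"
      using virial_limit[of 1] by (intro tendsto_minus) simp
    then have "(\<lambda>N. M N (\<lambda>x. (x - m0))) \<longlonglongrightarrow> 0"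
      unfolding M_def by (simp only: mult_minus_left integral_neg minus_minus minus_zero)
    ultimately show ?thesis unfolding 2 by simp
  next
    case (3 j)
    let ?c = "\<lambda>k. integral {0..pi} (\<lambda>t. cos t ^ k)"
    have "poly (pderiv (?t ^ (j + 1))) x = real (j + 1) * (x - m0) ^ j" for x
      by (simp add: pderiv_power_Suc pderiv_pCons del: power_Suc) 
    then have eq: "poly (pderiv (?t ^ (j + 1))) x * (r\<^sup>2 - (x - m0)\<^sup>2) - poly (?t ^ (j + 1)) x * (x - m0)
       = real (j + 1) * r\<^sup>2 * (x - m0) ^ j - real (j + 2) * (x - m0) ^ (j + 2)" for x
      unfolding pt by (simp add: algebra_simps power2_eq_square)
    have "\<forall>\<^sub>F N in sequentially. M N (\<lambda>x. real (j + 1) * r\<^sup>2 * (x - m0) ^ j - real (j + 2) * (x - m0) ^ (j + 2))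
       = real (j + 1) * r\<^sup>2 * M N (\<lambda>x. (x - m0) ^ j) - real (j + 2) * M N (\<lambda>x. (x - m0) ^ (j + 2))"
      using osc
    proof eventually_elim
      case (elim N)
      have "((\<lambda>x. real (j + 1) * r\<^sup>2 * ((x - m0) ^ j * (\<phi> N x)\<^sup>2) - real (j + 2) * ((x - m0) ^ (j + 2) * (\<phi> N x)\<^sup>2)) has_integral
        real (j + 1) * r\<^sup>2 * M N (\<lambda>x. (x - m0) ^ j) - real (j + 2) * M N (\<lambda>x. (x - m0) ^ (j + 2))) {-1..1}"
        by (intro has_integral_diff has_integral_mult_right has_M elim continuous_intros)
      then show ?case unfolding M_def[of _ "\<lambda>x. _ * r\<^sup>2 * (x - m0) ^ j - _ x"]
        by (intro integral_unique) (simp only: left_diff_distrib mult.assoc)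
    qed
    from Lim_transform_eventually[OF virial_limit[of "?t ^ (j + 1)", unfolded eq] this]
    have d: "(\<lambda>N. real (j + 1) * r\<^sup>2 * M N (\<lambda>x. (x - m0) ^ j) - real (j + 2) * M N (\<lambda>x. (x - m0) ^ (j + 2))) \<longlonglongrightarrow> 0" .
    have IH: "(\<lambda>N. M N (\<lambda>x. (x - m0) ^ j)) \<longlonglongrightarrow> (- r) ^ j * ?c j / pi"
      using less 3 by simp
    have "(\<lambda>N. (real (j + 1) * r\<^sup>2 * M N (\<lambda>x. (x - m0) ^ j) -
        (real (j + 1) * r\<^sup>2 * M N (\<lambda>x. (x - m0) ^ j) - real (j + 2) * M N (\<lambda>x. (x - m0) ^ (j + 2)))) / real (j + 2))
        \<longlonglongrightarrow> (real (j + 1) * r\<^sup>2 * ((- r) ^ j * ?c j / pi) - 0) / real (j + 2)"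
      by (intro tendsto_intros d IH) simp
    moreover have "(real (j + 1) * r\<^sup>2 * ((- r) ^ j * ?c j / pi) - 0) / real (j + 2) = (- r) ^ (j + 2) * ?c (j + 2) / pi"
      unfolding integral_cos_power by (simp add: power2_eq_square field_simps)
    moreover have "(real (j + 1) * r\<^sup>2 * M N (\<lambda>x. (x - m0) ^ j) -
        (real (j + 1) * r\<^sup>2 * M N (\<lambda>x. (x - m0) ^ j) - real (j + 2) * M N (\<lambda>x. (x - m0) ^ (j + 2)))) / real (j + 2)
        = M N (\<lambda>x. (x - m0) ^ (j + 2))" for N
      by simp
    ultimately show ?thesis unfolding 3 by (simp only:)
  qed
qed

lemma range_in: "m0 - r * cos t \<in> {-1..1}"
proof -
  have "\<bar>r * cos t\<bar> \<le> r * 1" unfolding abs_mult using r_pos by (intro mult_mono) auto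
  then show ?thesis using left right by auto
qed

lemma Lam_integrable:
  fixes f :: "real \<Rightarrow> real"
  assumes "continuous_on {-1..1} f"
  shows "(\<lambda>t. f (m0 - r * cos t)) integrable_on {0..pi}"
proof (rule integrable_continuous_real)
  show "continuous_on {0..pi} (\<lambda>t. f (m0 - r * cos t))"
    by (rule continuous_on_compose2[OF assms]) (use range_in in \<open>auto intro!: continuous_intros\<close>)
qed

text \<open>Weierstrass approximation: both functionals (the first one for large N) have total mass
  1, so a uniform error in the function is passed on without amplification.\<close>

lemma M_lim:
  assumes f: "continuous_on {-1..1} f"
  shows "(\<lambda>N. M N f) \<longlonglongrightarrow> Lam f"
proof (rule LIMSEQ_I)
  fix e :: real assume e: "e > 0"
  have "continuous_on {-1 - m0..1 - m0} (\<lambda>y. f (y + m0))"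
    by (rule continuous_on_compose2[OF f]) (auto intro!: continuous_intros)
  then obtain g where "real_polynomial_function g" and g: "\<And>y. y \<in> {-1 - m0..1 - m0} \<Longrightarrow> \<bar>f (y + m0) - g y\<bar> < e / 4"
    using Stone_Weierstrass_real_polynomial_function[of "{-1 - m0..1 - m0}" "\<lambda>y. f (y + m0)" "e / 4"] e by auto
  then obtain a n where ga: "g = (\<lambda>y. \<Sum>i\<le>n. a i * y ^ i)"
    unfolding real_polynomial_function_iff_sum by blast
  define G where "G x = (\<Sum>i\<le>n. a i * (x - m0) ^ i)" for x
  have Gc: "continuous_on {-1..1} G" unfolding G_def by (intro continuous_intros)
  have fG: "\<bar>f x - G x\<bar> \<le> e / 4" if "x \<in> {-1..1}" for x
    using g[of "x - m0"] that by (simp add: ga G_def)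
  have "((\<lambda>t. \<Sum>i\<le>n. a i * ((- r) ^ i * cos t ^ i)) has_integral (\<Sum>i\<le>n. a i * ((- r) ^ i * integral {0..pi} (\<lambda>t. cos t ^ i)))) {0..pi}"
    by (intro has_integral_sum has_integral_mult_right integrable_integral integrable_continuous_real continuous_intros) auto
  moreover have "(\<Sum>i\<le>n. a i * ((- r) ^ i * cos t ^ i)) = G (m0 - r * cos t)" for t
    unfolding G_def by (simp flip: power_mult_distrib)
  ultimately have LG: "Lam G = (\<Sum>i\<le>n. a i * ((- r) ^ i * integral {0..pi} (\<lambda>t. cos t ^ i) / pi))"
    by (simp add: Lam_def integral_unique sum_divide_distrib)
  have MG: "\<forall>\<^sub>F N in sequentially. (\<Sum>i\<le>n. a i * M N (\<lambda>x. (x - m0) ^ i)) = M N G"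
    using osc
  proof eventually_elim
    case (elim N)
    have "((\<lambda>x. \<Sum>i\<le>n. a i * ((x - m0) ^ i * (\<phi> N x)\<^sup>2)) has_integral (\<Sum>i\<le>n. a i * M N (\<lambda>x. (x - m0) ^ i))) {-1..1}"
      by (intro has_integral_sum has_integral_mult_right has_M elim continuous_intros) auto
    then show ?case by (simp add: M_def[of N G] G_def integral_unique sum_distrib_right mult.assoc)
  qed
  have "(\<lambda>N. M N G) \<longlonglongrightarrow> Lam G"
    by (rule Lim_transform_eventually[OF _ MG]) (unfold LG, intro tendsto_intros power_M_lim)
  then have "\<forall>\<^sub>F N in sequentially. \<bar>M N G - Lam G\<bar> < e / 4"
    using e by (auto dest!: tendstoD[where e = "e / 4"] simp: dist_real_def)
  moreover have "\<forall>\<^sub>F N in sequentially. \<bar>M N f - M N G\<bar> \<le> e / 4"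
    using osc
  proof eventually_elim
    case (elim N)
    have "((\<lambda>x. f x * (\<phi> N x)\<^sup>2 - G x * (\<phi> N x)\<^sup>2) has_integral M N f - M N G) {-1..1}"
      by (intro has_integral_diff has_M elim f Gc)
    then have "M N f - M N G = integral {-1..1} (\<lambda>x. (f x - G x) * (\<phi> N x)\<^sup>2)"
      by (simp add: integral_unique left_diff_distrib)
    then show ?case
      using oscillator.phi2_bound[OF elim, of "\<lambda>x. f x - G x" "e / 4"] fG by (simp add: f Gc continuous_intros)
  qed
  moreover have L: "\<bar>Lam f - Lam G\<bar> \<le> e / 4"
  proof -
    have "((\<lambda>t. f (m0 - r * cos t) - G (m0 - r * cos t)) has_integral
        integral {0..pi} (\<lambda>t. f (m0 - r * cos t)) - integral {0..pi} (\<lambda>t. G (m0 - r * cos t))) {0..pi}"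
      by (intro has_integral_diff integrable_integral Lam_integrable f Gc)
    from has_integral_bound_real[OF _ _ this, of "e / 4" "{}"]
    have "\<bar>integral {0..pi} (\<lambda>t. f (m0 - r * cos t)) - integral {0..pi} (\<lambda>t. G (m0 - r * cos t))\<bar> \<le> e / 4 * pi"
      using fG[OF range_in] e by (simp add: pi_ge_zero)
    then show ?thesis unfolding Lam_def diff_divide_distrib[symmetric]
      by (simp add: pos_divide_le_eq)
  qed
  ultimately have "\<forall>\<^sub>F N in sequentially. \<bar>M N G - Lam G\<bar> < e / 4 \<and> \<bar>M N f - M N G\<bar> \<le> e / 4"
    by (simp add: eventually_conj)
  then have "\<forall>\<^sub>F N in sequentially. \<bar>M N f - Lam f\<bar> < e"
    by eventually_elim (use e L in linarith)
  then show "\<exists>no. \<forall>N\<ge>no. norm (M N f - Lam f) < e"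
    by (simp add: eventually_sequentially)
qed

end

section \<open>Energy at the origin\<close>

context oscillator_limit
begin

text \<open>The equipartition weight cut off continuously, so that weak convergence applies to
  it.\<close>

abbreviation bump :: "real \<Rightarrow> real \<Rightarrow> real" where
  "bump d x \<equiv> max 0 (d\<^sup>2 - x\<^sup>2)"

lemma bump_eq:
  fixes d x :: real assumes "d > 0"
  shows "x \<in> {-d..d} \<Longrightarrow> bump d x = d\<^sup>2 - x\<^sup>2" and "x \<notin> {-d..d} \<Longrightarrow> bump d x = 0"
proof -
  have "x \<in> {-d..d} \<longleftrightarrow> x\<^sup>2 \<le> d\<^sup>2"
    using abs_le_square_iff[of x d] assms by (auto simp: abs_le_iff)
  then show "x \<in> {-d..d} \<Longrightarrow> bump d x = d\<^sup>2 - x\<^sup>2" "x \<notin> {-d..d} \<Longrightarrow> bump d x = 0" by auto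
qed

lemma integral_bump:
  fixes f :: "real \<Rightarrow> real"
  assumes d: "d > 0" "{-d..d} \<subseteq> S" and f: "continuous_on {-d..d} f"
  shows "integral S (\<lambda>x. bump d x * f x) = integral {-d..d} (\<lambda>x. (d\<^sup>2 - x\<^sup>2) * f x)"
proof -
  have "((\<lambda>x. (d\<^sup>2 - x\<^sup>2) * f x) has_integral integral {-d..d} (\<lambda>x. (d\<^sup>2 - x\<^sup>2) * f x)) {-d..d}"
    by (intro integrable_integral integrable_continuous_real continuous_intros f)
  then have "((\<lambda>x. bump d x * f x) has_integral integral {-d..d} (\<lambda>x. (d\<^sup>2 - x\<^sup>2) * f x)) {-d..d}"
    by (rule has_integral_eq[rotated]) (simp add: bump_eq(1)[OF d(1)])
  then have "((\<lambda>x. bump d x * f x) has_integral integral {-d..d} (\<lambda>x. (d\<^sup>2 - x\<^sup>2) * f x)) S"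
    by (rule has_integral_on_superset) (use d bump_eq(2)[OF d(1)] in auto)
  then show ?thesis by (rule integral_unique)
qed

text \<open>With x = m0 - r cos t the factor r^2 - (x - m0)^2 is (r sin t)^2; one sine is absorbed
  by dx and the other is the remaining square root.\<close>

lemma Lam_bump:
  assumes d: "d > 0" "{-d..d} \<subseteq> {m0 - r..m0 + r}"
  shows "Lam (\<lambda>x. bump d x * (r\<^sup>2 - (x - m0)\<^sup>2)) = integral {-d..d} (\<lambda>x. (d\<^sup>2 - x\<^sup>2) * sqrt (r\<^sup>2 - (x - m0)\<^sup>2)) / pi"
proof -
  let ?g = "\<lambda>t. m0 - r * cos t" and ?F = "\<lambda>x. bump d x * sqrt (r\<^sup>2 - (x - m0)\<^sup>2)"
  have "((\<lambda>t. (r * sin t) *\<^sub>R ?F (?g t)) has_integral integral {?g 0..?g pi} ?F) {0..pi}"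
  proof (rule has_integral_substitution[where c = "m0 - r" and d = "m0 + r"])
    show "?g ` {0..pi} \<subseteq> {m0 - r..m0 + r}"
    proof -
      have "\<bar>r * cos t\<bar> \<le> r * 1" for t unfolding abs_mult using r_pos by (intro mult_mono) auto
      then have "- r \<le> r * cos t \<and> r * cos t \<le> r" for t by (auto simp: abs_le_iff minus_le_iff)
      then show ?thesis by (auto simp: minus_le_iff)
    qed
    show "continuous_on {m0 - r..m0 + r} ?F" by (intro continuous_intros)
    show "((\<lambda>t. m0 - r * cos t) has_real_derivative r * sin x) (at x within {0..pi})" for x
      by (auto intro!: derivative_eq_intros)
  qed (use r_pos in auto)
  moreover have "(r * sin t) *\<^sub>R ?F (?g t) = bump d (?g t) * (r\<^sup>2 - (?g t - m0)\<^sup>2)" if t: "t \<in> {0..pi}" for t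
  proof -
    have s: "r * sin t \<ge> 0" using t r_pos by (simp add: sin_ge_zero)
    have "r\<^sup>2 - (?g t - m0)\<^sup>2 = (r * sin t)\<^sup>2"
      using sin_squared_eq[of t] by (simp add: power_mult_distrib right_diff_distrib)
    then show ?thesis using s by (simp add: power2_eq_square)
  qed
  ultimately have "((\<lambda>t. bump d (?g t) * (r\<^sup>2 - (?g t - m0)\<^sup>2)) has_integral integral {?g 0..?g pi} ?F) {0..pi}"
    by (rule has_integral_eq[rotated]) 
  then have "Lam (\<lambda>x. bump d x * (r\<^sup>2 - (x - m0)\<^sup>2)) = integral {m0 - r..m0 + r} ?F / pi"
    unfolding Lam_def by (simp add: integral_unique)
  also have "integral {m0 - r..m0 + r} ?F = integral {-d..d} (\<lambda>x. (d\<^sup>2 - x\<^sup>2) * sqrt (r\<^sup>2 - (x - m0)\<^sup>2))"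
    by (rule integral_bump[OF d]) (intro continuous_intros)
  finally show ?thesis .
qed

lemma local_mass_lim:
  assumes d: "0 < d" "d < 1"
  shows "(\<lambda>N. integral {-d..d} (\<lambda>x. (d\<^sup>2 - x\<^sup>2) * (\<rho> N - (x - m N)\<^sup>2) * (\<phi> N x)\<^sup>2))
    \<longlonglongrightarrow> Lam (\<lambda>x. bump d x * (r\<^sup>2 - (x - m0)\<^sup>2))"
proof -
  let ?R = "\<lambda>N. M N (\<lambda>x. bump d x * (r\<^sup>2 - (x - m0)\<^sup>2)) + (\<rho> N - r\<^sup>2 + (m0\<^sup>2 - (m N)\<^sup>2)) * M N (bump d)
     + (2 * (m N - m0)) * M N (\<lambda>x. bump d x * x)"
  have 1: "(\<lambda>N. \<rho> N - r\<^sup>2 + (m0\<^sup>2 - (m N)\<^sup>2)) \<longlonglongrightarrow> 0"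
    using tendsto_add[OF tendsto_diff[OF rho_lim tendsto_const[of "r\<^sup>2"]]
      tendsto_diff[OF tendsto_const[of "m0\<^sup>2"] tendsto_power[OF m_lim, of 2]]] by simp
  have 2: "(\<lambda>N. 2 * (m N - m0)) \<longlonglongrightarrow> 0"
    using tendsto_mult[OF tendsto_const[of 2] tendsto_diff[OF m_lim tendsto_const[of m0]]] by simp
  have lim: "?R \<longlonglongrightarrow> Lam (\<lambda>x. bump d x * (r\<^sup>2 - (x - m0)\<^sup>2)) + 0 + 0"
    by (intro tendsto_add M_lim null_times_M 1 2 continuous_intros)
  have ev: "\<forall>\<^sub>F N in sequentially. ?R N = integral {-d..d} (\<lambda>x. (d\<^sup>2 - x\<^sup>2) * (\<rho> N - (x - m N)\<^sup>2) * (\<phi> N x)\<^sup>2)"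
    using osc
  proof eventually_elim
    case (elim N)
    interpret oscillator "\<phi> N" "D N" "\<kappa> N" "m N" "\<rho> N" by fact
    have c: "continuous_on {-d..d} (\<phi> N)"
      by (rule continuous_on_subset[OF phi_cont]) (use d in auto)
    have "((\<lambda>x. bump d x * (r\<^sup>2 - (x - m0)\<^sup>2) * (\<phi> N x)\<^sup>2 + (\<rho> N - r\<^sup>2 + (m0\<^sup>2 - (m N)\<^sup>2)) * (bump d x * (\<phi> N x)\<^sup>2)
      + (2 * (m N - m0)) * (bump d x * x * (\<phi> N x)\<^sup>2)) has_integral ?R N) {-1..1}" (is "(?f has_integral _) _")
      by (intro has_integral_add has_integral_mult_right has_M elim continuous_intros)
    moreover have "?f = (\<lambda>x. bump d x * ((\<rho> N - (x - m N)\<^sup>2) * (\<phi> N x)\<^sup>2))"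
      by (rule ext) (simp add: algebra_simps power2_eq_square)
    ultimately have "?R N = integral {-1..1} (\<lambda>x. bump d x * ((\<rho> N - (x - m N)\<^sup>2) * (\<phi> N x)\<^sup>2))"
      by (simp only: integral_unique)
    also have "\<dots> = integral {-d..d} (\<lambda>x. (d\<^sup>2 - x\<^sup>2) * ((\<rho> N - (x - m N)\<^sup>2) * (\<phi> N x)\<^sup>2))"
      by (rule integral_bump) (use d in \<open>auto intro!: continuous_intros c\<close>)
    finally show ?case by (simp only: mult.assoc)
  qed
  from Lim_transform_eventually[OF lim ev] show ?thesis by (simp only: add_0_right)
qed

definition e0 :: "nat \<Rightarrow> real" where
  "e0 N = oscillator.E (\<phi> N) (D N) (\<kappa> N) (m N) (\<rho> N) 0 / (\<kappa> N)\<^sup>2"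

text \<open>Twice the potential r^2 - m0^2 at 0 times the arcsine density there, in accordance with
  equipartition.\<close>

definition T0 :: real where "T0 = 2 / pi * sqrt (r\<^sup>2 - m0\<^sup>2)"

lemma r2_m02: "r\<^sup>2 - m0\<^sup>2 > 0"
  using power_strict_mono[OF zero_in, of 2] by simp

lemma T0_pos: "T0 > 0"
  unfolding T0_def using r2_m02 by simp

text \<open>Of the three factors \<open>t\<close> one pays for the variation of the square root over
  the window, one for the Gronwall factor, and one gives the strict inequality that survives for
  large N.\<close>

lemma e0_bounds:
  assumes t: "t > 1"
  shows "\<forall>\<^sub>F N in sequentially. T0 / t ^ 3 < e0 N \<and> e0 N < T0 * t ^ 3"
proof -
  define R0 where "R0 = r\<^sup>2 - m0\<^sup>2"
  \<comment> \<open>The limiting potential exceeds \<open>R0 / 2\<close> on the window; one half of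
    this is spent on the deviation of \<open>m\<close> and \<open>\<rho>\<close> from their limits.
    \<open>L\<close> depends only on \<open>c\<close>, so \<open>d\<close> can afterwards be chosen
    to make \<open>exp (L * d)\<close> less than \<open>t\<close>.\<close>
  define c where "c = R0 / 4"
  define L where "L = 1 / sqrt c + 4 / c"
  define s where "s x = sqrt (r\<^sup>2 - (x - m0)\<^sup>2)" for x
  have R0: "R0 > 0" unfolding R0_def by (rule r2_m02)
  have c: "c > 0" using R0 by (simp add: c_def)
  have s0: "s 0 = sqrt R0" "s 0 > 0" using R0 by (simp_all add: s_def R0_def)
  have "\<forall>\<^sub>F x in nhds 0. s 0 / t < s x \<and> s x < s 0 * t \<and> R0 / 2 < r\<^sup>2 - (x - m0)\<^sup>2 \<and> exp (L * x) < t"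
  proof (intro eventually_conj)
    have "isCont s 0" unfolding s_def by (intro continuous_intros)
    then have s: "(s \<longlongrightarrow> s 0) (nhds 0)" by (simp add: isCont_def tendsto_nhds_iff)
    show "\<forall>\<^sub>F x in nhds 0. s 0 / t < s x"
      using s0 t by (intro order_tendstoD(1)[OF s]) (simp add: field_simps)
    show "\<forall>\<^sub>F x in nhds 0. s x < s 0 * t"
      using s0 t by (intro order_tendstoD(2)[OF s]) simp
    have "isCont (\<lambda>x. r\<^sup>2 - (x - m0)\<^sup>2) 0" by (intro continuous_intros)
    then have "((\<lambda>x. r\<^sup>2 - (x - m0)\<^sup>2) \<longlongrightarrow> R0) (nhds 0)" by (simp add: isCont_def tendsto_nhds_iff R0_def)
    then show "\<forall>\<^sub>F x in nhds 0. R0 / 2 < r\<^sup>2 - (x - m0)\<^sup>2"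
      using R0 by (intro order_tendstoD(1)) auto
    have "isCont (\<lambda>x. exp (L * x)) 0" by (intro continuous_intros)
    then have "((\<lambda>x. exp (L * x)) \<longlongrightarrow> 1) (nhds 0)" by (simp add: isCont_def tendsto_nhds_iff)
    then show "\<forall>\<^sub>F x in nhds 0. exp (L * x) < t"
      using t by (intro order_tendstoD(2)) auto
  qed
  then obtain dd where dd: "dd > 0" "\<And>x. \<bar>x\<bar> < dd \<Longrightarrow> s 0 / t < s x \<and> s x < s 0 * t \<and> R0 / 2 < r\<^sup>2 - (x - m0)\<^sup>2 \<and> exp (L * x) < t"
    unfolding eventually_nhds_metric by (auto simp: dist_real_def)
  define d where "d = min (dd / 2) (1 / 2)"
  have d: "0 < d" "d < 1" using dd(1) by (auto simp: d_def)
  have x: "s 0 / t < s x" "s x < s 0 * t" "R0 / 2 < r\<^sup>2 - (x - m0)\<^sup>2" "exp (L * x) < t" if "\<bar>x\<bar> \<le> d" for x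
    using dd(2)[of x] that dd(1) by (auto simp: d_def)
  define X where "X = exp (L * d)"
  have X: "1 / X > 1 / t" "X < t" "X > 0" using x(4)[of d] d t by (auto simp: X_def field_simps)
  define H where "H = 4 * d ^ 3 / 3"
  have H: "H > 0" using d by (simp add: H_def)
  define C where "C = 4 * X / sqrt c"
  have C: "C > 0" using X c by (simp add: C_def)
  define Q where "Q N = integral {-d..d} (\<lambda>x. (d\<^sup>2 - x\<^sup>2) * (\<rho> N - (x - m N)\<^sup>2) * (\<phi> N x)\<^sup>2)" for N
  define q where "q = Lam (\<lambda>x. bump d x * (r\<^sup>2 - (x - m0)\<^sup>2))"
  have Q: "Q \<longlonglongrightarrow> q" unfolding Q_def q_def by (rule local_mass_lim[OF d])
  have hasH: "((\<lambda>x. d\<^sup>2 - x\<^sup>2) has_integral H) {-d..d}"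
  proof -
    have "((\<lambda>x. d\<^sup>2 - x\<^sup>2) has_integral (d\<^sup>2 * d - d ^ 3 / 3) - (d\<^sup>2 * (-d) - (-d) ^ 3 / 3)) {-d..d}"
      using d by (intro fundamental_theorem_of_calculus)
        (auto simp flip: has_real_derivative_iff_has_vector_derivative intro!: derivative_eq_intros)
    then show ?thesis by (simp add: H_def power2_eq_square power3_eq_cube mult.assoc)
  qed
  have sub: "{-d..d} \<subseteq> {m0 - r..m0 + r}"
  proof
    fix y assume "y \<in> {-d..d}"
    then have "\<bar>y\<bar> \<le> d" by auto
    from x(3)[OF this] have "(y - m0)\<^sup>2 \<le> r\<^sup>2" using R0 by linarith
    then have "\<bar>y - m0\<bar> \<le> r" using r_pos abs_le_square_iff[of "y - m0" r] by simp
    then show "y \<in> {m0 - r..m0 + r}" by auto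
  qed
  have qs: "q = integral {-d..d} (\<lambda>x. (d\<^sup>2 - x\<^sup>2) * s x) / pi"
    unfolding q_def s_def by (rule Lam_bump[OF d(1) sub])
  have si: "(\<lambda>x. (d\<^sup>2 - x\<^sup>2) * s x) integrable_on {-d..d}"
    unfolding s_def by (intro integrable_continuous_real continuous_intros)
  have xd: "0 \<le> d\<^sup>2 - x\<^sup>2" if "x \<in> {-d..d}" for x
    using bump_eq(1)[OF d(1) that] by simp
  have q1: "H * (s 0 / t) \<le> q * pi"
  proof -
    have "H * (s 0 / t) \<le> integral {-d..d} (\<lambda>x. (d\<^sup>2 - x\<^sup>2) * s x)"
      by (rule has_integral_le[OF has_integral_mult_left[OF hasH] integrable_integral[OF si]])
         (intro mult_left_mono xd less_imp_le[OF x(1)], auto)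
    then show ?thesis by (simp add: qs)
  qed
  have q2: "q * pi \<le> H * (s 0 * t)"
  proof -
    have "integral {-d..d} (\<lambda>x. (d\<^sup>2 - x\<^sup>2) * s x) \<le> H * (s 0 * t)"
      by (rule has_integral_le[OF integrable_integral[OF si] has_integral_mult_left[OF hasH]])
         (intro mult_left_mono xd less_imp_le[OF x(2)], auto)
    then show ?thesis by (simp add: qs)
  qed
  \<comment> \<open>The two inequalities of \<open>E_bounds\<close> solved for
    \<open>e0 N\<close>.\<close>
  have lim1: "(\<lambda>N. (2 * Q N + 1 / \<kappa> N) / (H / X - C * (1 / \<kappa> N))) \<longlonglongrightarrow> (2 * q + 0) / (H / X - C * 0)"
    by (intro tendsto_intros Q inv_kappa_lim) (use H X in auto)
  have lim2: "(\<lambda>N. 2 * Q N / (H * X + C * (1 / \<kappa> N))) \<longlonglongrightarrow> 2 * q / (H * X + C * 0)"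
    by (intro tendsto_intros Q inv_kappa_lim) (use H X in auto)
  have T: "T0 = 2 / pi * s 0" by (simp add: T0_def s0 R0_def)
  have b1: "(2 * q + 0) / (H / X - C * 0) < T0 * t ^ 3"
  proof -
    have "(2 * q + 0) / (H / X - C * 0) = 2 / pi * (q * pi) * X / H" using X H by simp
    also have "\<dots> \<le> 2 / pi * (H * (s 0 * t)) * X / H"
      using q2 X H by (intro divide_right_mono mult_right_mono mult_left_mono) auto
    also have "\<dots> = T0 * t * X" using H by (simp add: T)
    also have "\<dots> \<le> T0 * t * t" using X T0_pos t by (intro mult_left_mono) auto
    also have "\<dots> < T0 * t * t * t" using T0_pos t by simp
    finally show ?thesis by (simp add: power3_eq_cube mult.assoc)
  qed
  have b2: "T0 / t ^ 3 < 2 * q / (H * X + C * 0)"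
  proof -
    have "T0 / t ^ 3 = T0 / (t * t) / t" by (simp add: power3_eq_cube)
    also have "\<dots> < T0 / (t * t)" using T0_pos t by (simp add: field_simps)
    also have "\<dots> = T0 / t * (1 / t)" by simp
    also have "\<dots> \<le> T0 / t * (1 / X)" using X T0_pos t by (intro mult_left_mono) auto
    also have "\<dots> = 2 / pi * (H * (s 0 / t)) / (H * X)" using H by (simp add: T)
    also have "\<dots> \<le> 2 / pi * (q * pi) / (H * X)"
      using q1 X H by (intro divide_right_mono mult_left_mono) auto
    finally show ?thesis by simp
  qed
  have m1: "\<bar>m0\<bar> < 1" using zero_in left right by auto
  have ev_m: "\<forall>\<^sub>F N in sequentially. \<bar>m N\<bar> < 1"
    using order_tendstoD(2)[OF tendsto_rabs[OF m_lim] m1] .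
  have "(\<lambda>N. \<bar>\<rho> N - r\<^sup>2\<bar> + \<bar>m0\<^sup>2 - (m N)\<^sup>2\<bar> + 2 * \<bar>m N - m0\<bar>) \<longlonglongrightarrow> \<bar>r\<^sup>2 - r\<^sup>2\<bar> + \<bar>m0\<^sup>2 - m0\<^sup>2\<bar> + 2 * \<bar>m0 - m0\<bar>"
    by (intro tendsto_intros rho_lim m_lim)
  then have ev_R: "\<forall>\<^sub>F N in sequentially. \<bar>\<rho> N - r\<^sup>2\<bar> + \<bar>m0\<^sup>2 - (m N)\<^sup>2\<bar> + 2 * \<bar>m N - m0\<bar> < c"
    using c by (intro order_tendstoD(2)) auto
  have "(\<lambda>N. H / X - C * (1 / \<kappa> N)) \<longlonglongrightarrow> H / X - C * 0"
    by (intro tendsto_intros inv_kappa_lim) 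
  then have ev_H: "\<forall>\<^sub>F N in sequentially. 0 < H / X - C * (1 / \<kappa> N)"
    by (rule order_tendstoD(1)) (use H X(3) in simp)
  show ?thesis
    using osc ev_m ev_R ev_H order_tendstoD(2)[OF lim1 b1] order_tendstoD(1)[OF lim2 b2]
  proof eventually_elim
    case (elim N)
    interpret oscillator "\<phi> N" "D N" "\<kappa> N" "m N" "\<rho> N" by fact
    have Rc: "c \<le> \<rho> N - (y - m N)\<^sup>2" if y: "\<bar>y\<bar> \<le> d" for y
    proof -
      have "\<rho> N - (y - m N)\<^sup>2 = r\<^sup>2 - (y - m0)\<^sup>2 + (\<rho> N - r\<^sup>2) + (m0\<^sup>2 - (m N)\<^sup>2) + 2 * (y * (m N - m0))"
        by (simp add: algebra_simps power2_eq_square)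
      moreover have "\<bar>y * (m N - m0)\<bar> \<le> 1 * \<bar>m N - m0\<bar>"
        unfolding abs_mult using y d by (intro mult_right_mono) auto
      ultimately show ?thesis using x(3)[OF y] elim(3) unfolding c_def by linarith
    qed
    have m: "\<bar>m N\<bar> \<le> 1" using elim by simp
    have L: "lip c = L" unfolding L_def by (rule lip_def[OF c d m Rc])
    have E1: "e0 N * H * (1 / X) \<le> 2 * Q N + 1 / \<kappa> N + C * e0 N / \<kappa> N"
      using E_bounds(1)[OF c d m Rc] unfolding L e0_def[symmetric] Q_def[symmetric] H_def[symmetric]
      by (simp add: C_def X_def exp_minus field_simps)
    have E2: "2 * Q N \<le> e0 N * H * X + C * e0 N / \<kappa> N"
      using E_bounds(2)[OF c d m Rc] unfolding L e0_def[symmetric] Q_def[symmetric] H_def[symmetric]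
      by (simp add: C_def X_def)
    have "e0 N * (H / X - C * (1 / \<kappa> N)) \<le> 2 * Q N + 1 / \<kappa> N"
      using E1 by (simp add: right_diff_distrib mult.commute)
    then have "e0 N \<le> (2 * Q N + 1 / \<kappa> N) / (H / X - C * (1 / \<kappa> N))"
      using elim(4) by (simp only: pos_le_divide_eq)
    moreover have "2 * Q N / (H * X + C * (1 / \<kappa> N)) \<le> e0 N"
    proof -
      have "0 < H * X + C * (1 / \<kappa> N)" using H X C kappa_pos by (intro add_pos_pos) auto
      moreover have "2 * Q N \<le> e0 N * (H * X + C * (1 / \<kappa> N))"
        using E2 by (simp add: distrib_left mult.commute mult.left_commute)
      ultimately show ?thesis by (simp only: pos_divide_le_eq)
    qed
    ultimately show ?case using elim(5,6) by linarith
  qed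
qed

lemma e0_lim: "e0 \<longlonglongrightarrow> T0"
proof (rule order_tendstoI)
  fix a assume a: "a < T0"
  have "((\<lambda>t. T0 / t ^ 3) \<longlongrightarrow> T0 / 1 ^ 3) (at_right 1)" by (intro tendsto_intros) auto
  then have "\<forall>\<^sub>F t in at_right 1. a < T0 / t ^ 3" using a by (intro order_tendstoD(1)) auto
  moreover have "\<forall>\<^sub>F t in at_right (1::real). t > 1" by (simp add: eventually_at_filter)
  ultimately have "\<forall>\<^sub>F t in at_right (1::real). a < T0 / t ^ 3 \<and> t > 1" by (rule eventually_conj)
  then obtain t where "a < T0 / t ^ 3" "t > 1" using eventually_happens'[OF trivial_limit_at_right_real] by blast
  from e0_bounds[OF this(2)] show "\<forall>\<^sub>F N in sequentially. a < e0 N"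
    by eventually_elim (use \<open>a < T0 / t ^ 3\<close> in linarith)
next
  fix a assume a: "T0 < a"
  have "((\<lambda>t. T0 * t ^ 3) \<longlongrightarrow> T0 * 1 ^ 3) (at_right 1)" by (intro tendsto_intros)
  then have "\<forall>\<^sub>F t in at_right 1. T0 * t ^ 3 < a" using a by (intro order_tendstoD(2)) auto
  moreover have "\<forall>\<^sub>F t in at_right (1::real). t > 1" by (simp add: eventually_at_filter)
  ultimately have "\<forall>\<^sub>F t in at_right (1::real). T0 * t ^ 3 < a \<and> t > 1" by (rule eventually_conj)
  then obtain t where "T0 * t ^ 3 < a" "t > 1" using eventually_happens'[OF trivial_limit_at_right_real] by blast
  from e0_bounds[OF this(2)] show "\<forall>\<^sub>F N in sequentially. e0 N < a"
    by eventually_elim (use \<open>T0 * t ^ 3 < a\<close> in linarith)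
qed

end

section \<open>Local comparison with a rotation\<close>

text \<open>With \<open>u\<close> and \<open>v\<close> equal to 1 the pair (f, g) turns with angular
  speed \<open>pi\<close>, the speed that belongs to the sine kernel. Two separate factors are
  allowed because the equations for \<open>\<phi>\<close> and for \<open>D\<close> deviate from it
  in different ways.\<close>

locale near_rotation =
  fixes f g u v :: "real \<Rightarrow> real" and S \<delta> :: real
  assumes S: "S > 0" and delta: "0 \<le> \<delta>" "\<delta> \<le> 1"
    and f_deriv: "x \<in> {-S..S} \<Longrightarrow> (f has_real_derivative pi * g x * u x) (at x)"
    and g_deriv: "x \<in> {-S..S} \<Longrightarrow> (g has_real_derivative - pi * f x * v x) (at x)"
    and u: "x \<in> {-S..S} \<Longrightarrow> \<bar>u x - 1\<bar> \<le> \<delta>"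
    and v: "x \<in> {-S..S} \<Longrightarrow> \<bar>v x - 1\<bar> \<le> \<delta>"
begin

definition F :: "real \<Rightarrow> real" where "F x = (f x)\<^sup>2 + (g x)\<^sup>2"

text \<open>A crude Gronwall bound, using only \<delta> \<le> 1; with it all finer error estimates
  become linear in \<open>\<delta>\<close>.\<close>

definition B :: real where "B = F 0 * exp (2 * pi * S)"

lemma F_deriv:
  assumes "x \<in> {-S..S}"
  shows "(F has_real_derivative 2 * pi * f x * g x * (u x - v x)) (at x)"
  unfolding F_def[abs_def]
  by (rule DERIV_cong, (rule derivative_intros f_deriv[OF assms] g_deriv[OF assms])+) (simp add: algebra_simps)

lemma two_fg: "2 * \<bar>f x * g x\<bar> \<le> F x"
proof -
  have "0 \<le> (\<bar>f x\<bar> - \<bar>g x\<bar>)\<^sup>2" by simp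
  then show ?thesis by (simp add: F_def power2_diff abs_mult)
qed

lemma F_nonneg: "F x \<ge> 0" by (simp add: F_def)

lemma F_deriv_le:
  assumes "x \<in> {-S..S}"
  shows "\<bar>2 * pi * f x * g x * (u x - v x)\<bar> \<le> 2 * pi * \<delta> * F x"
proof -
  have "\<bar>u x - v x\<bar> \<le> 2 * \<delta>" using u[OF assms] v[OF assms] by linarith
  then have "(pi * (2 * \<bar>f x * g x\<bar>)) * \<bar>u x - v x\<bar> \<le> (pi * F x) * (2 * \<delta>)"
    using two_fg[of x] F_nonneg[of x] by (intro mult_mono) auto
  moreover have "\<bar>2 * pi * f x * g x * (u x - v x)\<bar> = (pi * (2 * \<bar>f x * g x\<bar>)) * \<bar>u x - v x\<bar>"
    by (simp only: abs_mult abs_numeral abs_of_pos[OF pi_gt_zero] ac_simps)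
  moreover have "(pi * F x) * (2 * \<delta>) = 2 * pi * \<delta> * F x" by (simp only: ac_simps)
  ultimately show ?thesis by linarith
qed

lemma F_le_B:
  assumes "x \<in> {-S..S}" shows "F x \<le> B"
proof -
  have d: "\<bar>2 * pi * f t * g t * (u t - v t)\<bar> \<le> 2 * pi * F t" if "t \<in> {-S..S}" for t
  proof -
    have "2 * pi * \<delta> * F t \<le> 2 * pi * 1 * F t"
      using delta F_nonneg[of t] by (intro mult_right_mono mult_left_mono) auto
    then show ?thesis using F_deriv_le[OF that] by linarith
  qed
  have S2: "exp (2 * pi * \<bar>x\<bar>) \<le> exp (2 * pi * S)" using assms by auto
  have "F x \<le> F 0 * exp (2 * pi * \<bar>x\<bar>)"
  proof (cases "x \<ge> 0")
    case True
    have "F x * exp (- (2 * pi) * x) \<le> F 0 * exp (- (2 * pi) * 0)"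
    proof (rule DERIV_nonpos_imp_nonincreasing[OF True])
      fix t assume "0 \<le> t" "t \<le> x"
      then have t: "t \<in> {-S..S}" using assms by auto
      have "((\<lambda>t. F t * exp (- (2 * pi) * t)) has_real_derivative
          2 * pi * f t * g t * (u t - v t) * exp (- (2 * pi) * t) + (exp (- (2 * pi) * t) * (- (2 * pi))) * F t) (at t)"
        by (rule DERIV_mult F_deriv t)+ (rule derivative_eq_intros refl | simp)+
      moreover have "2 * pi * f t * g t * (u t - v t) * exp (- (2 * pi) * t) + (exp (- (2 * pi) * t) * (- (2 * pi))) * F t
         = exp (- (2 * pi) * t) * (2 * pi * f t * g t * (u t - v t) - 2 * pi * F t)"
        by (simp add: algebra_simps)
      moreover have "exp (- (2 * pi) * t) * (2 * pi * f t * g t * (u t - v t) - 2 * pi * F t) \<le> 0"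
        using d[OF t] by (intro mult_nonneg_nonpos) (auto simp: abs_le_iff)
      ultimately show "\<exists>y. ((\<lambda>t. F t * exp (- (2 * pi) * t)) has_real_derivative y) (at t) \<and> y \<le> 0" by auto
    qed
    then show ?thesis using True by (simp add: exp_minus field_simps)
  next
    case False
    then have x0: "x \<le> 0" by simp
    have "F x * exp (2 * pi * x) \<le> F 0 * exp (2 * pi * 0)"
    proof (rule DERIV_nonneg_imp_nondecreasing[OF x0])
      fix t assume "x \<le> t" "t \<le> 0"
      then have t: "t \<in> {-S..S}" using assms by auto
      have "((\<lambda>t. F t * exp (2 * pi * t)) has_real_derivative
          2 * pi * f t * g t * (u t - v t) * exp (2 * pi * t) + (exp (2 * pi * t) * (2 * pi)) * F t) (at t)"
        by (rule DERIV_mult F_deriv t)+ (rule derivative_eq_intros refl | simp)+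
      moreover have "2 * pi * f t * g t * (u t - v t) * exp (2 * pi * t) + (exp (2 * pi * t) * (2 * pi)) * F t
         = exp (2 * pi * t) * (2 * pi * f t * g t * (u t - v t) + 2 * pi * F t)"
        by (simp add: algebra_simps)
      moreover have "exp (2 * pi * t) * (2 * pi * f t * g t * (u t - v t) + 2 * pi * F t) \<ge> 0"
        using d[OF t] by (intro mult_nonneg_nonneg) (auto simp: abs_le_iff)
      ultimately show "\<exists>y. ((\<lambda>t. F t * exp (2 * pi * t)) has_real_derivative y) (at t) \<and> y \<ge> 0" by auto
    qed
    then show ?thesis using False by (simp add: exp_minus field_simps)
  qed
  also have "\<dots> \<le> B" unfolding B_def using S2 F_nonneg by (intro mult_left_mono) auto
  finally show ?thesis .
qed

lemma B_nonneg: "B \<ge> 0"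
  using F_nonneg by (simp add: B_def)

lemma F_diff:
  assumes "x \<in> {-S..S}" shows "\<bar>F x - F 0\<bar> \<le> 2 * pi * \<delta> * B * S"
proof -
  have "norm (F x - F 0) \<le> (2 * pi * \<delta> * B) * norm (x - 0)"
  proof (rule field_differentiable_bound[where S = "{-S..S}"])
    fix z assume z: "z \<in> {-S..S}"
    show "(F has_real_derivative 2 * pi * f z * g z * (u z - v z)) (at z within {-S..S})"
      by (rule DERIV_subset[OF F_deriv[OF z]]) simp
    have "2 * pi * \<delta> * F z \<le> 2 * pi * \<delta> * B" using F_le_B[OF z] delta by (intro mult_left_mono) auto
    then show "norm (2 * pi * f z * g z * (u z - v z)) \<le> 2 * pi * \<delta> * B"
      unfolding real_norm_def using F_deriv_le[OF z] by linarith
  qed (use assms S in auto)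
  also have "\<dots> \<le> (2 * pi * \<delta> * B) * S"
    using assms delta B_nonneg by (intro mult_left_mono) auto
  finally show ?thesis by simp
qed

lemma prod_le_B:
  assumes "x \<in> {-S..S}" "y \<in> {-S..S}"
  shows "\<bar>f x * f y\<bar> \<le> B" "\<bar>g x * g y\<bar> \<le> B" "\<bar>f x * g y\<bar> \<le> B" "\<bar>g x * f y\<bar> \<le> B"
proof -
  have le: "\<bar>f z\<bar> \<le> sqrt B" "\<bar>g z\<bar> \<le> sqrt B" if "z \<in> {-S..S}" for z
  proof -
    have "(f z)\<^sup>2 \<le> F z" "(g z)\<^sup>2 \<le> F z" by (simp_all add: F_def)
    then have "(f z)\<^sup>2 \<le> B" "(g z)\<^sup>2 \<le> B" using F_le_B[OF that] by linarith+
    then show "\<bar>f z\<bar> \<le> sqrt B" "\<bar>g z\<bar> \<le> sqrt B" using real_le_rsqrt by auto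
  qed
  have *: "\<bar>a * b\<bar> \<le> B" if "\<bar>a\<bar> \<le> sqrt B" "\<bar>b\<bar> \<le> sqrt B" for a b
  proof -
    have "\<bar>a\<bar> * \<bar>b\<bar> \<le> sqrt B * sqrt B" using that B_nonneg by (intro mult_mono) auto
    then show ?thesis using B_nonneg by (simp add: abs_mult)
  qed
  show "\<bar>f x * f y\<bar> \<le> B" "\<bar>g x * g y\<bar> \<le> B" "\<bar>f x * g y\<bar> \<le> B" "\<bar>g x * f y\<bar> \<le> B"
    by (rule *[OF le(1)[OF assms(1)] le(1)[OF assms(2)]], rule *[OF le(2)[OF assms(1)] le(2)[OF assms(2)]],
        rule *[OF le(1)[OF assms(1)] le(2)[OF assms(2)]], rule *[OF le(2)[OF assms(1)] le(1)[OF assms(2)]])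
qed

text \<open>Seen in a frame rotating with angular speed \<open>pi\<close>, the vector
  \<open>(P, Q)\<close> measuring the deviation from the exact rotation is almost constant; since
  \<open>P\<close> vanishes at \<open>y\<close>, integrating once more gains the factor \<open>\<bar>x - y\<bar>\<close>.\<close>

lemma wronskian_sin:
  assumes x: "x \<in> {-S..S}" and y: "y \<in> {-S..S}"
  shows "\<bar>f x * g y - g x * f y - F 0 * sin (pi * (x - y))\<bar> \<le> (18 * pi * pi * S + 2 * pi) * \<delta> * B * \<bar>x - y\<bar>"
proof -
  define P where "P t = f t * g y - g t * f y - F 0 * sin (pi * (t - y))" for t
  define Q where "Q t = g t * g y + f t * f y - F 0 * cos (pi * (t - y))" for t
  define e1 where "e1 t = pi * ((u t - 1) * (g t * g y) + (v t - 1) * (f t * f y))" for t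
  define e2 where "e2 t = pi * ((u t - 1) * (g t * f y) - (v t - 1) * (f t * g y))" for t
  have dP: "(P has_real_derivative pi * Q t + e1 t) (at t)" if t: "t \<in> {-S..S}" for t
    unfolding P_def Q_def e1_def
    by (rule DERIV_cong, (rule derivative_intros f_deriv[OF t] g_deriv[OF t] DERIV_fun_sin)+) (simp add: algebra_simps)
  have dQ: "(Q has_real_derivative - pi * P t + e2 t) (at t)" if t: "t \<in> {-S..S}" for t
    unfolding P_def Q_def e2_def
    by (rule DERIV_cong, (rule derivative_intros f_deriv[OF t] g_deriv[OF t] DERIV_fun_cos)+) (simp add: algebra_simps)
  have e: "\<bar>e1 t\<bar> \<le> 2 * pi * \<delta> * B" "\<bar>e2 t\<bar> \<le> 2 * pi * \<delta> * B" if t: "t \<in> {-S..S}" for t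
  proof -
    have m: "\<bar>a * b\<bar> \<le> \<delta> * B" if "\<bar>a\<bar> \<le> \<delta>" "\<bar>b\<bar> \<le> B" for a b
      unfolding abs_mult using that delta by (intro mult_mono) auto
    note p = prod_le_B[OF t y]
    have "\<bar>(u t - 1) * (g t * g y) + (v t - 1) * (f t * f y)\<bar> \<le> 2 * (\<delta> * B)"
      using m[OF u[OF t] p(2)] m[OF v[OF t] p(1)] by linarith
    then have "pi * \<bar>(u t - 1) * (g t * g y) + (v t - 1) * (f t * f y)\<bar> \<le> pi * (2 * (\<delta> * B))"
      by (intro mult_left_mono) auto
    then show "\<bar>e1 t\<bar> \<le> 2 * pi * \<delta> * B" unfolding e1_def by (simp add: abs_mult ac_simps)
    have "\<bar>(u t - 1) * (g t * f y) - (v t - 1) * (f t * g y)\<bar> \<le> 2 * (\<delta> * B)"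
      using m[OF u[OF t] p(4)] m[OF v[OF t] p(3)] by linarith
    then have "pi * \<bar>(u t - 1) * (g t * f y) - (v t - 1) * (f t * g y)\<bar> \<le> pi * (2 * (\<delta> * B))"
      by (intro mult_left_mono) auto
    then show "\<bar>e2 t\<bar> \<le> 2 * pi * \<delta> * B" unfolding e2_def by (simp add: abs_mult ac_simps)
  qed
  let ?c = "\<lambda>t. cos (pi * (t - y))" and ?s = "\<lambda>t. sin (pi * (t - y))"
  \<comment> \<open>Rotating back by the angle \<open>pi * (t - y)\<close> removes the main terms
    from the derivatives of \<open>P\<close> and \<open>Q\<close>; only \<open>e1\<close> and
    \<open>e2\<close> are left.\<close>
  define p where "p t = P t * ?c t - Q t * ?s t" for t
  define q where "q t = P t * ?s t + Q t * ?c t" for t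
  have comb: "\<bar>a * c + b * d\<bar> \<le> 4 * pi * \<delta> * B" if "\<bar>a\<bar> \<le> 2 * pi * \<delta> * B" "\<bar>b\<bar> \<le> 2 * pi * \<delta> * B" "\<bar>c\<bar> \<le> 1" "\<bar>d\<bar> \<le> 1" for a b c d
  proof -
    have "\<bar>a * c\<bar> \<le> (2 * pi * \<delta> * B) * 1" "\<bar>b * d\<bar> \<le> (2 * pi * \<delta> * B) * 1"
      unfolding abs_mult using that by (intro mult_mono; force)+
    then show ?thesis by linarith
  qed
  have nb: "\<bar>t - y\<bar> \<le> 2 * S" if "t \<in> {-S..S}" for t using that y by auto
  have bound: "\<bar>h t - h y\<bar> \<le> 8 * pi * \<delta> * B * S"
    if h: "\<And>z. z \<in> {-S..S} \<Longrightarrow> (h has_real_derivative h' z) (at z)" "\<And>z. z \<in> {-S..S} \<Longrightarrow> \<bar>h' z\<bar> \<le> 4 * pi * \<delta> * B"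
      and t: "t \<in> {-S..S}" for h h' t
  proof -
    have "norm (h t - h y) \<le> (4 * pi * \<delta> * B) * norm (t - y)"
      by (rule field_differentiable_bound[where S = "{-S..S}" and f' = h'])
         (use t y h in \<open>auto intro: DERIV_subset\<close>)
    also have "\<dots> \<le> (4 * pi * \<delta> * B) * (2 * S)"
      using nb[OF t] delta B_nonneg by (intro mult_left_mono) auto
    finally show ?thesis by simp
  qed
  have dp: "(p has_real_derivative e1 z * ?c z + (- e2 z) * ?s z) (at z)" if z: "z \<in> {-S..S}" for z
    unfolding p_def
    by (rule DERIV_cong, (rule derivative_intros dP[OF z] dQ[OF z] DERIV_fun_sin DERIV_fun_cos)+) (simp add: algebra_simps)
  have dq: "(q has_real_derivative e1 z * ?s z + e2 z * ?c z) (at z)" if z: "z \<in> {-S..S}" for z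
    unfolding q_def
    by (rule DERIV_cong, (rule derivative_intros dP[OF z] dQ[OF z] DERIV_fun_sin DERIV_fun_cos)+) (simp add: algebra_simps)
  \<comment> \<open>18 = 8 + 8 + 2: the drift of \<open>p\<close> and of \<open>q\<close> over a
    distance of at most \<open>2 * S\<close>, and the initial value of \<open>q\<close>, which is
    \<open>F y - F 0\<close>.\<close>
  have Qb: "\<bar>Q t\<bar> \<le> 18 * pi * \<delta> * B * S" if t: "t \<in> {-S..S}" for t
  proof -
    have p: "\<bar>p t - p y\<bar> \<le> 8 * pi * \<delta> * B * S"
      by (rule bound[OF dp _ t], assumption, rule comb) (use e in auto)
    have q: "\<bar>q t - q y\<bar> \<le> 8 * pi * \<delta> * B * S"
      by (rule bound[OF dq _ t], assumption, rule comb) (use e in auto)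
    have py: "p y = 0" by (simp add: p_def P_def)
    have "q y = F y - F 0" by (simp add: q_def Q_def F_def power2_eq_square)
    then have qy: "\<bar>q y\<bar> \<le> 2 * pi * \<delta> * B * S" using F_diff[OF y] by simp
    have alg: "b * (s * s + c * c) = (a * s + b * c) * c - (a * c - b * s) * s" for a b c s :: real
      by (simp add: algebra_simps)
    have "Q t * (?s t * ?s t + ?c t * ?c t) = q t * ?c t - p t * ?s t"
      unfolding p_def q_def by (rule alg)
    moreover have "?s t * ?s t + ?c t * ?c t = 1"
      unfolding power2_eq_square[symmetric] by (rule sin_cos_squared_add)
    ultimately have "Q t = q t * ?c t - p t * ?s t" by simp
    moreover have "\<bar>q t * ?c t\<bar> \<le> \<bar>q t\<bar> * 1" "\<bar>p t * ?s t\<bar> \<le> \<bar>p t\<bar> * 1"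
      unfolding abs_mult by (intro mult_left_mono; simp)+
    ultimately show ?thesis using p q py qy by linarith
  qed
  have "norm (P x - P y) \<le> ((18 * pi * pi * S + 2 * pi) * \<delta> * B) * norm (x - y)"
  proof (rule field_differentiable_bound[where S = "{-S..S}"])
    fix z assume z: "z \<in> {-S..S}"
    show "(P has_real_derivative pi * Q z + e1 z) (at z within {-S..S})"
      by (rule DERIV_subset[OF dP[OF z]]) simp
    have "pi * \<bar>Q z\<bar> \<le> pi * (18 * pi * \<delta> * B * S)" by (intro mult_left_mono Qb z) simp
    then have "\<bar>pi * Q z\<bar> \<le> pi * (18 * pi * \<delta> * B * S)" by (simp add: abs_mult)
    moreover have "pi * (18 * pi * \<delta> * B * S) + 2 * pi * \<delta> * B = (18 * pi * pi * S + 2 * pi) * \<delta> * B"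
      by (simp add: algebra_simps)
    ultimately show "norm (pi * Q z + e1 z) \<le> (18 * pi * pi * S + 2 * pi) * \<delta> * B"
      using e(1)[OF z] by simp
  qed (use x y in auto)
  moreover have "P y = 0" by (simp add: P_def)
  ultimately show ?thesis by (simp add: P_def)
qed

end

section \<open>Elementary properties of the sine kernel\<close>

lemma sine_kernel_sinc: "sine_kernel x y = sinc (pi * (x - y))"
  by (simp add: sine_kernel_def)

lemma sine_kernel_le_1: "\<bar>sine_kernel x y\<bar> \<le> 1"
proof (cases "x = y")
  case False
  have "\<bar>sin (pi * (x - y))\<bar> \<le> \<bar>pi * (x - y)\<bar>" by (rule abs_sin_x_le_abs_x)
  then show ?thesis using False by (simp add: sine_kernel_def divide_le_eq)
qed (simp add: sine_kernel_def)

lemma sine_kernel_mult: "sine_kernel x y * (pi * (x - y)) = sin (pi * (x - y))"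
  by (simp add: sine_kernel_def)

section \<open>Local limit of the kernel\<close>

lemma isCont_sine_kernel: "isCont (\<lambda>x. sine_kernel x y) z"
proof -
  have "isCont (\<lambda>x. sinc (pi * (x - y))) z"
    by (rule isCont_o2[OF _ isCont_sinc]) (intro continuous_intros)
  then show ?thesis unfolding sine_kernel_sinc .
qed

text \<open>\<open>\<mu>\<close> is the local point density used for unfolding. The assumption
  \<open>ratio_lim\<close> is the only place where its size matters: it says that the frequency at
  0, measured in the unfolded variable, tends to \<open>pi\<close>.\<close>

locale kernel_scaling = oscillator_limit +
  fixes k :: "nat \<Rightarrow> real \<Rightarrow> real \<Rightarrow> real" and \<mu> :: "nat \<Rightarrow> real"
  assumes mu_lim: "filterlim \<mu> at_top sequentially"
    and ratio_lim: "(\<lambda>N. \<kappa> N / (pi * \<mu> N)) \<longlonglongrightarrow> 1 / sqrt (r\<^sup>2 - m0\<^sup>2)"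
    and kernel: "\<forall>\<^sub>F N in sequentially. \<forall>x\<in>{-1<..<1}. \<forall>y\<in>{-1<..<1}.
      (2 * \<kappa> N + 1) * ((x - y) * k N x y) = \<phi> N x * D N y - D N x * \<phi> N y - \<kappa> N * (x - y) * (\<phi> N x * \<phi> N y)"
    and kernel_cont: "\<forall>\<^sub>F N in sequentially. \<forall>y\<in>{-1<..<1}. isCont (\<lambda>x. k N x y) y"
begin

definition w :: "nat \<Rightarrow> real" where "w N = (\<kappa> N / (pi * \<mu> N))\<^sup>2"

text \<open>The squared radius at 0 of the rotating pair formed by \<open>\<phi>\<close> and
  \<open>D / (pi * \<mu>)\<close>.\<close>

definition F0 :: "nat \<Rightarrow> real" where "F0 N = (\<phi> N 0)\<^sup>2 + (D N 0 / (pi * \<mu> N))\<^sup>2"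

definition A :: "nat \<Rightarrow> real" where "A N = pi * \<mu> N / (2 * \<kappa> N + 1)"

abbreviation R0 :: real where "R0 \<equiv> r\<^sup>2 - m0\<^sup>2"

lemma inv_mu_lim: "(\<lambda>N. 1 / \<mu> N) \<longlonglongrightarrow> 0"
  using tendsto_inverse_0_at_top[OF mu_lim] by (simp add: inverse_eq_divide)

lemma w_lim: "w \<longlonglongrightarrow> 1 / R0"
proof -
  have "w \<longlonglongrightarrow> (1 / sqrt R0)\<^sup>2" unfolding w_def by (intro tendsto_power ratio_lim)
  then show ?thesis using r2_m02 by (simp add: power_divide)
qed

lemma Rn_lim: "(\<lambda>N. \<rho> N - (m N)\<^sup>2) \<longlonglongrightarrow> R0"
  by (intro tendsto_intros rho_lim m_lim)

text \<open>Squared radius and energy differ only in the weight given to \<open>\<phi>\<close> at 0,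
  and \<open>w\<close> times the potential there tends to 1; the boundedness of the energy keeps the
  difference a null sequence.\<close>

lemma F0_lim: "F0 \<longlonglongrightarrow> T0 / R0"
proof -
  have wR: "(\<lambda>N. w N * (\<rho> N - (m N)\<^sup>2)) \<longlonglongrightarrow> 1 / R0 * R0" by (intro tendsto_mult w_lim Rn_lim)
  have "(\<lambda>N. \<bar>1 - w N * (\<rho> N - (m N)\<^sup>2)\<bar> * (2 * e0 N / R0)) \<longlonglongrightarrow> \<bar>1 - 1 / R0 * R0\<bar> * (2 * T0 / R0)"
    using r2_m02 by (intro tendsto_intros wR e0_lim) auto
  then have b: "(\<lambda>N. \<bar>1 - w N * (\<rho> N - (m N)\<^sup>2)\<bar> * (2 * e0 N / R0)) \<longlonglongrightarrow> 0"
    using r2_m02 by simp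
  have "\<forall>\<^sub>F N in sequentially. R0 / 2 < \<rho> N - (m N)\<^sup>2"
    using r2_m02 by (intro order_tendstoD(1)[OF Rn_lim]) simp
  then have "\<forall>\<^sub>F N in sequentially. norm (F0 N - w N * e0 N) \<le> \<bar>1 - w N * (\<rho> N - (m N)\<^sup>2)\<bar> * (2 * e0 N / R0)"
    using osc
  proof eventually_elim
    case (elim N)
    have k: "\<kappa> N > 0" using elim(2) by (rule oscillator.kappa_pos)
    have e: "e0 N = (D N 0)\<^sup>2 / (\<kappa> N)\<^sup>2 + (\<rho> N - (m N)\<^sup>2) * (\<phi> N 0)\<^sup>2"
      unfolding e0_def oscillator.E_def[OF elim(2)] using k by (simp add: add_divide_distrib)
    have "F0 N - w N * e0 N = (\<phi> N 0)\<^sup>2 * (1 - w N * (\<rho> N - (m N)\<^sup>2)) + ((D N 0 / (pi * \<mu> N))\<^sup>2 - w N * ((D N 0)\<^sup>2 / (\<kappa> N)\<^sup>2))"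
      unfolding F0_def e by (simp add: algebra_simps)
    also have "(D N 0 / (pi * \<mu> N))\<^sup>2 - w N * ((D N 0)\<^sup>2 / (\<kappa> N)\<^sup>2) = 0"
      using k by (simp add: w_def power_divide)
    finally have 1: "norm (F0 N - w N * e0 N) = \<bar>1 - w N * (\<rho> N - (m N)\<^sup>2)\<bar> * (\<phi> N 0)\<^sup>2"
      by (simp add: abs_mult)
    have "R0 / 2 * (\<phi> N 0)\<^sup>2 \<le> (\<rho> N - (m N)\<^sup>2) * (\<phi> N 0)\<^sup>2"
      using elim(1) by (intro mult_right_mono) auto
    also have "\<dots> \<le> e0 N" unfolding e by simp
    finally have "(\<phi> N 0)\<^sup>2 \<le> 2 * e0 N / R0" using r2_m02 by (simp add: field_simps)
    then show ?case unfolding 1 by (intro mult_left_mono) auto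
  qed
  then have "(\<lambda>N. F0 N - w N * e0 N) \<longlonglongrightarrow> 0" by (rule Lim_null_comparison[OF _ b])
  from tendsto_add[OF this tendsto_mult[OF w_lim e0_lim]] show ?thesis by simp
qed

lemma A_lim: "A \<longlonglongrightarrow> sqrt R0 / 2"
proof -
  have lim: "(\<lambda>N. 1 / (2 * (\<kappa> N / (pi * \<mu> N)) + 1 / \<mu> N * (1 / pi))) \<longlonglongrightarrow> 1 / (2 * (1 / sqrt R0) + 0 * (1 / pi))"
    using r2_m02 by (intro tendsto_intros ratio_lim inv_mu_lim) auto
  have "\<forall>\<^sub>F N in sequentially. \<mu> N > 0"
    using mu_lim unfolding filterlim_at_top_dense by blast
  then have ev: "\<forall>\<^sub>F N in sequentially. 1 / (2 * (\<kappa> N / (pi * \<mu> N)) + 1 / \<mu> N * (1 / pi)) = A N"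
  proof eventually_elim
    case (elim N)
    then have "2 * (\<kappa> N / (pi * \<mu> N)) + 1 / \<mu> N * (1 / pi) = (2 * \<kappa> N + 1) / (pi * \<mu> N)"
      by (simp add: add_divide_distrib)
    then show ?case by (simp only: A_def) simp
  qed
  from Lim_transform_eventually[OF lim ev] show ?thesis by simp
qed

text \<open>Bounds both deviations from the rotation. The first summand covers \<open>u\<close>; the
  others cover the distortion of time, the drift of the potential over the window, its mismatch at
  0, and the part of the potential of order \<open>\<kappa>\<close>. The 3 bounds \<bar>2 m -
  x\<bar> for \<bar>m\<bar> < 1 and \<bar>x\<bar> < 1/2.\<close>

definition b :: "real \<Rightarrow> nat \<Rightarrow> real" where
  "b S N = 2 * (S * (1 / \<mu> N))\<^sup>2 + (2 * (S * (1 / \<mu> N))\<^sup>2 * w N * (\<bar>\<rho> N - (m N)\<^sup>2\<bar> + 3) + 3 * w N * (S * (1 / \<mu> N))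
     + \<bar>w N * (\<rho> N - (m N)\<^sup>2) - 1\<bar> + w N * (1 / \<kappa> N))"

lemma b_lim: "b S \<longlonglongrightarrow> 0"
proof -
  have "b S \<longlonglongrightarrow> 2 * (S * 0)\<^sup>2 + (2 * (S * 0)\<^sup>2 * (1 / R0) * (\<bar>R0\<bar> + 3) + 3 * (1 / R0) * (S * 0)
     + \<bar>1 / R0 * R0 - 1\<bar> + 1 / R0 * 0)"
    unfolding b_def by (intro tendsto_intros inv_mu_lim w_lim Rn_lim inv_kappa_lim)
  then show ?thesis using r2_m02 by simp
qed

text \<open>Three sources: the amplitude at finite N, the deviation from an exact rotation, and the
  term of the kernel with the product of the two values of \<open>\<phi>\<close>.\<close>

definition err :: "real \<Rightarrow> nat \<Rightarrow> real" where
  "err S N = \<bar>A N * F0 N * pi - 1\<bar> + A N * ((18 * pi * pi * S + 2 * pi) * b S N * (F0 N * exp (2 * pi * S)))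
     + 1 / \<mu> N * (F0 N * exp (2 * pi * S))"

text \<open>The constants meet here: sqrt R0 / 2 from the prefactor, T0 / R0 from the amplitude and
  the slope \<open>pi\<close> multiply to 1 by the value of \<open>T0\<close>.\<close>

lemma err_lim: "err S \<longlonglongrightarrow> 0"
proof -
  have "err S \<longlonglongrightarrow> \<bar>sqrt R0 / 2 * (T0 / R0) * pi - 1\<bar>
     + sqrt R0 / 2 * ((18 * pi * pi * S + 2 * pi) * 0 * (T0 / R0 * exp (2 * pi * S))) + 0 * (T0 / R0 * exp (2 * pi * S))"
    unfolding err_def by (intro tendsto_intros A_lim F0_lim b_lim inv_mu_lim)
  moreover have "sqrt R0 / 2 * (T0 / R0) * pi = sqrt R0 * sqrt R0 / R0" by (simp add: T0_def)
  moreover have "sqrt R0 * sqrt R0 / R0 = 1" using r2_m02 by simp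
  ultimately show ?thesis by (simp only:) simp
qed

lemma kernel_err:
  assumes S: "S > 0"
  shows "\<forall>\<^sub>F N in sequentially. \<forall>\<xi>\<in>{-S..S}. \<forall>\<eta>\<in>{-S..S}.
     \<bar>k N (\<xi> / \<mu> N) (\<eta> / \<mu> N) / \<mu> N - sine_kernel \<xi> \<eta>\<bar> \<le> err S N"
proof -
  have "(\<lambda>N. S * (1 / \<mu> N)) \<longlonglongrightarrow> S * 0" by (intro tendsto_intros inv_mu_lim)
  then have ev1: "\<forall>\<^sub>F N in sequentially. S * (1 / \<mu> N) < 1 / 2" by (intro order_tendstoD(2)) auto
  have ev2: "\<forall>\<^sub>F N in sequentially. b S N < 1" by (intro order_tendstoD(2)[OF b_lim]) simp
  have ev3: "\<forall>\<^sub>F N in sequentially. \<mu> N > 0"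
    using mu_lim unfolding filterlim_at_top_dense by blast
  have m1: "\<bar>m0\<bar> < 1" using zero_in left right by auto
  have ev4: "\<forall>\<^sub>F N in sequentially. \<bar>m N\<bar> < 1"
    using order_tendstoD(2)[OF tendsto_rabs[OF m_lim] m1] .
  show ?thesis
    using osc kernel kernel_cont ev1 ev2 ev3 ev4
  proof eventually_elim
    case (elim N)
    let ?k = "\<kappa> N" and ?mu = "\<mu> N" and ?R = "\<rho> N - (m N)\<^sup>2"
    interpret oscillator "\<phi> N" "D N" ?k "m N" "\<rho> N" by fact
    note mu = \<open>\<mu> N > 0\<close>
    \<comment> \<open>The functions in the unfolded variable. \<open>u\<close> and \<open>v\<close>
      are chosen so that the oscillator equations take the form of a perturbed rotation
      exactly.\<close>
    define f where "f \<xi> = \<phi> N (\<xi> / ?mu)" for \<xi>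
    define g where "g \<xi> = D N (\<xi> / ?mu) / (pi * ?mu)" for \<xi>
    define u where "u \<xi> = 1 / (1 - (\<xi> / ?mu)\<^sup>2)" for \<xi>
    define v where "v \<xi> = w N * (\<rho> N - (\<xi> / ?mu - m N)\<^sup>2) * u \<xi> + w N * (1 / ?k)" for \<xi>
    have w0: "w N \<ge> 0" by (simp add: w_def)
    have eta: "0 < S * (1 / ?mu)" "S * (1 / ?mu) < 1 / 2" using S mu elim by auto
    have x: "\<bar>\<xi> / ?mu\<bar> \<le> S * (1 / ?mu)" "\<xi> / ?mu \<in> {-1<..<1}" "(\<xi> / ?mu)\<^sup>2 \<le> (S * (1 / ?mu))\<^sup>2" "(\<xi> / ?mu)\<^sup>2 \<le> 1 / 4"
      if "\<xi> \<in> {-S..S}" for \<xi>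
    proof -
      have "\<bar>\<xi>\<bar> * (1 / ?mu) \<le> S * (1 / ?mu)" using that mu by (intro mult_right_mono) auto
      then show a: "\<bar>\<xi> / ?mu\<bar> \<le> S * (1 / ?mu)" using mu by (simp add: abs_divide)
      then have "\<bar>\<xi> / ?mu\<bar> < 1" using eta by linarith
      then have "-1 < \<xi> / ?mu \<and> \<xi> / ?mu < 1" unfolding abs_less_iff by linarith
      then show "\<xi> / ?mu \<in> {-1<..<1}" by (simp only: greaterThanLessThan_iff)
      show sq: "(\<xi> / ?mu)\<^sup>2 \<le> (S * (1 / ?mu))\<^sup>2"
      proof -
        have "\<bar>\<xi> / ?mu\<bar> \<le> \<bar>S * (1 / ?mu)\<bar>" using a abs_of_pos[OF eta(1)] by (simp only:)
        then show ?thesis by (simp only: abs_le_square_iff)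
      qed
      have "(S * (1 / ?mu))\<^sup>2 \<le> (1 / 2)\<^sup>2" using eta by (intro power_mono) auto
      moreover have "(1 / 2)\<^sup>2 = (1 / 4 :: real)" by (simp add: power_divide)
      ultimately show "(\<xi> / ?mu)\<^sup>2 \<le> 1 / 4" using sq by linarith
    qed
    have ud: "0 \<le> u \<xi> - 1 \<and> u \<xi> - 1 \<le> 2 * (S * (1 / ?mu))\<^sup>2" if "\<xi> \<in> {-S..S}" for \<xi>
    proof -
      define y where "y = (\<xi> / ?mu)\<^sup>2"
      have y: "0 \<le> y" "y \<le> 1 / 4" "y \<le> (S * (1 / ?mu))\<^sup>2" 
        unfolding y_def by (rule zero_le_power2, rule x(4)[OF that], rule x(3)[OF that])
      have "1 - y \<noteq> 0" using y by linarith
      then have eq: "u \<xi> - 1 = y / (1 - y)" by (simp only: u_def y_def[symmetric]) (simp add: field_simps)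
      have "y / (1 - y) \<le> 2 * y" using y mult_left_mono[OF y(2,1)] by (simp add: divide_le_eq algebra_simps)
      then show ?thesis using y unfolding eq by auto
    qed
    have b0: "0 \<le> 2 * (S * (1 / ?mu))\<^sup>2" "0 \<le> 2 * (S * (1 / ?mu))\<^sup>2 * w N * (\<bar>?R\<bar> + 3)" "0 \<le> 3 * w N * (S * (1 / ?mu))"
      "0 \<le> w N * (1 / ?k)"
    proof -
      have e: "0 \<le> S * (1 / ?mu)" "0 \<le> 3 * w N" "0 \<le> \<bar>?R\<bar> + 3" using eta w0 by auto
      show "0 \<le> 2 * (S * (1 / ?mu))\<^sup>2" by simp
      then have "0 \<le> 2 * (S * (1 / ?mu))\<^sup>2 * w N" using w0 by (rule mult_nonneg_nonneg)
      then show "0 \<le> 2 * (S * (1 / ?mu))\<^sup>2 * w N * (\<bar>?R\<bar> + 3)" using e(3) by (rule mult_nonneg_nonneg)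
      show "0 \<le> 3 * w N * (S * (1 / ?mu))" using e(2,1) by (rule mult_nonneg_nonneg)
      show "0 \<le> w N * (1 / ?k)" using w0 kappa_pos by simp
    qed
    have nr: "near_rotation f g u v S (b S N)"
    proof
      show "S > 0" by fact
      show "0 \<le> b S N" unfolding b_def using b0 by linarith
      show "b S N \<le> 1" using elim by simp
      fix \<xi> assume xi: "\<xi> \<in> {-S..S}"
      have s: "1 - (\<xi> / ?mu)\<^sup>2 > 0" using x(4)[OF xi] by linarith
      have dm: "((\<lambda>\<xi>. \<xi> / ?mu) has_real_derivative 1 / ?mu) (at \<xi>)" by (rule DERIV_cdivide[OF DERIV_ident])
      show "(f has_real_derivative pi * g \<xi> * u \<xi>) (at \<xi>)"
        unfolding f_def
        by (rule DERIV_cong[OF DERIV_chain2[where f = "\<phi> N" and g = "\<lambda>\<xi>. \<xi> / ?mu" and x = \<xi>, OF phi_deriv[OF x(2)[OF xi]] dm]])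
           (use mu in \<open>simp add: g_def u_def\<close>)
      have "((\<lambda>\<xi>. D N (\<xi> / ?mu) / (pi * ?mu)) has_real_derivative
         (- (?k\<^sup>2 * (\<rho> N - (\<xi> / ?mu - m N)\<^sup>2) + ?k * (1 - (\<xi> / ?mu)\<^sup>2)) * f \<xi> / (1 - (\<xi> / ?mu)\<^sup>2)) * (1 / ?mu) / (pi * ?mu)) (at \<xi>)"
        unfolding f_def by (rule DERIV_cdivide[OF DERIV_chain2[where f = "D N" and g = "\<lambda>\<xi>. \<xi> / ?mu" and x = \<xi>, OF D_deriv[OF x(2)[OF xi]] dm]])
      also have "(- (?k\<^sup>2 * (\<rho> N - (\<xi> / ?mu - m N)\<^sup>2) + ?k * (1 - (\<xi> / ?mu)\<^sup>2)) * f \<xi> / (1 - (\<xi> / ?mu)\<^sup>2)) * (1 / ?mu) / (pi * ?mu)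
          = - pi * f \<xi> * v \<xi>"
      proof -
        have alg: "- (K\<^sup>2 * R + K * s) * F / s * (1 / M) / (p * M) = - p * F * ((K / (p * M))\<^sup>2 * R * (1 / s) + (K / (p * M))\<^sup>2 * (1 / K))"
          if "s \<noteq> 0" "M \<noteq> 0" "p \<noteq> 0" "K \<noteq> 0" for K R s F M p :: real
          using that by (simp add: field_simps power2_eq_square)
        show ?thesis unfolding v_def w_def u_def by (rule alg) (use s mu kappa_pos in auto)
      qed
      finally show "(g has_real_derivative - pi * f \<xi> * v \<xi>) (at \<xi>)" unfolding g_def[abs_def] .
      show "\<bar>u \<xi> - 1\<bar> \<le> b S N"
        using ud[OF xi] b0 unfolding b_def by linarith
      have 1: "v \<xi> - 1 = (u \<xi> - 1) * (w N * (\<rho> N - (\<xi> / ?mu - m N)\<^sup>2)) + w N * (\<xi> / ?mu * (2 * m N - \<xi> / ?mu)) + (w N * ?R - 1) + w N * (1 / ?k)"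
      proof -
        have alg: "W * (p - (t - q)\<^sup>2) * U + c - 1 = (U - 1) * (W * (p - (t - q)\<^sup>2)) + W * (t * (2 * q - t)) + (W * (p - q\<^sup>2) - 1) + c"
          for W p t q U c :: real by (simp add: algebra_simps power2_eq_square)
        show ?thesis unfolding v_def by (rule alg)
      qed
      have xb: "\<bar>\<xi> / ?mu * (2 * m N - \<xi> / ?mu)\<bar> \<le> S * (1 / ?mu) * 3"
      proof -
        have "\<bar>2 * m N - \<xi> / ?mu\<bar> \<le> 3" using x(1)[OF xi] eta elim(7) by linarith
        from mult_mono[OF x(1)[OF xi] this less_imp_le[OF eta(1)] abs_ge_zero]
        show ?thesis unfolding abs_mult[of "\<xi> / ?mu"] .
      qed
      have 2: "\<bar>(u \<xi> - 1) * (w N * (\<rho> N - (\<xi> / ?mu - m N)\<^sup>2))\<bar> \<le> 2 * (S * (1 / ?mu))\<^sup>2 * (w N * (\<bar>?R\<bar> + 3))"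
      proof -
        have "\<rho> N - (\<xi> / ?mu - m N)\<^sup>2 = ?R + \<xi> / ?mu * (2 * m N - \<xi> / ?mu)"
          by (simp add: algebra_simps power2_eq_square)
        then have "\<bar>\<rho> N - (\<xi> / ?mu - m N)\<^sup>2\<bar> \<le> \<bar>?R\<bar> + 3" using xb eta by linarith
        then have "w N * \<bar>\<rho> N - (\<xi> / ?mu - m N)\<^sup>2\<bar> \<le> w N * (\<bar>?R\<bar> + 3)" using w0 by (intro mult_left_mono)
        moreover have "\<bar>u \<xi> - 1\<bar> \<le> 2 * (S * (1 / ?mu))\<^sup>2" using ud[OF xi] by linarith
        ultimately show ?thesis
          unfolding abs_mult[of "u \<xi> - 1"] abs_mult[of "w N"] abs_of_nonneg[OF w0]
          by (intro mult_mono[OF _ _ b0(1) mult_nonneg_nonneg[OF w0 abs_ge_zero]])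
      qed
      have 3: "\<bar>w N * (\<xi> / ?mu * (2 * m N - \<xi> / ?mu))\<bar> \<le> w N * (S * (1 / ?mu) * 3)"
        unfolding abs_mult[of "w N"] abs_of_nonneg[OF w0] by (rule mult_left_mono[OF xb w0])
      show "\<bar>v \<xi> - 1\<bar> \<le> b S N"
      proof -
        have "w N * (S * (1 / ?mu) * 3) = 3 * w N * (S * (1 / ?mu))"
          "2 * (S * (1 / ?mu))\<^sup>2 * (w N * (\<bar>?R\<bar> + 3)) = 2 * (S * (1 / ?mu))\<^sup>2 * w N * (\<bar>?R\<bar> + 3)"
          by (simp_all only: ac_simps)
        moreover have "\<bar>p + q + t + z\<bar> \<le> \<bar>p\<bar> + \<bar>q\<bar> + \<bar>t\<bar> + \<bar>z\<bar>" for p q t z :: real by linarith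
        ultimately show ?thesis
          using 1 2 3 b0(1) abs_of_nonneg[OF b0(4)] unfolding b_def 1
          by (smt (verit))
      qed
    qed
    interpret R: near_rotation f g u v S "b S N" by (rule nr)
    have F0: "R.F 0 = F0 N" by (simp add: R.F_def F0_def f_def g_def)
    have B: "R.B = F0 N * exp (2 * pi * S)" by (simp add: R.B_def F0)
    have A0: "A N > 0" using mu kappa_pos by (simp add: A_def)
    \<comment> \<open>Each error in \<open>e2\<close> carries the factor \<xi> - \<eta>, which is
      why \<open>wronskian_sin\<close> had to be proved with it; dividing leaves a bound uniform up
      to the diagonal.\<close>
    have off: "\<bar>k N (\<xi> / ?mu) (\<eta> / ?mu) / ?mu - sine_kernel \<xi> \<eta>\<bar> \<le> err S N"
      if xi: "\<xi> \<in> {-S..S}" and et: "\<eta> \<in> {-S..S}" and ne: "\<xi> \<noteq> \<eta>" for \<xi> \<eta>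
    proof -
      define K where "K = k N (\<xi> / ?mu) (\<eta> / ?mu) / ?mu"
      define G where "G = f \<xi> * g \<eta> - g \<xi> * f \<eta>"
      have D: "D N (z / ?mu) = pi * ?mu * g z" for z using mu by (simp add: g_def)
      have "(2 * ?k + 1) * ((\<xi> / ?mu - \<eta> / ?mu) * (?mu * K)) = pi * ?mu * G - ?k * (\<xi> / ?mu - \<eta> / ?mu) * (f \<xi> * f \<eta>)"
      proof -
        have muK: "k N (\<xi> / ?mu) (\<eta> / ?mu) = ?mu * K" using mu by (simp add: K_def)
        have "(2 * ?k + 1) * ((\<xi> / ?mu - \<eta> / ?mu) * k N (\<xi> / ?mu) (\<eta> / ?mu)) =
          \<phi> N (\<xi> / ?mu) * D N (\<eta> / ?mu) - D N (\<xi> / ?mu) * \<phi> N (\<eta> / ?mu) - ?k * (\<xi> / ?mu - \<eta> / ?mu) * (\<phi> N (\<xi> / ?mu) * \<phi> N (\<eta> / ?mu))"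
          using elim(2) x(2)[OF xi] x(2)[OF et] by blast
        moreover have "f \<xi> * (pi * ?mu * g \<eta>) - pi * ?mu * g \<xi> * f \<eta> = pi * ?mu * G"
          unfolding G_def by (simp only: algebra_simps)
        ultimately show ?thesis unfolding muK D f_def[symmetric] by (simp only:)
      qed
      moreover have "(\<xi> / ?mu - \<eta> / ?mu) * (?mu * K) = (\<xi> - \<eta>) * K" using mu by (simp add: field_simps)
      moreover have "?k * (\<xi> / ?mu - \<eta> / ?mu) = ?k * (1 / ?mu) * (\<xi> - \<eta>)"
        by (simp add: diff_divide_distrib right_diff_distrib)
      ultimately have "(2 * ?k + 1) * ((\<xi> - \<eta>) * K) = pi * ?mu * G - ?k * (1 / ?mu) * (\<xi> - \<eta>) * (f \<xi> * f \<eta>)"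
        by (simp only:)
      then have "(\<xi> - \<eta>) * K = (pi * ?mu * G - ?k * (1 / ?mu) * (\<xi> - \<eta>) * (f \<xi> * f \<eta>)) / (2 * ?k + 1)"
        using kappa_pos by (simp add: nonzero_eq_divide_eq mult.commute)
      then have e1: "(\<xi> - \<eta>) * K = A N * G - ?k / (2 * ?k + 1) * (1 / ?mu) * ((\<xi> - \<eta>) * (f \<xi> * f \<eta>))"
        by (simp add: A_def diff_divide_distrib ac_simps)
      have sn: "F0 N * sin (pi * (\<xi> - \<eta>)) = F0 N * pi * ((\<xi> - \<eta>) * sine_kernel \<xi> \<eta>)"
        using sine_kernel_mult[of \<xi> \<eta>] by (metis mult.assoc mult.commute)
      have e2: "(\<xi> - \<eta>) * (K - sine_kernel \<xi> \<eta>) =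
         A N * (G - F0 N * sin (pi * (\<xi> - \<eta>))) + (A N * F0 N * pi - 1) * ((\<xi> - \<eta>) * sine_kernel \<xi> \<eta>)
          - ?k / (2 * ?k + 1) * (1 / ?mu) * ((\<xi> - \<eta>) * (f \<xi> * f \<eta>))"
        unfolding right_diff_distrib[of "\<xi> - \<eta>"] e1 sn by (simp only: algebra_simps)
      have t1: "\<bar>A N * (G - F0 N * sin (pi * (\<xi> - \<eta>)))\<bar> \<le> A N * ((18 * pi * pi * S + 2 * pi) * b S N * (F0 N * exp (2 * pi * S)) * \<bar>\<xi> - \<eta>\<bar>)"
        unfolding abs_mult[of "A N"] abs_of_pos[OF A0]
        using R.wronskian_sin[OF xi et] A0 unfolding G_def F0 B by (intro mult_left_mono) auto
      have t2: "\<bar>(A N * F0 N * pi - 1) * ((\<xi> - \<eta>) * sine_kernel \<xi> \<eta>)\<bar> \<le> \<bar>A N * F0 N * pi - 1\<bar> * (\<bar>\<xi> - \<eta>\<bar> * 1)"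
        unfolding abs_mult[of "A N * F0 N * pi - 1"] abs_mult[of "\<xi> - \<eta>"] by (intro mult_left_mono sine_kernel_le_1) auto
      have t3: "\<bar>?k / (2 * ?k + 1) * (1 / ?mu) * ((\<xi> - \<eta>) * (f \<xi> * f \<eta>))\<bar> \<le> 1 * (1 / ?mu) * (\<bar>\<xi> - \<eta>\<bar> * (F0 N * exp (2 * pi * S)))"
        unfolding abs_mult[of "?k / (2 * ?k + 1) * (1 / ?mu)"] abs_mult[of "?k / (2 * ?k + 1)"] abs_mult[of "\<xi> - \<eta>"]
        using R.prod_le_B(1)[OF xi et] mu kappa_pos unfolding B by (intro mult_mono) auto
      have "\<bar>\<xi> - \<eta>\<bar> * \<bar>K - sine_kernel \<xi> \<eta>\<bar> \<le> \<bar>\<xi> - \<eta>\<bar> * err S N"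
      proof -
        have "\<bar>\<xi> - \<eta>\<bar> * err S N = A N * ((18 * pi * pi * S + 2 * pi) * b S N * (F0 N * exp (2 * pi * S)) * \<bar>\<xi> - \<eta>\<bar>)
           + \<bar>A N * F0 N * pi - 1\<bar> * (\<bar>\<xi> - \<eta>\<bar> * 1) + 1 * (1 / ?mu) * (\<bar>\<xi> - \<eta>\<bar> * (F0 N * exp (2 * pi * S)))"
          unfolding err_def by (simp only: distrib_left mult_1_left mult_1_right ac_simps)
        then show ?thesis unfolding abs_mult[symmetric] e2 using t1 t2 t3 by linarith
      qed
      then show ?thesis using ne unfolding K_def by (simp add: mult_le_cancel_left)
    qed
    show ?case
    proof (intro ballI)
      fix \<xi> \<eta> assume xi: "\<xi> \<in> {-S..S}" and et: "\<eta> \<in> {-S..S}"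
      show "\<bar>k N (\<xi> / ?mu) (\<eta> / ?mu) / ?mu - sine_kernel \<xi> \<eta>\<bar> \<le> err S N"
      proof (cases "\<xi> = \<eta>")
        case False
        then show ?thesis using off xi et by blast
      next
        case True
        \<comment> \<open>On the diagonal no division is possible, but the off-diagonal bound is
          independent of the points and passes to the limit by continuity.\<close>
        have "isCont (\<lambda>x. k N x (\<eta> / ?mu)) (\<eta> / ?mu)" using elim(3) x(2)[OF et] by blast
        then have "isCont (\<lambda>z. k N (z / ?mu) (\<eta> / ?mu)) \<eta>"
          by (intro isCont_o2[where f = "\<lambda>z. z / ?mu" and g = "\<lambda>x. k N x (\<eta> / ?mu)"] continuous_intros) (use mu in auto)
        then have "isCont (\<lambda>z. \<bar>k N (z / ?mu) (\<eta> / ?mu) / ?mu - sine_kernel z \<eta>\<bar>) \<eta>"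
          using mu by (intro continuous_intros isCont_sine_kernel) auto
        then have "((\<lambda>z. \<bar>k N (z / ?mu) (\<eta> / ?mu) / ?mu - sine_kernel z \<eta>\<bar>) \<longlongrightarrow>
            \<bar>k N (\<eta> / ?mu) (\<eta> / ?mu) / ?mu - sine_kernel \<eta> \<eta>\<bar>) (at \<eta> within {-S..S})"
          unfolding isCont_def by (rule tendsto_within_subset) simp
        moreover have "\<forall>\<^sub>F z in at \<eta> within {-S..S}. \<bar>k N (z / ?mu) (\<eta> / ?mu) / ?mu - sine_kernel z \<eta>\<bar> \<le> err S N"
          unfolding eventually_at_filter by (rule always_eventually) (use off et in auto)
        moreover have "at \<eta> within {-S..S} \<noteq> bot"
          using S et by (simp add: at_within_Icc_at trivial_limit_within islimpt_Icc)
        ultimately have "\<bar>k N (\<eta> / ?mu) (\<eta> / ?mu) / ?mu - sine_kernel \<eta> \<eta>\<bar> \<le> err S N"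
          using tendsto_upperbound by blast
        then show ?thesis using True by simp
      qed
    qed
  qed
qed

end

section \<open>Vandermonde determinants and permutation sums\<close>

text \<open>The change from powers to monic polynomials is a triangular matrix with ones on the
  diagonal.\<close>

lemma det_monic_polys:
  fixes P :: "nat \<Rightarrow> real poly" and z :: "nat \<Rightarrow> real"
  assumes P: "\<And>j. j < n \<Longrightarrow> degree (P j) = j" "\<And>j. j < n \<Longrightarrow> coeff (P j) j = 1"
  shows "Determinant.det (mat n n (\<lambda>(i, j). poly (P j) (z i))) = Determinant.det (mat n n (\<lambda>(i, j). z i ^ j))"
proof -
  let ?V = "mat n n (\<lambda>(i, j). z i ^ j)" and ?C = "mat n n (\<lambda>(k, j). coeff (P j) k)"
  have "mat n n (\<lambda>(i, j). poly (P j) (z i)) = ?V * ?C"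
  proof (rule eq_matI)
    fix i j assume ij: "i < dim_row (?V * ?C)" "j < dim_col (?V * ?C)"
    then have "(?V * ?C) $$ (i, j) = (\<Sum>k\<in>{0..<n}. z i ^ k * coeff (P j) k)"
      by (simp add: scalar_prod_def)
    also have "\<dots> = (\<Sum>k\<le>degree (P j). z i ^ k * coeff (P j) k)"
      using ij P(1)[of j] by (intro sum.mono_neutral_right) (auto simp: coeff_eq_0)
    also have "\<dots> = poly (P j) (z i)" by (simp add: poly_altdef mult.commute)
    finally show "mat n n (\<lambda>(i, j). poly (P j) (z i)) $$ (i, j) = (?V * ?C) $$ (i, j)"
      using ij by simp
  qed auto
  moreover have "Determinant.det ?C = 1"
  proof -
    have "Determinant.det ?C = prod_list (diag_mat ?C)"
      by (rule det_upper_triangular[of _ n]) (auto simp: P coeff_eq_0)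
    also have "\<dots> = 1" unfolding prod_list_diag_prod by (rule prod.neutral) (simp add: P)
    finally show ?thesis .
  qed
  ultimately show ?thesis by (simp add: det_mult[of _ n])
qed

text \<open>Newton's basis polynomials vanish at the earlier nodes, so the evaluation matrix is
  triangular.\<close>

lemma det_vandermonde:
  fixes z :: "nat \<Rightarrow> real"
  shows "Determinant.det (mat n n (\<lambda>(i, j). z i ^ j)) = (\<Prod>j<n. \<Prod>i<j. z j - z i)"
proof -
  define P where "P j = (\<Prod>i<j. [:- z i, 1:])" for j
  have P: "degree (P j) = j \<and> coeff (P j) j = 1" for j
  proof (induction j)
    case (Suc j)
    have "P (Suc j) = [:- z j, 1:] * P j" by (simp add: P_def mult.commute)
    moreover have "P j \<noteq> 0" using Suc by auto
    ultimately show ?case using Suc by (simp add: degree_pCons_eq coeff_eq_0 degree_mult_eq del: mult_pCons_left) (simp add: coeff_eq_0)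
  qed (simp add: P_def)
  have "Determinant.det (mat n n (\<lambda>(i, j). z i ^ j)) = Determinant.det (mat n n (\<lambda>(i, j). poly (P j) (z i)))"
    using P by (intro det_monic_polys[symmetric]) auto
  also have "\<dots> = prod_list (diag_mat (mat n n (\<lambda>(i, j). poly (P j) (z i))))"
  proof (rule det_lower_triangular)
    fix i j assume ij: "i < j" "j < n"
    then have "(\<Prod>k<j. z i - z k) = 0" by (intro prod_zero) auto
    then show "mat n n (\<lambda>(i, j). poly (P j) (z i)) $$ (i, j) = 0" using ij by (simp add: P_def poly_prod)
  qed simp
  also have "\<dots> = (\<Prod>j<n. \<Prod>i<j. z j - z i)"
    unfolding prod_list_diag_prod by (auto simp: P_def poly_prod atLeast0LessThan intro!: prod.cong)
  finally show ?thesis .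
qed

text \<open>Reduces the double sum over permutations below to at most two terms for each
  \<open>p\<close>.\<close>

lemma permutes_agree:
  assumes p: "p permutes S" and q: "q permutes S" and S: "\<And>x. x \<in> S \<Longrightarrow> x \<notin> {a, b} \<Longrightarrow> p x = q x"
    and ab: "a \<in> S" "b \<in> S"
  shows "q = p \<or> q = p \<circ> Transposition.transpose a b"
proof -
  have "(inv_into UNIV p \<circ> q) permutes S" using p q by (simp add: permutes_compose permutes_inv)
  moreover have "(inv_into UNIV p \<circ> q) x = x" if "x \<in> S - {a, b}" for x
    using S[of x] that permutes_inverses(2)[OF p, of x] by auto
  ultimately have "(inv_into UNIV p \<circ> q) permutes {a, b}" by (rule permutes_superset)
  then have "inv_into UNIV p \<circ> q = id \<or> inv_into UNIV p \<circ> q = Transposition.transpose a b" by (simp add: permutes_doubleton_iff)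
  moreover have "p \<circ> (inv_into UNIV p \<circ> q) = q" using permutes_inv_o(1)[OF p] by (simp flip: comp_assoc)
  ultimately show ?thesis by (metis comp_id)
qed

lemma of_int_sign_sq: "of_int (sign p * sign p) = (1 :: real)"
  by (simp del: of_int_mult)

lemma sign_sq [simp]: "real_of_int (sign p) * real_of_int (sign p) = 1"
  using of_int_sign_sq[of p] by (simp only: of_int_mult)

interpretation lb: product_sigma_finite "\<lambda>_::nat. lborel :: real measure"
  by standard

section \<open>Moments of counting statistics under a squared determinant\<close>

locale onb =
  fixes n :: nat and \<psi> :: "nat \<Rightarrow> real \<Rightarrow> real"
  assumes psi_int: "\<And>k l. k < n \<Longrightarrow> l < n \<Longrightarrow> integrable lborel (\<lambda>x. \<psi> k x * \<psi> l x)"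
    and psi_orth: "\<And>k l. k < n \<Longrightarrow> l < n \<Longrightarrow> (\<integral>x. \<psi> k x * \<psi> l x \<partial>lborel) = (if k = l then 1 else 0)"
begin

text \<open>A Slater determinant; \<open>Suc\<close> translates between matrix rows, numbered from
  0, and points, numbered from 1.\<close>

definition Dt :: "(nat \<Rightarrow> real) \<Rightarrow> real" where
  "Dt y = Determinant.det (mat n n (\<lambda>(i, j). \<psi> j (y (Suc i))))"

definition G :: "(real \<Rightarrow> real) \<Rightarrow> nat \<Rightarrow> nat \<Rightarrow> real" where
  "G f k l = (\<integral>x. f x * (\<psi> k x * \<psi> l x) \<partial>lborel)"

abbreviation "perms \<equiv> {p. p permutes {0..<n}}"

lemma Dt_sq: "(Dt y)\<^sup>2 = (\<Sum>p\<in>perms. \<Sum>q\<in>perms. of_int (sign p * sign q) * (\<Prod>j\<in>{1..n}. \<psi> (p (j - 1)) (y j) * \<psi> (q (j - 1)) (y j)))"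
proof -
  have D: "Dt y = (\<Sum>p\<in>perms. of_int (sign p) * (\<Prod>j\<in>{1..n}. \<psi> (p (j - 1)) (y j)))"
  proof -
    have "Dt y = (\<Sum>p\<in>perms. of_int (sign p) * (\<Prod>i = 0..<n. mat n n (\<lambda>(i, j). \<psi> j (y (Suc i))) $$ (i, p i)))"
      unfolding Dt_def by (rule det_def') simp
    also have "\<dots> = (\<Sum>p\<in>perms. of_int (sign p) * (\<Prod>i = 0..<n. \<psi> (p i) (y (Suc i))))"
      by (intro sum.cong prod.cong arg_cong2[where f = "(*)"] refl) (auto dest: permutes_in_image)
    moreover have "(\<Prod>i = 0..<n. \<psi> (p i) (y (Suc i))) = (\<Prod>j\<in>{1..n}. \<psi> (p (j - 1)) (y j))" for p
      by (rule prod.reindex_bij_witness[of _ "\<lambda>j. j - 1" Suc]) auto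
    ultimately show ?thesis by (simp only:)
  qed
  show ?thesis unfolding D power2_eq_square sum_product
    by (intro sum.cong refl) (simp add: prod.distrib)
qed

text \<open>\<open>A\<close> holds row numbers, hence the shift \<open>j - 1\<close>. The form as a
  product over all coordinates keeps the integrals factorised.\<close>

definition mask :: "(real \<Rightarrow> real) \<Rightarrow> nat set \<Rightarrow> (nat \<Rightarrow> real) \<Rightarrow> real" where
  "mask f A y = (\<Prod>j\<in>{1..n}. if j - 1 \<in> A then f (y j) else 1)"

context
  fixes f :: "real \<Rightarrow> real"
  assumes f_meas: "f \<in> borel_measurable borel" and f_bound: "\<And>x. \<bar>f x\<bar> \<le> 1"
begin

lemma f_int: "k < n \<Longrightarrow> l < n \<Longrightarrow> integrable lborel (\<lambda>x. f x * (\<psi> k x * \<psi> l x))"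
  by (rule Bochner_Integration.integrable_bound[OF psi_int[of k l]])
     (use f_meas f_bound borel_measurable_integrable[OF psi_int] in \<open>auto simp: abs_mult mult_left_le_one_le intro!: AE_I2\<close>)

text \<open>Every term of the expanded square factorises over the coordinates. A coordinate outside
  \<open>A\<close> contributes an orthonormality integral, which forces \<open>p\<close> and
  \<open>q\<close> to agree there.\<close>

lemma mask_integral:
  assumes "A \<subseteq> {0..<n}"
  shows "integrable (Pi\<^sub>M {1..n} (\<lambda>_. lborel)) (\<lambda>y. mask f A y * (Dt y)\<^sup>2)"
    and "(\<integral>y. mask f A y * (Dt y)\<^sup>2 \<partial>Pi\<^sub>M {1..n} (\<lambda>_. lborel)) =
      (\<Sum>p\<in>perms. \<Sum>q\<in>perms. of_int (sign p * sign q) *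
         (if \<forall>i\<in>{0..<n} - A. p i = q i then \<Prod>i\<in>A. G f (p i) (q i) else 0))"
proof -
  let ?M = "Pi\<^sub>M {1..n} (\<lambda>_. lborel :: real measure)"
  let ?h = "\<lambda>p q j x. (if j - 1 \<in> A then f x else 1) * (\<psi> (p (j - 1)) x * \<psi> (q (j - 1)) x)"
  have eq: "mask f A y * (Dt y)\<^sup>2 = (\<Sum>p\<in>perms. \<Sum>q\<in>perms. of_int (sign p * sign q) * (\<Prod>j\<in>{1..n}. ?h p q j (y j)))" for y
    unfolding Dt_sq mask_def sum_distrib_left by (intro sum.cong refl) (simp add: prod.distrib)
  have lt: "p (j - 1) < n" if "p \<in> perms" "j \<in> {1..n}" for p j
  proof -
    have "j - 1 \<in> {0..<n}" using that by auto
    then show ?thesis using that permutes_in_image[of p "{0..<n}" "j - 1"] by auto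
  qed
  have hi: "integrable lborel (?h p q j)" if "p \<in> perms" "q \<in> perms" "j \<in> {1..n}" for p q j
  proof -
    have "p (j - 1) < n" "q (j - 1) < n" using lt that by blast+
    then show ?thesis using f_int psi_int by (cases "j - 1 \<in> A") simp_all
  qed
  have pi: "integrable ?M (\<lambda>y. \<Prod>j\<in>{1..n}. ?h p q j (y j))" if "p \<in> perms" "q \<in> perms" for p q
    using hi that by (intro lb.product_integrable_prod) auto
  show "integrable ?M (\<lambda>y. mask f A y * (Dt y)\<^sup>2)"
    unfolding eq by (intro Bochner_Integration.integrable_sum integrable_mult_right) (use pi in auto)
  have "(\<integral>y. mask f A y * (Dt y)\<^sup>2 \<partial>?M) =
      (\<Sum>p\<in>perms. \<Sum>q\<in>perms. of_int (sign p * sign q) * (\<integral>y. (\<Prod>j\<in>{1..n}. ?h p q j (y j)) \<partial>?M))"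
    unfolding eq using pi by (subst Bochner_Integration.integral_sum) (auto intro!: Bochner_Integration.integrable_sum sum.cong integrable_mult_right simp: Bochner_Integration.integral_sum)
  also have "\<dots> = (\<Sum>p\<in>perms. \<Sum>q\<in>perms. of_int (sign p * sign q) *
         (if \<forall>i\<in>{0..<n} - A. p i = q i then \<Prod>i\<in>A. G f (p i) (q i) else 0))"
  proof (intro sum.cong refl arg_cong2[where f = "(*)"])
    fix p q assume pq: "p \<in> perms" "q \<in> perms"
    have "(\<integral>y. (\<Prod>j\<in>{1..n}. ?h p q j (y j)) \<partial>?M) = (\<Prod>j\<in>{1..n}. \<integral>x. ?h p q j x \<partial>lborel)"
      using hi pq by (intro lb.product_integral_prod) auto
    also have "\<dots> = (\<Prod>i\<in>{0..<n}. \<integral>x. ?h p q (Suc i) x \<partial>lborel)"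
      by (rule prod.reindex_bij_witness[of _ Suc "\<lambda>j. j - 1"]) auto
    also have "\<dots> = (\<Prod>i\<in>{0..<n}. if i \<in> A then G f (p i) (q i) else if p i = q i then 1 else 0)"
    proof (intro prod.cong refl)
      fix i assume i: "i \<in> {0..<n}"
      then have "p i < n" "q i < n" using pq permutes_in_image[of p "{0..<n}" i] permutes_in_image[of q "{0..<n}" i] by auto
      then show "(\<integral>x. ?h p q (Suc i) x \<partial>lborel) = (if i \<in> A then G f (p i) (q i) else if p i = q i then 1 else 0)"
        by (auto simp: G_def psi_orth)
    qed
    also have "\<dots> = (\<Prod>i\<in>A. G f (p i) (q i)) * (\<Prod>i\<in>{0..<n} - A. if p i = q i then 1 else 0)"
    proof -
      have "(\<Prod>i\<in>{0..<n}. if i \<in> A then G f (p i) (q i) else if p i = q i then 1 else 0) =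
         (\<Prod>i\<in>{0..<n} - A. if i \<in> A then G f (p i) (q i) else if p i = q i then 1 else 0) *
         (\<Prod>i\<in>A. if i \<in> A then G f (p i) (q i) else if p i = q i then 1 else 0)"
        by (rule prod.subset_diff[OF assms]) simp
      then show ?thesis by (simp add: mult.commute)
    qed
    also have "\<dots> = (if \<forall>i\<in>{0..<n} - A. p i = q i then \<Prod>i\<in>A. G f (p i) (q i) else 0)"
      by (auto simp: prod_zero)
    finally show "(\<integral>y. (\<Prod>j\<in>{1..n}. ?h p q j (y j)) \<partial>?M) = (if \<forall>i\<in>{0..<n} - A. p i = q i then \<Prod>i\<in>A. G f (p i) (q i) else 0)" .
  qed
  finally show "(\<integral>y. mask f A y * (Dt y)\<^sup>2 \<partial>?M) = (\<Sum>p\<in>perms. \<Sum>q\<in>perms. of_int (sign p * sign q) *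
         (if \<forall>i\<in>{0..<n} - A. p i = q i then \<Prod>i\<in>A. G f (p i) (q i) else 0))" .
qed

lemma finite_perms: "finite perms" by (rule finite_permutations) simp

lemma G_sym: "G f k l = G f l k"
  by (simp add: G_def mult.commute)

lemma mask_integral_single:
  assumes "A \<subseteq> {a}" "a < n"
  shows "(\<integral>y. mask f A y * (Dt y)\<^sup>2 \<partial>Pi\<^sub>M {1..n} (\<lambda>_. lborel)) = (\<Sum>p\<in>perms. \<Prod>i\<in>A. G f (p i) (p i))"
proof -
  have A: "A \<subseteq> {0..<n}" using assms by auto
  have "(\<Sum>q\<in>perms. of_int (sign p * sign q) * (if \<forall>i\<in>{0..<n} - A. p i = q i then \<Prod>i\<in>A. G f (p i) (q i) else 0))
     = (\<Prod>i\<in>A. G f (p i) (p i))" if p: "p \<in> perms" for p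
  proof -
    have "q = p" if q: "q \<in> perms" and *: "\<forall>i\<in>{0..<n} - A. p i = q i" for q
    proof -
      have "q = p \<or> q = p \<circ> Transposition.transpose a a"
        by (rule permutes_agree[where S = "{0..<n}"]) (use p q * assms in auto)
      then show ?thesis by simp
    qed
    then have "(\<Sum>q\<in>perms. of_int (sign p * sign q) * (if \<forall>i\<in>{0..<n} - A. p i = q i then \<Prod>i\<in>A. G f (p i) (q i) else 0))
      = (\<Sum>q\<in>perms. if q = p then of_int (sign p * sign p) * (\<Prod>i\<in>A. G f (p i) (p i)) else 0)"
      by (intro sum.cong refl) auto
    then show ?thesis using p finite_perms by (simp add: sum.delta of_int_sign_sq del: of_int_mult)
  qed
  then show ?thesis unfolding mask_integral(2)[OF A] by (intro sum.cong refl) auto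
qed

text \<open>For each \<open>p\<close> the survivors are \<open>p\<close> itself and \<open>p\<close>
  composed with the transposition, which enters with the opposite sign: the 2 by 2 determinant of
  the two-point correlation.\<close>

lemma mask_integral_pair:
  assumes ab: "a < n" "b < n" "a \<noteq> b"
  shows "(\<integral>y. mask f {a, b} y * (Dt y)\<^sup>2 \<partial>Pi\<^sub>M {1..n} (\<lambda>_. lborel)) =
     (\<Sum>p\<in>perms. G f (p a) (p a) * G f (p b) (p b) - (G f (p a) (p b))\<^sup>2)"
proof -
  have A: "{a, b} \<subseteq> {0..<n}" using assms by auto
  have "(\<Sum>q\<in>perms. of_int (sign p * sign q) * (if \<forall>i\<in>{0..<n} - {a, b}. p i = q i then \<Prod>i\<in>{a, b}. G f (p i) (q i) else 0))
     = G f (p a) (p a) * G f (p b) (p b) - (G f (p a) (p b))\<^sup>2" if p: "p \<in> perms" for p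
  proof -
    let ?r = "p \<circ> Transposition.transpose a b"
    have pp: "p permutes {0..<n}" using p by simp
    have r: "?r \<in> perms" using p ab by (auto intro!: permutes_compose permutes_swap_id)
    have "inj p" using pp by (rule permutes_inj)
    then have ne: "p a \<noteq> p b" using ab by (auto dest: injD)
    have rp: "?r \<noteq> p"
    proof
      assume "?r = p"
      then have "?r a = p a" by simp
      then show False using ne by simp
    qed
    have "permutation p" "permutation (Transposition.transpose a b)"
      using pp by (auto intro: permutes_imp_permutation permutation_swap_id)
    then have "sign ?r = - sign p" using ab by (simp add: sign_compose sign_swap_id)
    then have sr: "of_int (sign p * sign ?r) = (-1 :: real)" using of_int_sign_sq[of p] by simp
    have "q \<in> {p, ?r}" if q: "q \<in> perms" and *: "\<forall>i\<in>{0..<n} - {a, b}. p i = q i" for q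
    proof -
      have "q = p \<or> q = p \<circ> Transposition.transpose a b"
        by (rule permutes_agree[where S = "{0..<n}"]) (use p q * ab in auto)
      then show ?thesis by simp
    qed
    then have "(\<Sum>q\<in>perms. of_int (sign p * sign q) * (if \<forall>i\<in>{0..<n} - {a, b}. p i = q i then \<Prod>i\<in>{a, b}. G f (p i) (q i) else 0))
      = (\<Sum>q\<in>{p, ?r}. of_int (sign p * sign q) * (if \<forall>i\<in>{0..<n} - {a, b}. p i = q i then \<Prod>i\<in>{a, b}. G f (p i) (q i) else 0))"
      using p r finite_perms by (intro sum.mono_neutral_right) auto
    also have "\<dots> = of_int (sign p * sign p) * (\<Prod>i\<in>{a, b}. G f (p i) (p i)) + of_int (sign p * sign ?r) * (\<Prod>i\<in>{a, b}. G f (p i) (?r i))"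
      using rp by (simp add: Transposition.transpose_def)
    also have "\<dots> = G f (p a) (p a) * G f (p b) (p b) - (G f (p a) (p b))\<^sup>2"
      unfolding of_int_sign_sq sr using ab G_sym[of "p b" "p a"] by (simp add: power2_eq_square)
    finally show ?thesis .
  qed
  then show ?thesis unfolding mask_integral(2)[OF A] by (intro sum.cong refl) auto
qed

lemma sum_perm: "p \<in> perms \<Longrightarrow> (\<Sum>i<n. g (p i)) = (\<Sum>k<n. g k)" for g :: "nat \<Rightarrow> real"
  using sum.permute[of p "{0..<n}" g] by (simp add: atLeast0LessThan o_def)

lemma Dt_norm: "(\<integral>y. (Dt y)\<^sup>2 \<partial>Pi\<^sub>M {1..n} (\<lambda>_. lborel)) = real (fact n)"
proof -
  have "(\<integral>y. mask f {} y * (Dt y)\<^sup>2 \<partial>Pi\<^sub>M {1..n} (\<lambda>_. lborel)) = (\<Sum>p\<in>perms. \<Prod>i\<in>{}. G f (p i) (p i))" (is "?l = ?r")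
  proof -
    have e: "{} \<subseteq> {0..<n}" by simp
    have "(\<Sum>q\<in>perms. of_int (sign p * sign q) * (if \<forall>i\<in>{0..<n} - {}. p i = q i then \<Prod>i\<in>{}. G f (p i) (q i) else 0)) = (1 :: real)"
      if p: "p \<in> perms" for p
    proof -
      have "q = p" if q: "q \<in> perms" and *: "\<forall>i\<in>{0..<n} - {}. p i = q i" for q
      proof
        fix i show "q i = p i" using p q * by (cases "i < n") (auto simp: permutes_def)
      qed
      then have "(\<Sum>q\<in>perms. of_int (sign p * sign q) * (if \<forall>i\<in>{0..<n} - {}. p i = q i then \<Prod>i\<in>{}. G f (p i) (q i) else 0))
        = (\<Sum>q\<in>perms. if q = p then of_int (sign p * sign p) else (0 :: real))"
        by (intro sum.cong refl) auto
      then show ?thesis using p finite_perms by (simp add: sum.delta of_int_sign_sq del: of_int_mult)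
    qed
    then show ?thesis unfolding mask_integral(2)[OF e] by (intro sum.cong refl) auto
  qed
  then show ?thesis by (simp add: mask_def card_permutations)
qed

lemma sum_f_integral:
  shows "integrable (Pi\<^sub>M {1..n} (\<lambda>_. lborel)) (\<lambda>y. (\<Sum>j\<in>{1..n}. f (y j)) * (Dt y)\<^sup>2)"
    and "(\<integral>y. (\<Sum>j\<in>{1..n}. f (y j)) * (Dt y)\<^sup>2 \<partial>Pi\<^sub>M {1..n} (\<lambda>_. lborel)) = fact n * (\<Sum>k<n. G f k k)"
proof -
  let ?M = "Pi\<^sub>M {1..n} (\<lambda>_. lborel :: real measure)"
  have m: "mask f {a} y = f (y (Suc a))" if "a < n" for a y
  proof -
    have "mask f {a} y = (\<Prod>j\<in>{1..n}. if j = Suc a then f (y (Suc a)) else 1)"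
      unfolding mask_def by (intro prod.cong refl) auto
    then show ?thesis using that by simp
  qed
  have s: "(\<Sum>j\<in>{1..n}. f (y j)) = (\<Sum>a<n. mask f {a} y)" for y
  proof -
    have "(\<Sum>j\<in>{1..n}. f (y j)) = (\<Sum>a<n. f (y (Suc a)))"
      by (rule sum.reindex_bij_witness[of _ Suc "\<lambda>j. j - 1"]) auto
    then show ?thesis by (simp add: m)
  qed
  have i: "integrable ?M (\<lambda>y. mask f {a} y * (Dt y)\<^sup>2)" if "a < n" for a
    using that by (intro mask_integral) auto
  show "integrable ?M (\<lambda>y. (\<Sum>j\<in>{1..n}. f (y j)) * (Dt y)\<^sup>2)"
    unfolding s sum_distrib_right using i by (intro Bochner_Integration.integrable_sum) auto
  have "(\<integral>y. (\<Sum>j\<in>{1..n}. f (y j)) * (Dt y)\<^sup>2 \<partial>?M) = (\<Sum>a<n. \<integral>y. mask f {a} y * (Dt y)\<^sup>2 \<partial>?M)"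
    unfolding s sum_distrib_right using i by (intro Bochner_Integration.integral_sum) auto
  also have "\<dots> = (\<Sum>a<n. \<Sum>p\<in>perms. G f (p a) (p a))"
    by (intro sum.cong refl) (subst mask_integral_single, auto)
  also have "\<dots> = (\<Sum>p\<in>perms. \<Sum>k<n. G f k k)"
    by (subst sum.swap) (intro sum.cong refl sum_perm[of _ "\<lambda>k. G f k k"], auto)
  also have "\<dots> = fact n * (\<Sum>k<n. G f k k)" by (simp add: card_permutations)
  finally show "(\<integral>y. (\<Sum>j\<in>{1..n}. f (y j)) * (Dt y)\<^sup>2 \<partial>?M) = fact n * (\<Sum>k<n. G f k k)" .
qed

lemma sum_f_sq_integral:
  assumes idem: "\<And>x. f x * f x = f x"
  shows "integrable (Pi\<^sub>M {1..n} (\<lambda>_. lborel)) (\<lambda>y. (\<Sum>j\<in>{1..n}. f (y j))\<^sup>2 * (Dt y)\<^sup>2)"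
    and "(\<integral>y. (\<Sum>j\<in>{1..n}. f (y j))\<^sup>2 * (Dt y)\<^sup>2 \<partial>Pi\<^sub>M {1..n} (\<lambda>_. lborel)) =
      fact n * ((\<Sum>k<n. G f k k) + (\<Sum>k<n. G f k k)\<^sup>2 - (\<Sum>k<n. \<Sum>l<n. (G f k l)\<^sup>2))"
proof -
  let ?M = "Pi\<^sub>M {1..n} (\<lambda>_. lborel :: real measure)"
  have m: "mask f {a, b} y = f (y (Suc a)) * f (y (Suc b))" if ab: "a < n" "b < n" for a b y
  proof (cases "a = b")
    case True
    have "mask f {a} y = (\<Prod>j\<in>{1..n}. if j = Suc a then f (y (Suc a)) else 1)"
      unfolding mask_def by (intro prod.cong refl) auto
    then show ?thesis using ab True idem by simp
  next
    case False
    have "mask f {a, b} y = (\<Prod>j\<in>{1..n}. (if j = Suc a then f (y (Suc a)) else 1) * (if j = Suc b then f (y (Suc b)) else 1))"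
      unfolding mask_def using False by (intro prod.cong refl) auto
    then show ?thesis using ab by (simp add: prod.distrib)
  qed
  have s: "(\<Sum>j\<in>{1..n}. f (y j))\<^sup>2 = (\<Sum>a<n. \<Sum>b<n. mask f {a, b} y)" for y
  proof -
    have "(\<Sum>j\<in>{1..n}. f (y j)) = (\<Sum>a<n. f (y (Suc a)))"
      by (rule sum.reindex_bij_witness[of _ Suc "\<lambda>j. j - 1"]) auto
    then show ?thesis by (simp add: m power2_eq_square sum_product)
  qed
  have i: "integrable ?M (\<lambda>y. mask f {a, b} y * (Dt y)\<^sup>2)" if "a < n" "b < n" for a b
    using that by (intro mask_integral) auto
  show "integrable ?M (\<lambda>y. (\<Sum>j\<in>{1..n}. f (y j))\<^sup>2 * (Dt y)\<^sup>2)"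
    unfolding s sum_distrib_right using i by (intro Bochner_Integration.integrable_sum) auto
  let ?g = "\<lambda>k l. G f k k * G f l l - (G f k l)\<^sup>2"
  have "(\<integral>y. (\<Sum>j\<in>{1..n}. f (y j))\<^sup>2 * (Dt y)\<^sup>2 \<partial>?M) = (\<Sum>a<n. \<Sum>b<n. \<integral>y. mask f {a, b} y * (Dt y)\<^sup>2 \<partial>?M)"
    unfolding s sum_distrib_right using i
    by (subst Bochner_Integration.integral_sum) (auto intro!: Bochner_Integration.integrable_sum sum.cong Bochner_Integration.integral_sum)
  \<comment> \<open>On the diagonal \<open>?g\<close> is zero, so the pair term may be summed over
    all a and b; the diagonal itself contributes a first moment because \<open>f\<close> is
    idempotent.\<close>
  also have "\<dots> = (\<Sum>a<n. \<Sum>b<n. (if a = b then \<Sum>p\<in>perms. G f (p a) (p a) else 0) + (\<Sum>p\<in>perms. ?g (p a) (p b)))"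
  proof (intro sum.cong refl)
    fix a b assume "a \<in> {..<n}" "b \<in> {..<n}"
    then show "(\<integral>y. mask f {a, b} y * (Dt y)\<^sup>2 \<partial>?M) = (if a = b then \<Sum>p\<in>perms. G f (p a) (p a) else 0) + (\<Sum>p\<in>perms. ?g (p a) (p b))"
      using mask_integral_single[of "{a}" a] mask_integral_pair[of a b] by (cases "a = b") (auto simp: power2_eq_square)
  qed
  also have "\<dots> = (\<Sum>a<n. \<Sum>p\<in>perms. G f (p a) (p a)) + (\<Sum>a<n. \<Sum>b<n. \<Sum>p\<in>perms. ?g (p a) (p b))"
    by (simp add: sum.distrib)
  also have "(\<Sum>a<n. \<Sum>p\<in>perms. G f (p a) (p a)) = (\<Sum>p\<in>perms. \<Sum>k<n. G f k k)"
    by (subst sum.swap) (intro sum.cong refl sum_perm[of _ "\<lambda>k. G f k k"], auto)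
  also have "(\<Sum>a<n. \<Sum>b<n. \<Sum>p\<in>perms. ?g (p a) (p b)) = (\<Sum>p\<in>perms. \<Sum>k<n. \<Sum>l<n. ?g k l)"
  proof -
    have "(\<Sum>a<n. \<Sum>b<n. \<Sum>p\<in>perms. ?g (p a) (p b)) = (\<Sum>a<n. \<Sum>p\<in>perms. \<Sum>b<n. ?g (p a) (p b))"
      by (intro sum.cong refl sum.swap)
    also have "\<dots> = (\<Sum>p\<in>perms. \<Sum>a<n. \<Sum>b<n. ?g (p a) (p b))" by (rule sum.swap)
    also have "\<dots> = (\<Sum>p\<in>perms. \<Sum>a<n. \<Sum>l<n. ?g (p a) l)"
      by (intro sum.cong refl sum_perm) auto
    also have "\<dots> = (\<Sum>p\<in>perms. \<Sum>k<n. \<Sum>l<n. ?g k l)"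
      by (intro sum.cong refl sum_perm[of _ "\<lambda>k. \<Sum>l<n. ?g k l"]) auto
    finally show ?thesis .
  qed
  finally show "(\<integral>y. (\<Sum>j\<in>{1..n}. f (y j))\<^sup>2 * (Dt y)\<^sup>2 \<partial>?M) =
      fact n * ((\<Sum>k<n. G f k k) + (\<Sum>k<n. G f k k)\<^sup>2 - (\<Sum>k<n. \<Sum>l<n. (G f k l)\<^sup>2))"
    by (simp add: card_permutations sum_subtractf power2_eq_square sum_product algebra_simps)
qed

end
end

section \<open>From the ordered chamber to the full space\<close>

lemma distr_PiM_permute:
  assumes I: "finite I" and p: "p permutes I"
  shows "distr (Pi\<^sub>M I (\<lambda>_::nat. lborel :: real measure)) (Pi\<^sub>M I (\<lambda>_. lborel)) (\<lambda>y. \<lambda>j\<in>I. y (p j)) = Pi\<^sub>M I (\<lambda>_. lborel)"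
    (is "distr ?M ?M ?T = ?M")
proof (rule lb.PiM_eqI[OF I])
  have pin: "p j \<in> I" if "j \<in> I" for j using permutes_in_image[OF p] that by blast
  have T: "?T \<in> ?M \<rightarrow>\<^sub>M ?M"
    by (intro measurable_restrict measurable_component_singleton pin)
  fix A :: "nat \<Rightarrow> real set" assume A: "\<And>i. i \<in> I \<Longrightarrow> A i \<in> sets lborel"
  let ?q = "inv_into UNIV p"
  have q: "?q permutes I" by (rule permutes_inv[OF p])
  have qin: "?q j \<in> I" if "j \<in> I" for j using permutes_in_image[OF q] that by blast
  have vim: "?T -` Pi\<^sub>E I A \<inter> space ?M = (\<Pi>\<^sub>E j\<in>I. A (?q j))"
  proof (rule Set.set_eqI)
    fix y
    have "(\<forall>j\<in>I. y (p j) \<in> A j) \<longleftrightarrow> (\<forall>j\<in>I. y j \<in> A (?q j))"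
    proof safe
      fix j assume a: "\<forall>j\<in>I. y (p j) \<in> A j" and j: "j \<in> I"
      then show "y j \<in> A (?q j)" using bspec[OF a qin[OF j]] permutes_inverses(1)[OF p, of j] by simp
    next
      fix j assume a: "\<forall>j\<in>I. y j \<in> A (?q j)" and j: "j \<in> I"
      then show "y (p j) \<in> A j" using bspec[OF a pin[OF j]] permutes_inverses(2)[OF p, of j] by simp
    qed
    then show "y \<in> ?T -` Pi\<^sub>E I A \<inter> space ?M \<longleftrightarrow> y \<in> (\<Pi>\<^sub>E j\<in>I. A (?q j))"
      by (auto simp: space_PiM PiE_iff)
  qed
  have "emeasure (distr ?M ?M ?T) (Pi\<^sub>E I A) = emeasure ?M (\<Pi>\<^sub>E j\<in>I. A (?q j))"
    using T A I by (subst emeasure_distr) (auto simp: vim intro!: sets_PiM_I_finite)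
  also have "\<dots> = (\<Prod>j\<in>I. emeasure lborel (A (?q j)))"
    using A qin I by (subst lb.emeasure_PiM) auto
  also have "\<dots> = (\<Prod>j\<in>I. emeasure lborel (A j))"
    using prod.permute[OF q, of "\<lambda>j. emeasure lborel (A j)"] by (simp add: o_def)
  finally show "emeasure (distr ?M ?M ?T) (Pi\<^sub>E I A) = (\<Prod>j\<in>I. emeasure lborel (A j))" .
qed simp

text \<open>Stated as a cardinality because it is applied to a sum of chamber indicators over all
  permutations.\<close>

lemma sorting_permutation:
  fixes y :: "nat \<Rightarrow> real"
  assumes y: "inj_on y {1..n}"
  shows "card {p. p permutes {1..n} \<and> strict_mono_on {1..n} (\<lambda>j. y (p j))} = 1"
proof -
  let ?I = "{1..n}"
  define xs where "xs = sorted_list_of_set (y ` ?I)"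
  have xs: "sorted_wrt (<) xs" "set xs = y ` ?I" "length xs = n" "distinct xs"
    unfolding xs_def using y by (auto simp: card_image)
  define p0 where "p0 j = (if j \<in> ?I then inv_into ?I y (xs ! (j - 1)) else j)" for j
  have in_im: "xs ! (j - 1) \<in> y ` ?I" if "j \<in> ?I" for j
    using xs(2,3) that nth_mem[of "j - 1" xs] by auto
  have yp0: "y (p0 j) = xs ! (j - 1)" "p0 j \<in> ?I" if "j \<in> ?I" for j
    using f_inv_into_f[OF in_im[OF that]] inv_into_into[OF in_im[OF that]] that by (simp_all add: p0_def)
  have lt: "xs ! (i - 1) < xs ! (j - 1)" if "i \<in> ?I" "j \<in> ?I" "i < j" for i j
    using sorted_wrt_nth_less[OF xs(1), of "i - 1" "j - 1"] that xs(3) by auto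
  have sm0: "strict_mono_on ?I (\<lambda>j. y (p0 j))"
    using yp0(1) lt by (auto simp: strict_mono_on_def)
  have "inj_on p0 ?I"
  proof (rule inj_onI)
    fix i j assume ij: "i \<in> ?I" "j \<in> ?I" "p0 i = p0 j"
    then have "xs ! (i - 1) = xs ! (j - 1)" using yp0(1) by metis
    then have "i - 1 = j - 1" using ij xs(3,4) by (subst (asm) nth_eq_iff_index_eq) auto
    then show "i = j" using ij by auto
  qed
  then have "bij_betw p0 ?I ?I"
    using yp0(2) endo_inj_surj[of ?I p0] by (auto simp: bij_betw_def image_subset_iff)
  then have p0: "p0 permutes ?I" by (rule bij_imp_permutes) (auto simp: p0_def)
  have "p = p0" if p: "p permutes ?I" and sm: "strict_mono_on ?I (\<lambda>j. y (p j))" for p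
  proof
    fix j
    let ?ys = "map (\<lambda>j. y (p j)) [1..<Suc n]"
    have "sorted_wrt (<) ?ys"
      using sm by (auto simp: sorted_wrt_iff_nth_less strict_mono_on_def simp del: upt_Suc)
    moreover have "set ?ys = y ` ?I"
      using permutes_image[OF p] by (simp only: set_map set_upt image_image[symmetric, of y p] atLeastLessThanSuc_atLeastAtMost)
    ultimately have "?ys = xs"
      using xs by (intro strict_sorted_equal) auto
    have "y (p j) = y (p0 j)" if "j \<in> ?I"
    proof -
      have "?ys ! (j - 1) = y (p j)" using that by (subst nth_map_upt) auto
      then show ?thesis using \<open>?ys = xs\<close> yp0(1)[OF that] by simp
    qed
    then show "p j = p0 j"
    proof (cases "j \<in> ?I")
      case True
      then have "p j \<in> ?I" "p0 j \<in> ?I" by (simp_all only: permutes_in_image[OF p] permutes_in_image[OF p0])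
      then show ?thesis using inj_onD[OF y \<open>j \<in> ?I \<Longrightarrow> y (p j) = y (p0 j)\<close>[OF True]] by blast
    next
      case False
      then show ?thesis using permutes_not_in[OF p] permutes_not_in[OF p0] by metis
    qed
  qed
  then have "{p. p permutes ?I \<and> strict_mono_on ?I (\<lambda>j. y (p j))} = {p0}" using p0 sm0 by blast
  then show ?thesis by simp
qed

text \<open>The n! images of the ordered chamber cover every point with distinct coordinates exactly
  once. Points with ties carry \<open>H = 0\<close>, so the decomposition holds pointwise and no
  null sets have to be discussed.\<close>

lemma integral_symmetric:
  fixes H :: "(nat \<Rightarrow> real) \<Rightarrow> real" and n :: nat
  defines "M \<equiv> Pi\<^sub>M {1..n} (\<lambda>_::nat. lborel :: real measure)"
  assumes H: "integrable M H"
    and sym: "\<And>p y. p permutes {1..n} \<Longrightarrow> H (\<lambda>j\<in>{1..n}. y (p j)) = H y"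
    and inj: "\<And>y. H y \<noteq> 0 \<Longrightarrow> inj_on y {1..n}"
  shows "fact n * (\<integral>y. indicator {y. strict_mono_on {1..n} y} y * H y \<partial>M) = (\<integral>y. H y \<partial>M)"
proof -
  let ?I = "{1..n}"
  let ?T = "\<lambda>p y. \<lambda>j\<in>?I. y (p j)"
  let ?S = "indicator {y. strict_mono_on ?I y} :: (nat \<Rightarrow> real) \<Rightarrow> real"
  have S_meas: "?S \<in> borel_measurable M"
  proof -
    have "{y \<in> space M. strict_mono_on ?I y} = {y \<in> space M. \<forall>i\<in>?I. \<forall>j\<in>?I. i < j \<longrightarrow> y i < y j}"
      by (auto simp: strict_mono_on_def)
    also have "\<dots> \<in> sets M" unfolding M_def by measurable
    finally have "{y. strict_mono_on ?I y} \<inter> space M \<in> sets M" by (simp add: Int_def conj_commute)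
    then show ?thesis by (simp add: borel_measurable_indicator_iff)
  qed
  have HS: "integrable M (\<lambda>y. ?S y * H y)"
  proof (rule Bochner_Integration.integrable_bound[OF H])
    show "(\<lambda>y. ?S y * H y) \<in> borel_measurable M"
      by (intro borel_measurable_times S_meas borel_measurable_integrable[OF H])
    show "AE y in M. norm (?S y * H y) \<le> norm (H y)"
      by (intro AE_I2) (simp add: indicator_def)
  qed
  have T: "?T p \<in> M \<rightarrow>\<^sub>M M" "distr M M (?T p) = M" if "p permutes ?I" for p
  proof -
    show "?T p \<in> M \<rightarrow>\<^sub>M M" unfolding M_def
      using permutes_in_image[OF that] by (intro measurable_restrict measurable_component_singleton) auto
    show "distr M M (?T p) = M" unfolding M_def by (rule distr_PiM_permute[OF _ that]) simp
  qed
  have smT: "?S (?T p y) = indicator {p. strict_mono_on ?I (\<lambda>j. y (p j))} p" for p y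
    by (auto simp: indicator_def strict_mono_on_def)
  have fin: "finite {p. p permutes ?I}" by (rule finite_permutations) simp
  have one: "(\<Sum>p | p permutes ?I. ?S (?T p y)) * H y = H y" for y
  proof (cases "H y = 0")
    case False
    have "(\<Sum>p | p permutes ?I. ?S (?T p y)) = real (card {p. p permutes ?I \<and> strict_mono_on ?I (\<lambda>j. y (p j))})"
      unfolding smT using fin by (simp add: indicator_def sum.If_cases Int_def conj_commute)
    then show ?thesis using sorting_permutation[OF inj[OF False]] by simp
  qed simp
  have intp: "integrable M (\<lambda>y. ?S (?T p y) * H (?T p y))" "(\<integral>y. ?S (?T p y) * H (?T p y) \<partial>M) = (\<integral>y. ?S y * H y \<partial>M)"
    if p: "p permutes ?I" for p
  proof -
    have "integrable (distr M M (?T p)) (\<lambda>y. ?S y * H y)" unfolding T(2)[OF p] by (rule HS)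
    then show "integrable M (\<lambda>y. ?S (?T p y) * H (?T p y))" by (rule integrable_distr[OF T(1)[OF p]])
    have "(\<integral>y. ?S y * H y \<partial>distr M M (?T p)) = (\<integral>y. ?S (?T p y) * H (?T p y) \<partial>M)"
      using HS by (intro integral_distr T(1)[OF p]) auto
    then show "(\<integral>y. ?S (?T p y) * H (?T p y) \<partial>M) = (\<integral>y. ?S y * H y \<partial>M)" unfolding T(2)[OF p] by simp
  qed
  have "(\<integral>y. H y \<partial>M) = (\<integral>y. (\<Sum>p | p permutes ?I. ?S (?T p y) * H (?T p y)) \<partial>M)"
  proof (rule Bochner_Integration.integral_cong[OF refl])
    fix y
    have "(\<Sum>p | p permutes ?I. ?S (?T p y) * H (?T p y)) = (\<Sum>p | p permutes ?I. ?S (?T p y)) * H y"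
      unfolding sum_distrib_right by (intro sum.cong refl arg_cong2[where f = "(*)"] sym) auto
    then show "H y = (\<Sum>p | p permutes ?I. ?S (?T p y) * H (?T p y))" unfolding one ..
  qed
  also have "\<dots> = (\<Sum>p | p permutes ?I. \<integral>y. ?S (?T p y) * H (?T p y) \<partial>M)"
    using intp(1) by (intro Bochner_Integration.integral_sum) auto
  also have "\<dots> = (\<Sum>p | p permutes ?I. \<integral>y. ?S y * H y \<partial>M)"
    using intp(2) by (intro sum.cong) auto
  also have "\<dots> = fact n * (\<integral>y. ?S y * H y \<partial>M)" by (simp add: card_permutations)
  finally show ?thesis by simp
qed

context onb
begin

lemma Dt_permute:
  assumes p: "p permutes {1..n}"
  shows "(Dt (\<lambda>j\<in>{1..n}. y (p j)))\<^sup>2 = (Dt y)\<^sup>2"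
proof -
  \<comment> \<open>The permutation \<open>p\<close> of point numbers, transported to row
    numbers.\<close>
  define q where "q i = (if i < n then p (Suc i) - 1 else i)" for i
  have pin: "p (Suc i) \<in> {1..n}" if "i < n" for i
    using permutes_in_image[OF p, of "Suc i"] that by auto
  have Sq: "Suc (q i) = p (Suc i)" if "i < n" for i using pin[OF that] that by (simp add: q_def)
  have "inj_on q {0..<n}"
  proof (rule inj_onI)
    fix i j assume "i \<in> {0..<n}" "j \<in> {0..<n}" "q i = q j"
    then have "p (Suc i) = p (Suc j)" using Sq[of i] Sq[of j] by simp
    then show "i = j" using permutes_inj[OF p] by (auto dest: injD)
  qed
  moreover have "q ` {0..<n} \<subseteq> {0..<n}" using pin by (fastforce simp: q_def)
  ultimately have "bij_betw q {0..<n} {0..<n}"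
    using endo_inj_surj[of "{0..<n}" q] by (simp add: bij_betw_def)
  then have q: "q permutes {0..<n}" by (rule bij_imp_permutes) (auto simp: q_def)
  let ?A = "mat n n (\<lambda>(i, j). \<psi> j (y (Suc i)))"
  have "Dt (\<lambda>j\<in>{1..n}. y (p j)) = Determinant.det (mat n n (\<lambda>(i, j). ?A $$ (q i, j)))"
    unfolding Dt_def
    by (rule arg_cong[where f = Determinant.det], rule eq_matI)
       (use permutes_in_image[OF q] Sq in auto)
  also have "\<dots> = of_int (sign q) * Determinant.det ?A"
    by (rule det_permute_rows[OF _ q]) simp
  finally have "Dt (\<lambda>j\<in>{1..n}. y (p j)) = of_int (sign q) * Dt y" by (simp add: Dt_def)
  then show ?thesis by (simp add: power_mult_distrib power2_eq_square[of "real_of_int (sign q)"] del: of_int_mult)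
qed

lemma Dt_inj:
  assumes "Dt y \<noteq> 0" shows "inj_on y {1..n}"
proof (rule inj_onI, rule ccontr)
  fix i j assume ij: "i \<in> {1..n}" "j \<in> {1..n}" "y i = y j" "i \<noteq> j"
  have "Dt y = 0" unfolding Dt_def
    by (rule det_identical_rows[of _ n "i - 1" "j - 1"]) (use ij in \<open>auto simp: row_def\<close>)
  then show False using assms by simp
qed

lemma chamber_integral:
  assumes g: "integrable (Pi\<^sub>M {1..n} (\<lambda>_. lborel)) (\<lambda>y. g y * (Dt y)\<^sup>2)"
    and sym: "\<And>p y. p permutes {1..n} \<Longrightarrow> g (\<lambda>j\<in>{1..n}. y (p j)) = g y"
  shows "fact n * (\<integral>y. indicator {y. strict_mono_on {1..n} y} y * (g y * (Dt y)\<^sup>2) \<partial>Pi\<^sub>M {1..n} (\<lambda>_. lborel))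
     = (\<integral>y. g y * (Dt y)\<^sup>2 \<partial>Pi\<^sub>M {1..n} (\<lambda>_. lborel))"
proof (rule integral_symmetric[OF g])
  show "g (\<lambda>j\<in>{1..n}. y (p j)) * (Dt (\<lambda>j\<in>{1..n}. y (p j)))\<^sup>2 = g y * (Dt y)\<^sup>2" if "p permutes {1..n}" for p y
    unfolding sym[OF that] Dt_permute[OF that] ..
  show "inj_on y {1..n}" if "g y * (Dt y)\<^sup>2 \<noteq> 0" for y
    using that by (intro Dt_inj) auto
qed

text \<open>The factor \<open>C\<close> disappears because both sides are probability densities.\<close>

lemma ensemble_variance:
  fixes M :: "'a measure" and Y :: "nat \<Rightarrow> 'a \<Rightarrow> real"
  assumes M: "prob_space M" and C: "C > 0"
    and dist: "distributed M (Pi\<^sub>M {1..n} (\<lambda>_. lborel)) (\<lambda>\<omega>. \<lambda>j\<in>{1..n}. Y j \<omega>)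
       (\<lambda>y. ennreal (C * (indicator {y. strict_mono_on {1..n} y} y * (Dt y)\<^sup>2)))"
    and I: "I \<in> sets borel"
  shows "prob_space.variance M (\<lambda>\<omega>. real (card {j\<in>{1..n}. Y j \<omega> \<in> I}))
    = (\<Sum>k<n. G (indicator I) k k) - (\<Sum>k<n. \<Sum>l<n. (G (indicator I) k l)\<^sup>2)"
proof -
  interpret prob_space M by fact
  let ?f = "indicator I :: real \<Rightarrow> real"
  let ?P = "Pi\<^sub>M {1..n} (\<lambda>_. lborel :: real measure)"
  let ?S = "indicator {y. strict_mono_on {1..n} y} :: (nat \<Rightarrow> real) \<Rightarrow> real"
  let ?X = "\<lambda>\<omega>. \<lambda>j\<in>{1..n}. Y j \<omega>"
  have f: "?f \<in> borel_measurable borel" "\<And>x. \<bar>?f x\<bar> \<le> 1" "\<And>x. ?f x * ?f x = ?f x"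
    using I by (auto simp: indicator_def)
  have Dt0: "(\<integral>y. (Dt y)\<^sup>2 \<partial>?P) = fact n" using Dt_norm[OF f(1,2)] by simp
  have iDt: "integrable ?P (\<lambda>y. 1 * (Dt y)\<^sup>2)"
    using mask_integral(1)[OF f(1,2), of "{}"] by (simp add: mask_def)
  \<comment> \<open>For symmetric \<open>g\<close> the chamber may be traded for the full space at
    the price of n!.\<close>
  have E: "fact n * expectation (\<lambda>\<omega>. g (?X \<omega>)) = C * (\<integral>y. g y * (Dt y)\<^sup>2 \<partial>?P)"
    if g: "g \<in> borel_measurable ?P" "integrable ?P (\<lambda>y. g y * (Dt y)\<^sup>2)"
      "\<And>p y. p permutes {1..n} \<Longrightarrow> g (\<lambda>j\<in>{1..n}. y (p j)) = g y" for g
  proof -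
    have "expectation (\<lambda>\<omega>. g (?X \<omega>)) = (\<integral>y. C * (?S y * (Dt y)\<^sup>2) * g y \<partial>?P)"
      by (rule distributed_integral[OF dist g(1), symmetric]) (use C in simp)
    also have "\<dots> = C * (\<integral>y. ?S y * (g y * (Dt y)\<^sup>2) \<partial>?P)"
      by (simp add: mult.assoc mult.commute mult.left_commute)
    finally show ?thesis using chamber_integral[OF g(2,3)] by (simp add: mult.left_commute)
  qed
  have "fact n * expectation (\<lambda>\<omega>. 1) = C * fact n"
    using E[of "\<lambda>_. 1"] iDt Dt0 by simp
  then have C1: "C = 1" by (simp add: prob_space)
  let ?s = "\<lambda>y. \<Sum>j\<in>{1..n}. ?f (y j)"
  have s_meas: "?s \<in> borel_measurable ?P" using I by measurable
  have s_sym: "?s (\<lambda>j\<in>{1..n}. y (p j)) = ?s y" if "p permutes {1..n}" for p and y :: "nat \<Rightarrow> real"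
    using sum.permute[OF that, of "\<lambda>j. ?f (y j)"] by (simp add: o_def)
  have E1: "expectation (\<lambda>\<omega>. ?s (?X \<omega>)) = (\<Sum>k<n. G ?f k k)"
    using E[OF s_meas sum_f_integral(1)[OF f(1,2)] s_sym] sum_f_integral(2)[OF f(1,2)] C1 by simp
  have E2: "expectation (\<lambda>\<omega>. (?s (?X \<omega>))\<^sup>2) = (\<Sum>k<n. G ?f k k) + (\<Sum>k<n. G ?f k k)\<^sup>2 - (\<Sum>k<n. \<Sum>l<n. (G ?f k l)\<^sup>2)"
    using E[of "\<lambda>y. (?s y)\<^sup>2", OF _ sum_f_sq_integral(1)[OF f]] s_meas s_sym sum_f_sq_integral(2)[OF f] C1 by simp
  have X_meas: "?X \<in> M \<rightarrow>\<^sub>M ?P" using dist by (rule distributed_measurable)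
  have sX_meas: "(\<lambda>\<omega>. ?s (?X \<omega>)) \<in> borel_measurable M" using measurable_compose[OF X_meas s_meas] .
  have s_bound: "\<bar>?s y\<bar> \<le> real n" for y
  proof -
    have "\<bar>?s y\<bar> \<le> (\<Sum>j\<in>{1..n}. \<bar>?f (y j)\<bar>)" by (rule sum_abs)
    also have "\<dots> \<le> (\<Sum>j\<in>{1..n}. 1)" by (intro sum_mono f(2))
    finally show ?thesis by simp
  qed
  have i1: "integrable M (\<lambda>\<omega>. ?s (?X \<omega>))"
    by (rule integrable_const_bound[of _ "real n"]) (use sX_meas s_bound in auto)
  have i2: "integrable M (\<lambda>\<omega>. (?s (?X \<omega>))\<^sup>2)"
  proof (rule integrable_const_bound[of _ "(real n)\<^sup>2"])
    show "AE \<omega> in M. norm ((?s (?X \<omega>))\<^sup>2) \<le> (real n)\<^sup>2"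
    proof (intro AE_I2)
      fix \<omega>
      have "\<bar>?s (?X \<omega>)\<bar>\<^sup>2 \<le> (real n)\<^sup>2" by (intro power_mono s_bound) simp
      then show "norm ((?s (?X \<omega>))\<^sup>2) \<le> (real n)\<^sup>2" by (simp only: real_norm_def power2_abs abs_power2)
    qed
  qed (use sX_meas in measurable)
  have card: "real (card {j\<in>{1..n}. Y j \<omega> \<in> I}) = ?s (?X \<omega>)" for \<omega>
    by (simp add: indicator_def sum.If_cases Int_def)
  show ?thesis using variance_eq[OF i1 i2] unfolding card E1 E2 by linarith
qed

end

section \<open>The Jacobi ensemble\<close>

lemma det_scale:
  fixes r c :: "nat \<Rightarrow> real"
  shows "Determinant.det (mat n n (\<lambda>(i, j). r i * c j * A i j)) = (\<Prod>i<n. r i) * (\<Prod>j<n. c j) * Determinant.det (mat n n (\<lambda>(i, j). A i j))"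
proof -
  have "(\<Prod>i = 0..<n. mat n n (\<lambda>(i, j). r i * c j * A i j) $$ (i, p i))
     = (\<Prod>i<n. r i) * (\<Prod>j<n. c j) * (\<Prod>i = 0..<n. mat n n (\<lambda>(i, j). A i j) $$ (i, p i))"
    if p: "p permutes {0..<n}" for p
  proof -
    have pi: "p i < n" if "i < n" for i using permutes_in_image[OF p, of i] that by auto
    have "(\<Prod>i = 0..<n. mat n n (\<lambda>(i, j). r i * c j * A i j) $$ (i, p i)) = (\<Prod>i = 0..<n. r i * c (p i) * A i (p i))"
      by (intro prod.cong refl) (simp add: pi)
    also have "\<dots> = (\<Prod>i = 0..<n. r i) * (\<Prod>i = 0..<n. c (p i)) * (\<Prod>i = 0..<n. A i (p i))"
      by (simp add: prod.distrib)
    also have "(\<Prod>i = 0..<n. c (p i)) = (\<Prod>i = 0..<n. c i)"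
      using prod.permute[OF p, of c] by (simp add: o_def)
    also have "(\<Prod>i = 0..<n. A i (p i)) = (\<Prod>i = 0..<n. mat n n (\<lambda>(i, j). A i j) $$ (i, p i))"
      by (intro prod.cong refl) (simp add: pi)
    finally show ?thesis by (simp add: atLeast0LessThan)
  qed
  then show ?thesis
    by (simp add: det_def'[of _ n] sum_distrib_left mult.left_commute)
qed

context jacobi
begin

lemma phi_mult: "x \<in> {-1..1} \<Longrightarrow> phi k x * phi l x = poly (opoly k * opoly l) x * poly W x / (sqrt (hnorm k) * sqrt (hnorm l))"
  using W_nonneg[of x] by (simp add: phi_def real_sqrt_divide)

lemma continuous_phi: "continuous_on A (phi k)"
  unfolding phi_def by (intro continuous_intros) (use hnorm_pos[of k] in auto)

lemma continuous_dphi: "continuous_on A (dphi k)"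
  unfolding dphi_def by (intro continuous_intros) (use hnorm_pos[of k] in auto)

lemma phi_orthonormal: "integral {-1..1} (\<lambda>x. phi k x * phi l x) = (if k = l then 1 else 0)"
proof -
  have "integral {-1..1} (\<lambda>x. phi k x * phi l x) = integral {-1..1} (\<lambda>x. poly (opoly k * opoly l) x * poly W x / (sqrt (hnorm k) * sqrt (hnorm l)))"
    by (rule integral_cong) (rule phi_mult)
  also have "\<dots> = ip (opoly k * opoly l) / (sqrt (hnorm k) * sqrt (hnorm l))"
    unfolding ip_def by (simp only: divide_inverse integral_mult_left)
  finally show ?thesis
    using opoly_orthogonal'[of k l] hnorm_pos[of k] by (auto simp: hnorm_def[symmetric])
qed

text \<open>Positive exponents are what make the weight, and with it \<open>phi\<close> and
  \<open>dphi\<close>, vanish at both endpoints.\<close>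

lemma oscillator_phi:
  assumes n: "n \<ge> 1" and ab: "\<alpha> \<ge> 1" "\<beta> \<ge> 1"
  shows "oscillator (phi n) (dphi n) (\<kappa> n) (center n) (radius2 n)"
proof
  show "\<kappa> n > 0" using n by (simp add: \<kappa>_def add_pos_nonneg)
  fix x :: real assume x: "x \<in> {-1<..<1}"
  have "poly (Dpoly n) x = (1 - x\<^sup>2) * poly (pderiv (opoly n)) x + poly \<theta> x * poly (opoly n) x"
    by (simp add: Dpoly_def power2_eq_square algebra_simps)
  with DERIV_weight[OF x, of n "opoly n"]
  show "(phi n has_real_derivative dphi n x / (1 - x\<^sup>2)) (at x)"
    unfolding phi_def[abs_def] dphi_def by (simp only:)
  have "sqrt (poly W x / hnorm n) * ((1 - x\<^sup>2) * poly (pderiv (Dpoly n)) x + poly \<theta> x * poly (Dpoly n) x) / (1 - x\<^sup>2)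
     = - ((\<kappa> n)\<^sup>2 * (radius2 n - (x - center n)\<^sup>2) + \<kappa> n * (1 - x\<^sup>2)) * phi n x / (1 - x\<^sup>2)"
    unfolding Dpoly_ode[OF n] phi_def by (simp only: ac_simps)
  with DERIV_weight[OF x, of n "Dpoly n"]
  show "(dphi n has_real_derivative - ((\<kappa> n)\<^sup>2 * (radius2 n - (x - center n)\<^sup>2) + \<kappa> n * (1 - x\<^sup>2)) * phi n x / (1 - x\<^sup>2)) (at x)"
    unfolding dphi_def[abs_def] by (simp only:)
next
  have W: "poly W 1 = 0" "poly W (-1) = 0" using ab by (simp_all add: poly_W)
  show "phi n (-1) = 0" "phi n 1 = 0" "dphi n (-1) = 0" "dphi n 1 = 0"
    by (simp_all add: phi_def dphi_def W)
  show "integral {-1..1} (\<lambda>x. (phi n x)\<^sup>2) = 1"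
    using phi_orthonormal[of n n] by (simp add: power2_eq_square)
qed (rule continuous_phi continuous_dphi)+

definition kern :: "nat \<Rightarrow> real \<Rightarrow> real \<Rightarrow> real" where
  "kern n x y = (\<Sum>k<n. phi k x * phi k y)"

text \<open>Multiplication of \<open>cd_kernel_Dpoly\<close> by the two half weights. No derivative
  of the weight appears, since \<open>Dpoly\<close> already contains the \<open>\<theta>\<close>
  term.\<close>

lemma kern_eq:
  assumes n: "n \<ge> 1"
  shows "(2 * \<kappa> n + 1) * ((x - y) * kern n x y) = phi n x * dphi n y - dphi n x * phi n y - \<kappa> n * (x - y) * (phi n x * phi n y)"
proof -
  have h: "hnorm k > 0" for k by (rule hnorm_pos)
  let ?w = "sqrt (poly W x) * sqrt (poly W y)"
  have k: "kern n x y = ?w * cd_kernel n x y"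
    unfolding kern_def cd_kernel_def sum_distrib_left
  proof (intro sum.cong refl)
    fix k
    have "sqrt (hnorm k) * sqrt (hnorm k) = hnorm k" using h[of k] by simp
    then show "phi k x * phi k y = ?w * (poly (opoly k) x * poly (opoly k) y / hnorm k)"
      by (simp add: phi_def real_sqrt_divide)
  qed
  have s: "sqrt (hnorm n) * sqrt (hnorm n) = hnorm n" using h[of n] by simp
  have pq: "sqrt (poly W x / hnorm n) * p * (sqrt (poly W y / hnorm n) * q) = ?w / hnorm n * (p * q)" for p q
    using s by (simp add: real_sqrt_divide)
  have "(2 * \<kappa> n + 1) * ((x - y) * kern n x y) = ?w / hnorm n * ((2 * \<kappa> n + 1) * hnorm n * ((x - y) * cd_kernel n x y))"
    using h[of n] unfolding k by simp
  also have "\<dots> = phi n x * dphi n y - dphi n x * phi n y - \<kappa> n * (x - y) * (phi n x * phi n y)"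
    unfolding cd_kernel_Dpoly[OF n] phi_def dphi_def pq by (simp only: right_diff_distrib ac_simps)
  finally show ?thesis .
qed

lemma continuous_kern: "continuous_on A (\<lambda>x. kern n x y)" "continuous_on A (\<lambda>x. kern n x x)"
  unfolding kern_def by (intro continuous_intros continuous_phi)+

text \<open>The cutoff is essential: outside the interval the polynomial weight continues with
  nonzero values, while the ensemble integrates over the whole line.\<close>

definition psi :: "nat \<Rightarrow> real \<Rightarrow> real" where
  "psi k x = indicator {-1..1} x * phi k x"

lemma integrable_phi2:
  "set_integrable lborel {a..b} (\<lambda>x. phi k x * phi l x)"
  by (intro borel_integrable_atLeastAtMost' continuous_intros continuous_phi)

lemma set_integral_phi2:
  "(\<integral>x. indicator {a..b} x * (phi k x * phi l x) \<partial>lborel) = integral {a..b} (\<lambda>x. phi k x * phi l x)"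
  using set_borel_integral_eq_integral(2)[OF integrable_phi2] by (simp add: set_lebesgue_integral_def)

lemma onb_psi: "onb n psi"
proof
  have eq: "psi k x * psi l x = indicator {-1..1} x * (phi k x * phi l x)" for k l x
    by (simp add: psi_def indicator_def)
  show "integrable lborel (\<lambda>x. psi k x * psi l x)" for k l
    unfolding eq using integrable_phi2[of "-1" 1 k l] by (simp add: set_integrable_def)
  show "(\<integral>x. psi k x * psi l x \<partial>lborel) = (if k = l then 1 else 0)" for k l
    unfolding eq set_integral_phi2 by (rule phi_orthonormal)
qed

lemma G_psi:
  assumes "c < 1"
  shows "onb.G psi (indicator {-c..c}) k l = integral {-c..c} (\<lambda>x. phi k x * phi l x)"
proof -
  have "indicator {-c..c} x * (psi k x * psi l x) = indicator {-c..c} x * (phi k x * phi l x)" for x :: real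
    using assms by (auto simp: psi_def indicator_def)
  then show ?thesis unfolding onb.G_def[OF onb_psi] by (simp only: set_integral_phi2)
qed

text \<open>Trace of the Gram matrix and trace of its square, rewritten through the kernel; all sums
  are finite, so only linearity of the integral is involved.\<close>

lemma sum_G_psi:
  assumes "c < 1"
  shows "(\<Sum>k<n. onb.G psi (indicator {-c..c}) k k) = integral {-c..c} (\<lambda>x. kern n x x)"
    and "(\<Sum>k<n. \<Sum>l<n. (onb.G psi (indicator {-c..c}) k l)\<^sup>2) = integral {-c..c} (\<lambda>x. integral {-c..c} (\<lambda>y. (kern n x y)\<^sup>2))"
proof -
  let ?I = "{-c..c}"
  have i: "(\<lambda>x. phi k x * phi l x) integrable_on ?I" for k l
    by (intro integrable_continuous_real continuous_intros continuous_phi)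
  show "(\<Sum>k<n. onb.G psi (indicator ?I) k k) = integral ?I (\<lambda>x. kern n x x)"
    unfolding G_psi[OF assms] kern_def by (rule integral_sum[symmetric]) (use i in auto)
  have sq: "(kern n x y)\<^sup>2 = (\<Sum>k<n. \<Sum>l<n. (phi k x * phi l x) * (phi k y * phi l y))" for x y
    unfolding kern_def power2_eq_square sum_product by (intro sum.cong refl) (simp only: ac_simps)
  have 1: "integral ?I (\<lambda>y. (kern n x y)\<^sup>2) = (\<Sum>k<n. \<Sum>l<n. (phi k x * phi l x) * integral ?I (\<lambda>y. phi k y * phi l y))" for x
  proof -
    have "((\<lambda>y. \<Sum>k<n. \<Sum>l<n. (phi k x * phi l x) * (phi k y * phi l y)) has_integral
       (\<Sum>k<n. \<Sum>l<n. (phi k x * phi l x) * integral ?I (\<lambda>y. phi k y * phi l y))) ?I"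
      by (intro has_integral_sum has_integral_mult_right integrable_integral i) auto
    then show ?thesis unfolding sq by (rule integral_unique)
  qed
  have "((\<lambda>x. \<Sum>k<n. \<Sum>l<n. (phi k x * phi l x) * integral ?I (\<lambda>y. phi k y * phi l y)) has_integral
     (\<Sum>k<n. \<Sum>l<n. integral ?I (\<lambda>x. phi k x * phi l x) * integral ?I (\<lambda>y. phi k y * phi l y))) ?I"
    by (intro has_integral_sum has_integral_mult_left integrable_integral i) auto
  then show "(\<Sum>k<n. \<Sum>l<n. (onb.G psi (indicator ?I) k l)\<^sup>2) = integral ?I (\<lambda>x. integral ?I (\<lambda>y. (kern n x y)\<^sup>2))"
    unfolding 1 G_psi[OF assms] unfolding power2_eq_square by (rule integral_unique[symmetric])
qed

text \<open>Half weights are pulled out of the rows and norms out of the columns; what is left is a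
  determinant of monic polynomials, hence a Vandermonde determinant. The cutoff of
  \<open>psi\<close> is closed while the chamber is open, and positive exponents reconcile the two,
  the weight being 0 at the endpoints.\<close>

lemma Dt_psi:
  assumes ab: "\<alpha> \<ge> 1" "\<beta> \<ge> 1"
  shows "(onb.Dt n psi y)\<^sup>2 = indicator {y. \<forall>j\<in>{1..n}. -1 < y j \<and> y j < 1} y *
     (\<Prod>j\<in>{1..n}. \<Prod>i\<in>{1..<j}. (y j - y i)\<^sup>2) * (\<Prod>j\<in>{1..n}. (1 + y j) ^ \<alpha> * (1 - y j) ^ \<beta>) / (\<Prod>k<n. hnorm k)"
proof -
  let ?z = "\<lambda>i. y (Suc i)"
  define r where "r t = indicator {-1..1} t * sqrt (poly W t)" for t :: real
  have psi: "psi j t = r t * (1 / sqrt (hnorm j)) * poly (opoly j) t" for j t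
    by (simp add: psi_def phi_def r_def real_sqrt_divide)
  have "onb.Dt n psi y = (\<Prod>i<n. r (?z i)) * (\<Prod>j<n. 1 / sqrt (hnorm j)) * Determinant.det (mat n n (\<lambda>(i, j). poly (opoly j) (?z i)))"
    unfolding onb.Dt_def[OF onb_psi] psi by (rule det_scale)
  also have "Determinant.det (mat n n (\<lambda>(i, j). poly (opoly j) (?z i))) = (\<Prod>j<n. \<Prod>i<j. ?z j - ?z i)"
    by (subst det_monic_polys) (simp_all add: det_vandermonde)
  finally have D: "(onb.Dt n psi y)\<^sup>2 = (\<Prod>i<n. (r (?z i))\<^sup>2) * (\<Prod>j<n. (1 / sqrt (hnorm j))\<^sup>2) * (\<Prod>j<n. \<Prod>i<j. (?z j - ?z i)\<^sup>2)"
    by (simp only: power_mult_distrib prod_power_distrib)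
  have h: "(\<Prod>j<n. (1 / sqrt (hnorm j))\<^sup>2) = 1 / (\<Prod>k<n. hnorm k)"
  proof -
    have "(1 / sqrt (hnorm j))\<^sup>2 = 1 / hnorm j" for j using hnorm_pos[of j] by (simp add: power_divide)
    then show ?thesis by (simp add: prod_dividef)
  qed
  have v: "(\<Prod>j<n. \<Prod>i<j. (?z j - ?z i)\<^sup>2) = (\<Prod>j\<in>{1..n}. \<Prod>i\<in>{1..<j}. (y j - y i)\<^sup>2)"
  proof -
    have "(\<Prod>j<n. \<Prod>i<j. (?z j - ?z i)\<^sup>2) = (\<Prod>j<n. \<Prod>i\<in>{1..<Suc j}. (y (Suc j) - y i)\<^sup>2)"
      by (intro prod.cong refl prod.reindex_bij_witness[of _ "\<lambda>i. i - 1" Suc]) auto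
    also have "\<dots> = (\<Prod>j\<in>{1..n}. \<Prod>i\<in>{1..<j}. (y j - y i)\<^sup>2)"
      by (rule prod.reindex_bij_witness[of _ "\<lambda>i. i - 1" Suc]) auto
    finally show ?thesis .
  qed
  have rr: "(r t)\<^sup>2 = indicator {-1<..<1} t * ((1 + t) ^ \<alpha> * (1 - t) ^ \<beta>)" for t
  proof -
    consider "t \<in> {-1<..<1}" | "t = 1" | "t = -1" | "t \<notin> {-1..1}" by fastforce
    then show ?thesis
      by cases (use W_nonneg[of t] ab in \<open>auto simp: r_def poly_W indicator_def\<close>)
  qed
  have "(\<Prod>i<n. (r (?z i))\<^sup>2) = (\<Prod>j\<in>{1..n}. (r (y j))\<^sup>2)"
    by (rule prod.reindex_bij_witness[of _ "\<lambda>i. i - 1" Suc]) auto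
  also have "\<dots> = (\<Prod>j\<in>{1..n}. indicator {-1<..<1} (y j)) * (\<Prod>j\<in>{1..n}. (1 + y j) ^ \<alpha> * (1 - y j) ^ \<beta>)"
    unfolding rr by (rule prod.distrib)
  also have "(\<Prod>j\<in>{1..n}. indicator {-1<..<1} (y j) :: real) = indicator {y. \<forall>j\<in>{1..n}. -1 < y j \<and> y j < 1} y"
    by (auto simp: indicator_def prod_zero)
  finally show ?thesis unfolding D h v by (simp add: ac_simps)
qed

end

lemma bus_variance_kernel:
  assumes bus: "bus_arrival_times M N n x Y"
    and nx: "n \<ge> 1" "x - 1 \<ge> 1" "N - x - (n - 1) \<ge> 1" and l: "l < 2"
  shows "bus_number_variance M n Y l =
    integral {- l / 2..l / 2} (\<lambda>t. jacobi.kern (x - 1) (N - x - (n - 1)) n t t)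
    - integral {- l / 2..l / 2} (\<lambda>t. integral {- l / 2..l / 2} (\<lambda>u. (jacobi.kern (x - 1) (N - x - (n - 1)) n t u)\<^sup>2))"
proof -
  define \<alpha> where "\<alpha> = x - 1"
  define \<beta> where "\<beta> = N - x - (n - 1)"
  interpret J: jacobi \<alpha> \<beta> .
  interpret O: onb n J.psi by (rule J.onb_psi)
  obtain c where ps: "prob_space M" and c: "c > 0"
    and dist: "distributed M (Pi\<^sub>M {1..n} (\<lambda>_. lborel)) (\<lambda>\<omega>. \<lambda>j\<in>{1..n}. Y j \<omega>) (\<lambda>y. ennreal (c * bus_weight N n x y))"
    using bus unfolding bus_arrival_times_def by blast
  define h where "h = (\<Prod>k<n. J.hnorm k)"
  have h: "h > 0" unfolding h_def by (intro prod_pos) (simp add: J.hnorm_pos)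
  \<comment> \<open>\<open>h\<close> merges with the unknown normalising constant, which
    \<open>ensemble_variance\<close> eliminates.\<close>
  have w: "bus_weight N n x y = h * (indicator {y. strict_mono_on {1..n} y} y * (O.Dt y)\<^sup>2)" for y
  proof -
    have ind: "indicator (ordered_chamber n) y = (indicator {y. strict_mono_on {1..n} y} y * indicator {y. \<forall>j\<in>{1..n}. -1 < y j \<and> y j < 1} y :: real)"
      by (auto simp: ordered_chamber_def indicator_def)
    show ?thesis
      unfolding bus_weight_def ind \<alpha>_def[symmetric] \<beta>_def[symmetric] J.Dt_psi[OF nx(2,3)[folded \<alpha>_def \<beta>_def]]
      using h by (simp add: h_def[symmetric])
  qed
  have "distributed M (Pi\<^sub>M {1..n} (\<lambda>_. lborel)) (\<lambda>\<omega>. \<lambda>j\<in>{1..n}. Y j \<omega>)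
      (\<lambda>y. ennreal (c * h * (indicator {y. strict_mono_on {1..n} y} y * (O.Dt y)\<^sup>2)))"
    using dist unfolding w by (simp only: mult.assoc)
  from O.ensemble_variance[OF ps _ this, of "{- l / 2..l / 2}"]
  have "bus_number_variance M n Y l = (\<Sum>k<n. O.G (indicator {- (l / 2)..l / 2}) k k) - (\<Sum>k<n. \<Sum>i<n. (O.G (indicator {- (l / 2)..l / 2}) k i)\<^sup>2)"
    using c h unfolding bus_number_variance_def by simp
  also have "\<dots> = integral {- (l / 2)..l / 2} (\<lambda>t. J.kern n t t) - integral {- (l / 2)..l / 2} (\<lambda>t. integral {- (l / 2)..l / 2} (\<lambda>u. (J.kern n t u)\<^sup>2))"
    using l by (simp only: J.sum_G_psi)
  finally show ?thesis unfolding \<alpha>_def \<beta>_def by simp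
qed

section \<open>Number variance of the sine process\<close>

lemma nn_integral_Icc:
  fixes f :: "real \<Rightarrow> real"
  assumes f: "continuous_on {a..b} f" and nn: "\<And>x. x \<in> {a..b} \<Longrightarrow> f x \<ge> 0"
  shows "(\<integral>\<^sup>+x. ennreal (f x) * indicator {a..b} x \<partial>lborel) = ennreal (integral {a..b} f)"
proof -
  have i: "set_integrable lborel {a..b} f" by (rule borel_integrable_atLeastAtMost'[OF f])
  have "(\<integral>\<^sup>+x. ennreal (f x) * indicator {a..b} x \<partial>lborel) = (\<integral>\<^sup>+x. ennreal (indicator {a..b} x *\<^sub>R f x) \<partial>lborel)"
    by (intro nn_integral_cong) (auto simp: indicator_def)
  also have "\<dots> = ennreal (\<integral>x. indicator {a..b} x *\<^sub>R f x \<partial>lborel)"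
    using i nn by (intro nn_integral_eq_integral) (auto simp: set_integrable_def indicator_def)
  also have "(\<integral>x. indicator {a..b} x *\<^sub>R f x \<partial>lborel) = integral {a..b} f"
    using set_borel_integral_eq_integral(2)[OF i] by (simp add: set_lebesgue_integral_def)
  finally show ?thesis .
qed

lemma continuous_on_sine_kernel:
  assumes "continuous_on A f" "continuous_on A g"
  shows "continuous_on A (\<lambda>x. sine_kernel (f x) (g x))"
  unfolding sine_kernel_sinc by (intro continuous_on_sinc continuous_intros assms)

lemma sine_kernel_commute: "sine_kernel x y = sine_kernel y x"
proof -
  have "pi * (x - y) = - (pi * (y - x))" by (simp add: algebra_simps)
  then show ?thesis unfolding sine_kernel_sinc by (simp only: sinc_neg)
qed

lemma sine_kernel_refl: "sine_kernel x x = 1"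
  by (simp add: sine_kernel_def)

lemma sine_kernel_shift: "sine_kernel (x + c) (y + c) = sine_kernel x y"
  by (simp add: sine_kernel_sinc)

lemma continuous_integral_sine_kernel:
  "continuous_on A (\<lambda>x. integral {a..b} (\<lambda>y. (sine_kernel x y)\<^sup>2))"
proof -
  have "continuous_on (A \<times> cbox a b) (\<lambda>(x, y). (sine_kernel x y)\<^sup>2)"
    by (auto simp: case_prod_beta intro!: continuous_intros continuous_on_sine_kernel)
  from integral_continuous_on_param[OF this] show ?thesis by simp
qed

lemma double_integral_sine_kernel_shift:
  "integral {a + c..b + c} (\<lambda>x. integral {a + c..b + c} (\<lambda>y. (sine_kernel x y)\<^sup>2))
     = integral {a..b} (\<lambda>x. integral {a..b} (\<lambda>y. (sine_kernel x y)\<^sup>2))"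
proof -
  have 1: "integral {a + c..b + c} (\<lambda>y. (sine_kernel (x + c) y)\<^sup>2) = integral {a..b} (\<lambda>y. (sine_kernel x y)\<^sup>2)" for x
  proof -
    have "integral {a..b} ((\<lambda>y. (sine_kernel (x + c) y)\<^sup>2) \<circ> (\<lambda>y. y + c)) = integral {a + c..b + c} (\<lambda>y. (sine_kernel (x + c) y)\<^sup>2)"
      by (intro integral_shift continuous_intros continuous_on_sine_kernel)
    then show ?thesis by (simp add: o_def sine_kernel_shift)
  qed
  have "integral {a..b} ((\<lambda>x. integral {a + c..b + c} (\<lambda>y. (sine_kernel x y)\<^sup>2)) \<circ> (\<lambda>x. x + c))
      = integral {a + c..b + c} (\<lambda>x. integral {a + c..b + c} (\<lambda>y. (sine_kernel x y)\<^sup>2))"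
    by (intro integral_shift continuous_integral_sine_kernel)
  then show ?thesis by (simp add: o_def 1)
qed

lemma card_PiE_1: "card {p \<in> (\<Pi>\<^sub>E i\<in>{..<1::nat}. A). inj_on p {..<1}} = card A"
proof -
  have "{..<1::nat} = {0}" by auto
  then have "{p \<in> (\<Pi>\<^sub>E i\<in>{..<1::nat}. A). inj_on p {..<1}} = (\<Pi>\<^sub>E i\<in>{0::nat}. A)" by auto
  then show ?thesis by (simp add: card_PiE)
qed

text \<open>A tuple \<open>p\<close> corresponds to the pair \<open>(p 0, p 1)\<close>, and
  injectivity removes the diagonal; this turns the two-point correlation into a second factorial
  moment.\<close>

lemma card_PiE_2:
  assumes A: "finite A"
  shows "card {p \<in> (\<Pi>\<^sub>E i\<in>{..<2::nat}. A). inj_on p {..<2}} = card A * card A - card A"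
proof -
  have two: "{..<2::nat} = {0, 1}" by auto
  let ?P = "{p \<in> (\<Pi>\<^sub>E i\<in>{..<2::nat}. A). inj_on p {..<2}}"
  let ?Q = "A \<times> A - (\<lambda>a. (a, a)) ` A"
  have "bij_betw (\<lambda>p. (p 0, p 1)) ?P ?Q"
    by (rule bij_betw_byWitness[where f' = "\<lambda>(a, b). \<lambda>i\<in>{..<2::nat}. if i = 0 then a else b"])
       (auto simp: two PiE_iff extensional_def fun_eq_iff inj_on_def)
  then have "card ?P = card ?Q" by (rule bij_betw_same_card)
  also have "\<dots> = card (A \<times> A) - card ((\<lambda>a. (a, a)) ` A)"
    using A by (intro card_Diff_subset) auto
  also have "\<dots> = card A * card A - card A"
    by (simp add: card_cartesian_product card_image inj_on_def)
  finally show ?thesis .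
qed

lemma det_mat_2:
  fixes f :: "nat \<Rightarrow> nat \<Rightarrow> real"
  shows "Determinant.det (mat 2 2 (\<lambda>(i, j). f i j)) = f 0 0 * f 1 1 - f 0 1 * f 1 0"
proof -
  have "Determinant.det (mat 2 2 (\<lambda>(i, j). f i j)) = (\<Sum>i<2. mat 2 2 (\<lambda>(i, j). f i j) $$ (i, 0) * cofactor (mat 2 2 (\<lambda>(i, j). f i j)) i 0)"
    by (rule laplace_expansion_column) auto
  then show ?thesis
    by (simp add: cofactor_def mat_delete_def numeral_2_eq_2 det_single)
qed

text \<open>The one-point function is 1 and gives the mean \<open>s\<close>; the two-point function
  is 1 minus the squared kernel and gives the second factorial moment. Translation invariance of the
  kernel removes \<open>c\<close>.\<close>

lemma sine_process_variance:
  assumes D: "determinantal_point_process P X sine_kernel" and s: "s > 0"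
  shows "prob_space.variance P (\<lambda>\<omega>. real (card (X \<omega> \<inter> {c..c + s})))
    = s - integral {0..s} (\<lambda>\<rho>. integral {0..s} (\<lambda>\<xi>. (sine_kernel \<xi> \<rho>)\<^sup>2))"
proof -
  let ?B = "{c..c + s}"
  let ?N = "\<lambda>\<omega>. card (X \<omega> \<inter> ?B)"
  have ps: "prob_space P" and fin: "\<And>\<omega>. \<omega> \<in> space P \<Longrightarrow> finite (X \<omega> \<inter> ?B)"
    and meas: "?N \<in> P \<rightarrow>\<^sub>M count_space UNIV"
    using D unfolding determinantal_point_process_def simple_point_process_def by auto
  interpret prob_space P by fact
  have corr: "(\<integral>\<^sup>+\<omega>. of_nat (card {p \<in> (\<Pi>\<^sub>E i\<in>{..<k}. X \<omega> \<inter> ?B). inj_on p {..<k}}) \<partial>P) =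
        (\<integral>\<^sup>+p\<in>(\<Pi>\<^sub>E i\<in>{..<k}. ?B). ennreal (Determinant.det (mat k k (\<lambda>(i, j). sine_kernel (p i) (p j)))) \<partial>(\<Pi>\<^sub>M i\<in>{..<k}. lborel))" for k
    using D unfolding determinantal_point_process_def by (elim conjE allE[of _ k] allE[of _ "\<lambda>_. ?B"]) auto
  have E1: "(\<integral>\<^sup>+\<omega>. ennreal (real (?N \<omega>)) \<partial>P) = ennreal s"
  proof -
    have "(\<integral>\<^sup>+\<omega>. ennreal (real (?N \<omega>)) \<partial>P) = (\<integral>\<^sup>+\<omega>. of_nat (card {p \<in> (\<Pi>\<^sub>E i\<in>{..<1::nat}. X \<omega> \<inter> ?B). inj_on p {..<1}}) \<partial>P)"
      unfolding card_PiE_1 by (simp add: ennreal_of_nat_eq_real_of_nat)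
    also have "\<dots> = (\<integral>\<^sup>+p\<in>(\<Pi>\<^sub>E i\<in>{..<1::nat}. ?B). 1 \<partial>(\<Pi>\<^sub>M i\<in>{..<1}. lborel))"
      unfolding corr by (intro nn_integral_cong) (simp add: det_single sine_kernel_def)
    also have "\<dots> = emeasure (\<Pi>\<^sub>M i\<in>{..<1::nat}. lborel) (\<Pi>\<^sub>E i\<in>{..<1}. ?B)"
      by (simp add: nn_integral_indicator sets_PiM_I_finite)
    also have "\<dots> = (\<Prod>i\<in>{..<1::nat}. emeasure lborel ?B)" by (rule lb.emeasure_PiM) auto
    also have "\<dots> = ennreal s" using s by simp
    finally show ?thesis .
  qed
  define I where "I = integral ?B (\<lambda>x. integral ?B (\<lambda>y. (sine_kernel x y)\<^sup>2))"
  have K1: "(sine_kernel x y)\<^sup>2 \<le> 1" for x y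
    using sine_kernel_le_1[of x y] by (simp add: abs_square_le_1)
  have cK: "continuous_on A (\<lambda>y. (sine_kernel x y)\<^sup>2)" for A x
    by (intro continuous_intros continuous_on_sine_kernel)
  have inner: "integral ?B (\<lambda>y. 1 - (sine_kernel x y)\<^sup>2) = s - integral ?B (\<lambda>y. (sine_kernel x y)\<^sup>2)" for x
    using s by (subst integral_diff) (auto intro!: integrable_continuous_real cK)
  have inner_nn: "0 \<le> s - integral ?B (\<lambda>y. (sine_kernel x y)\<^sup>2)" for x
    unfolding inner[symmetric] using K1 by (intro integral_nonneg integrable_continuous_real continuous_intros cK) auto
  have E2: "(\<integral>\<^sup>+\<omega>. ennreal (real (?N \<omega> * ?N \<omega> - ?N \<omega>)) \<partial>P) = ennreal (s * s - I)"
  proof -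
    have "(\<integral>\<^sup>+\<omega>. ennreal (real (?N \<omega> * ?N \<omega> - ?N \<omega>)) \<partial>P) = (\<integral>\<^sup>+\<omega>. of_nat (card {p \<in> (\<Pi>\<^sub>E i\<in>{..<2::nat}. X \<omega> \<inter> ?B). inj_on p {..<2}}) \<partial>P)"
      by (intro nn_integral_cong) (simp only: card_PiE_2 fin ennreal_of_nat_eq_real_of_nat)
    also have "\<dots> = (\<integral>\<^sup>+p. ennreal (1 - (sine_kernel (p 0) (p 1))\<^sup>2) * (indicator ?B (p 0) * indicator ?B (p 1)) \<partial>(\<Pi>\<^sub>M i\<in>{..<2::nat}. lborel))"
      unfolding corr
    proof (intro nn_integral_cong)
      fix p :: "nat \<Rightarrow> real" assume "p \<in> space (\<Pi>\<^sub>M i\<in>{..<2::nat}. lborel)"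
      then have e: "p \<in> extensional {..<2}" by (simp add: space_PiM PiE_iff)
      have two: "{..<2::nat} = {0, 1}" by auto
      have "indicator (\<Pi>\<^sub>E i\<in>{..<2}. ?B) p = (indicator ?B (p 0) * indicator ?B (p 1) :: ennreal)"
        using e by (auto simp: indicator_def PiE_iff two)
      moreover have "Determinant.det (mat 2 2 (\<lambda>(i, j). sine_kernel (p i) (p j))) = 1 - (sine_kernel (p 0) (p 1))\<^sup>2"
        unfolding det_mat_2 using sine_kernel_commute[of "p 1" "p 0"] by (simp add: sine_kernel_refl power2_eq_square)
      ultimately show "ennreal (Determinant.det (mat 2 2 (\<lambda>(i, j). sine_kernel (p i) (p j)))) * indicator (\<Pi>\<^sub>E i\<in>{..<2}. ?B) p
         = ennreal (1 - (sine_kernel (p 0) (p 1))\<^sup>2) * (indicator ?B (p 0) * indicator ?B (p 1))" by simp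
    qed
    \<comment> \<open>Written this way, coordinate 1 is integrated first, for fixed coordinate
      0.\<close>
    also have "{..<2::nat} = insert 1 {0}" by auto
    also have "(\<integral>\<^sup>+p. ennreal (1 - (sine_kernel (p 0) (p 1))\<^sup>2) * (indicator ?B (p 0) * indicator ?B (p 1)) \<partial>(\<Pi>\<^sub>M i\<in>insert 1 {0::nat}. lborel))
      = (\<integral>\<^sup>+p. (\<integral>\<^sup>+y. ennreal (1 - (sine_kernel (p 0) y)\<^sup>2) * (indicator ?B (p 0) * indicator ?B y) \<partial>lborel) \<partial>(\<Pi>\<^sub>M i\<in>{0::nat}. lborel))"
    proof (subst lb.product_nn_integral_insert)
      have "(\<lambda>(x, y). sine_kernel x y) \<in> borel_measurable (borel \<Otimes>\<^sub>M borel)"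
        unfolding borel_prod by (intro borel_measurable_continuous_onI) (auto simp: case_prod_beta intro!: continuous_on_sine_kernel continuous_intros)
      then have [measurable]: "(\<lambda>p. sine_kernel (p 0) (p 1)) \<in> borel_measurable (\<Pi>\<^sub>M i\<in>insert 1 {0::nat}. lborel)"
        by (rule measurable_compose[rotated, where g = "\<lambda>(x, y). sine_kernel x y" and f = "\<lambda>p. (p 0, p 1)", unfolded split]) measurable
      show "(\<lambda>p. ennreal (1 - (sine_kernel (p 0) (p 1))\<^sup>2) * (indicator ?B (p 0) * indicator ?B (p 1))) \<in> borel_measurable (\<Pi>\<^sub>M i\<in>insert 1 {0::nat}. lborel)"
        by measurable
    qed auto
    also have "\<dots> = (\<integral>\<^sup>+p. ennreal (s - integral ?B (\<lambda>y. (sine_kernel (p 0) y)\<^sup>2)) * indicator ?B (p 0) \<partial>(\<Pi>\<^sub>M i\<in>{0::nat}. lborel))"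
    proof (intro nn_integral_cong)
      fix p :: "nat \<Rightarrow> real"
      have "(\<integral>\<^sup>+y. ennreal (1 - (sine_kernel (p 0) y)\<^sup>2) * (indicator ?B (p 0) * indicator ?B y) \<partial>lborel)
        = (\<integral>\<^sup>+y. ennreal (1 - (sine_kernel (p 0) y)\<^sup>2) * indicator ?B y \<partial>lborel) * indicator ?B (p 0)"
        by (cases "p 0 \<in> ?B") auto
      also have "(\<integral>\<^sup>+y. ennreal (1 - (sine_kernel (p 0) y)\<^sup>2) * indicator ?B y \<partial>lborel) = ennreal (s - integral ?B (\<lambda>y. (sine_kernel (p 0) y)\<^sup>2))"
        using K1 by (subst nn_integral_Icc) (auto intro!: continuous_intros cK simp: inner)
      finally show "(\<integral>\<^sup>+y. ennreal (1 - (sine_kernel (p 0) y)\<^sup>2) * (indicator ?B (p 0) * indicator ?B y) \<partial>lborel)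
        = ennreal (s - integral ?B (\<lambda>y. (sine_kernel (p 0) y)\<^sup>2)) * indicator ?B (p 0)" .
    qed
    also have "\<dots> = (\<integral>\<^sup>+x. ennreal (s - integral ?B (\<lambda>y. (sine_kernel x y)\<^sup>2)) * indicator ?B x \<partial>lborel)"
    proof (rule lb.product_nn_integral_singleton[where f = "\<lambda>x. ennreal (s - integral ?B (\<lambda>y. (sine_kernel x y)\<^sup>2)) * indicator ?B x"])
      have "(\<lambda>x. s - integral ?B (\<lambda>y. (sine_kernel x y)\<^sup>2)) \<in> borel_measurable borel"
        by (intro borel_measurable_continuous_onI continuous_intros continuous_integral_sine_kernel)
      then show "(\<lambda>x. ennreal (s - integral ?B (\<lambda>y. (sine_kernel x y)\<^sup>2)) * indicator ?B x) \<in> borel_measurable lborel"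
        by measurable
    qed
    also have "\<dots> = ennreal (integral ?B (\<lambda>x. s - integral ?B (\<lambda>y. (sine_kernel x y)\<^sup>2)))"
      by (rule nn_integral_Icc[OF _ inner_nn]) (intro continuous_intros continuous_integral_sine_kernel)
    also have "integral ?B (\<lambda>x. s - integral ?B (\<lambda>y. (sine_kernel x y)\<^sup>2)) = s * s - I"
      using s unfolding I_def by (subst integral_diff) (auto intro!: integrable_continuous_real continuous_integral_sine_kernel)
    finally show ?thesis .
  qed
  have mN: "(\<lambda>\<omega>. real (?N \<omega>)) \<in> borel_measurable P" "(\<lambda>\<omega>. real (?N \<omega> * ?N \<omega> - ?N \<omega>)) \<in> borel_measurable P"
    using meas by (auto intro: measurable_compose[OF meas])
  have i1: "integrable P (\<lambda>\<omega>. real (?N \<omega>))" "expectation (\<lambda>\<omega>. real (?N \<omega>)) = s"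
    using nn_integral_eq_integrable[of "\<lambda>\<omega>. real (?N \<omega>)" P s] mN(1) E1 s by auto
  \<comment> \<open>\<open>ennreal\<close> truncates at 0, so the sign must be known before
    \<open>E2\<close> becomes a statement about a real expectation.\<close>
  have sI: "0 \<le> s * s - I"
  proof -
    have "s * s - I = integral ?B (\<lambda>x. s - integral ?B (\<lambda>y. (sine_kernel x y)\<^sup>2))"
      using s unfolding I_def by (subst integral_diff) (auto intro!: integrable_continuous_real continuous_integral_sine_kernel)
    also have "\<dots> \<ge> 0"
      by (intro integral_nonneg integrable_continuous_real continuous_intros continuous_integral_sine_kernel inner_nn)
    finally show ?thesis .
  qed
  have i2: "integrable P (\<lambda>\<omega>. real (?N \<omega> * ?N \<omega> - ?N \<omega>))" "expectation (\<lambda>\<omega>. real (?N \<omega> * ?N \<omega> - ?N \<omega>)) = s * s - I"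
    using iffD1[OF nn_integral_eq_integrable[OF mN(2) AE_I2[OF of_nat_0_le_iff] sI] E2] by blast+
  have sq: "(\<lambda>\<omega>. (real (?N \<omega>))\<^sup>2) = (\<lambda>\<omega>. real (?N \<omega> * ?N \<omega> - ?N \<omega>) + real (?N \<omega>))"
  proof
    fix \<omega>
    have "?N \<omega> \<le> ?N \<omega> * ?N \<omega>" by simp
    then show "(real (?N \<omega>))\<^sup>2 = real (?N \<omega> * ?N \<omega> - ?N \<omega>) + real (?N \<omega>)"
      by (simp only: of_nat_diff of_nat_mult power2_eq_square diff_add_cancel)
  qed
  have i3: "integrable P (\<lambda>\<omega>. (real (?N \<omega>))\<^sup>2)" "expectation (\<lambda>\<omega>. (real (?N \<omega>))\<^sup>2) = s * s - I + s"
    unfolding sq using i1 i2 by (auto simp del: of_nat_diff)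
  have "I = integral {0..s} (\<lambda>x. integral {0..s} (\<lambda>y. (sine_kernel x y)\<^sup>2))"
    using double_integral_sine_kernel_shift[of 0 c s] by (simp add: I_def add.commute)
  also have "\<dots> = integral {0..s} (\<lambda>\<rho>. integral {0..s} (\<lambda>\<xi>. (sine_kernel \<xi> \<rho>)\<^sup>2))"
    by (simp only: sine_kernel_commute)
  finally have I: "I = integral {0..s} (\<lambda>\<rho>. integral {0..s} (\<lambda>\<xi>. (sine_kernel \<xi> \<rho>)\<^sup>2))" .
  show ?thesis
    using variance_eq[OF i1(1) i3(1)] unfolding i1(2) i3(2) I by (simp add: power2_eq_square)
qed

section \<open>Passage to the limit\<close>

lemma integral_close:
  fixes f g :: "real \<Rightarrow> real"
  assumes "continuous_on {a..b} f" "continuous_on {a..b} g" "a \<le> b"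
    and "\<And>x. x \<in> {a..b} \<Longrightarrow> \<bar>f x - g x\<bar> \<le> e"
  shows "\<bar>integral {a..b} f - integral {a..b} g\<bar> \<le> e * (b - a)"
proof -
  have "integral {a..b} f - integral {a..b} g = integral {a..b} (\<lambda>x. f x - g x)"
    using assms by (intro integral_diff[symmetric] integrable_continuous_real)
  moreover have "norm (integral {a..b} (\<lambda>x. f x - g x)) \<le> e * (b - a)"
    using assms by (intro integral_bound continuous_intros) auto
  ultimately show ?thesis by simp
qed

lemma integral_rescale:
  fixes f :: "real \<Rightarrow> real"
  assumes f: "continuous_on {- (c / u)..c / u} f" and u: "u > 0" and c: "c \<ge> 0"
  shows "integral {- (c / u)..c / u} f = integral {-c..c} (\<lambda>x. f (x / u) / u)"
proof -
  have "((\<lambda>x. (1 / u) *\<^sub>R f (x / u)) has_integral integral {- c / u..c / u} f) {-c..c}"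
  proof (rule has_integral_substitution[where c = "- (c / u)" and d = "c / u"])
    show "(\<lambda>x. x / u) ` {-c..c} \<subseteq> {- (c / u)..c / u}"
      using u by (auto simp: divide_right_mono simp flip: minus_divide_left)
    show "((\<lambda>x. x / u) has_real_derivative 1 / u) (at x within {-c..c})" for x
      by (rule DERIV_cdivide[OF DERIV_ident])
  qed (use f c u in \<open>auto simp: divide_right_mono\<close>)
  then have "((\<lambda>x. f (x / u) / u) has_integral integral {- (c / u)..c / u} f) {-c..c}" by simp
  then show ?thesis by (rule integral_unique[symmetric])
qed

text \<open>After rescaling, both integrals run over a fixed interval or square, where uniform
  convergence of the kernel suffices. Squares stay close because the sine kernel is bounded by 1,
  whence the factor \<open>e N + 2\<close>.\<close>

lemma number_variance_limit:
  fixes k :: "nat \<Rightarrow> real \<Rightarrow> real \<Rightarrow> real"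
  assumes s: "s > 0"
    and k_cont: "\<And>N. continuous_on UNIV (\<lambda>(x, y). k N x y)"
    and mu: "\<forall>\<^sub>F N in sequentially. \<mu> N > 0"
    and err: "e \<longlonglongrightarrow> 0"
    and close: "\<forall>\<^sub>F N in sequentially. \<forall>\<xi>\<in>{- (s / 2)..s / 2}. \<forall>\<eta>\<in>{- (s / 2)..s / 2}.
       \<bar>k N (\<xi> / \<mu> N) (\<eta> / \<mu> N) / \<mu> N - sine_kernel \<xi> \<eta>\<bar> \<le> e N"
  shows "(\<lambda>N. integral {- (s / 2 / \<mu> N)..s / 2 / \<mu> N} (\<lambda>t. k N t t)
      - integral {- (s / 2 / \<mu> N)..s / 2 / \<mu> N} (\<lambda>t. integral {- (s / 2 / \<mu> N)..s / 2 / \<mu> N} (\<lambda>u. (k N t u)\<^sup>2)))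
     \<longlonglongrightarrow> s - integral {0..s} (\<lambda>\<rho>. integral {0..s} (\<lambda>\<xi>. (sine_kernel \<xi> \<rho>)\<^sup>2))"
proof -
  define c where "c = s / 2"
  have c: "c > 0" "c - (-c) = s" using s by (simp_all add: c_def)
  let ?B = "{-c..c}"
  let ?I = "integral ?B (\<lambda>x. integral ?B (\<lambda>y. (sine_kernel x y)\<^sup>2))"
  define q where "q N x y = k N (x / \<mu> N) (y / \<mu> N) / \<mu> N" for N x y
  have kc: "continuous_on A (\<lambda>z. k N (f z) (g z))" if "continuous_on A f" "continuous_on A g" for A f N and g :: "'b::topological_space \<Rightarrow> real"
    using continuous_on_compose2[OF k_cont[of N] continuous_on_Pair[OF that]] by simp
  have main: "\<forall>\<^sub>F N in sequentially.
     \<bar>(integral {- (c / \<mu> N)..c / \<mu> N} (\<lambda>t. k N t t)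
      - integral {- (c / \<mu> N)..c / \<mu> N} (\<lambda>t. integral {- (c / \<mu> N)..c / \<mu> N} (\<lambda>u. (k N t u)\<^sup>2))) - (s - ?I)\<bar>
      \<le> e N * s + e N * (e N + 2) * s * s"
    using close mu
  proof eventually_elim
    case (elim N)
    have qc: "continuous_on A (\<lambda>z. q N (f z) (g z))" if "continuous_on A f" "continuous_on A g" for A f and g :: "'b::topological_space \<Rightarrow> real"
      unfolding q_def using elim(2) that by (intro continuous_intros kc) auto
    have cl: "\<bar>q N x y - sine_kernel x y\<bar> \<le> e N" if "x \<in> ?B" "y \<in> ?B" for x y
      using elim(1) that unfolding q_def c_def by blast
    have e0: "e N \<ge> 0" using cl[of 0 0] c by auto
    have sq: "\<bar>(q N x y)\<^sup>2 - (sine_kernel x y)\<^sup>2\<bar> \<le> e N * (e N + 2)" if "x \<in> ?B" "y \<in> ?B" for x y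
    proof -
      have "\<bar>q N x y + sine_kernel x y\<bar> \<le> e N + 2"
        using cl[OF that] sine_kernel_le_1[of x y] by linarith
      then have "\<bar>q N x y - sine_kernel x y\<bar> * \<bar>q N x y + sine_kernel x y\<bar> \<le> e N * (e N + 2)"
        using cl[OF that] e0 by (intro mult_mono) auto
      moreover have "(q N x y)\<^sup>2 - (sine_kernel x y)\<^sup>2 = (q N x y - sine_kernel x y) * (q N x y + sine_kernel x y)"
        by (simp add: power2_eq_square algebra_simps)
      ultimately show ?thesis by (simp only: abs_mult)
    qed
    have kparam: "continuous_on A (\<lambda>x. integral {a..b} (\<lambda>y. (k N x y)\<^sup>2))" for A a b
    proof -
      have "continuous_on (A \<times> cbox a b) (\<lambda>(x, y). (k N x y)\<^sup>2)"
        unfolding case_prod_beta by (intro continuous_intros kc)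
      from integral_continuous_on_param[OF this] show ?thesis by simp
    qed
    have qparam: "continuous_on A (\<lambda>x. integral {a..b} (\<lambda>y. (q N x y)\<^sup>2))" for A a b
    proof -
      have "continuous_on (A \<times> cbox a b) (\<lambda>(x, y). (q N x y)\<^sup>2)"
        unfolding case_prod_beta by (intro continuous_intros qc)
      from integral_continuous_on_param[OF this] show ?thesis by simp
    qed
    have diag: "integral {- (c / \<mu> N)..c / \<mu> N} (\<lambda>t. k N t t) = integral ?B (\<lambda>x. q N x x)"
      unfolding q_def using elim(2) c(1) by (intro integral_rescale kc continuous_intros) auto
    have in1: "integral {- (c / \<mu> N)..c / \<mu> N} (\<lambda>u. (k N t u)\<^sup>2) = integral ?B (\<lambda>y. (k N t (y / \<mu> N))\<^sup>2 / \<mu> N)" for t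
      using elim(2) c(1) by (intro integral_rescale kc continuous_intros) auto
    have "integral {- (c / \<mu> N)..c / \<mu> N} (\<lambda>t. integral {- (c / \<mu> N)..c / \<mu> N} (\<lambda>u. (k N t u)\<^sup>2))
       = integral ?B (\<lambda>x. integral {- (c / \<mu> N)..c / \<mu> N} (\<lambda>u. (k N (x / \<mu> N) u)\<^sup>2) / \<mu> N)"
      using elim(2) c(1) by (intro integral_rescale kparam) auto
    also have "\<dots> = integral ?B (\<lambda>x. integral ?B (\<lambda>y. (q N x y)\<^sup>2))"
    proof (rule integral_cong)
      fix x
      have "integral {- (c / \<mu> N)..c / \<mu> N} (\<lambda>u. (k N (x / \<mu> N) u)\<^sup>2) / \<mu> N = integral ?B (\<lambda>y. (k N (x / \<mu> N) (y / \<mu> N))\<^sup>2 / \<mu> N) / \<mu> N"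
        unfolding in1 ..
      also have "\<dots> = integral ?B (\<lambda>y. (k N (x / \<mu> N) (y / \<mu> N))\<^sup>2 / \<mu> N / \<mu> N)"
        by (simp only: divide_inverse integral_mult_left)
      also have "(\<lambda>y. (k N (x / \<mu> N) (y / \<mu> N))\<^sup>2 / \<mu> N / \<mu> N) = (\<lambda>y. (q N x y)\<^sup>2)"
        by (simp add: q_def power_divide power2_eq_square)
      finally show "integral {- (c / \<mu> N)..c / \<mu> N} (\<lambda>u. (k N (x / \<mu> N) u)\<^sup>2) / \<mu> N = integral ?B (\<lambda>y. (q N x y)\<^sup>2)" .
    qed
    finally have dbl: "integral {- (c / \<mu> N)..c / \<mu> N} (\<lambda>t. integral {- (c / \<mu> N)..c / \<mu> N} (\<lambda>u. (k N t u)\<^sup>2))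
       = integral ?B (\<lambda>x. integral ?B (\<lambda>y. (q N x y)\<^sup>2))" .
    have "\<bar>integral ?B (\<lambda>x. q N x x) - integral ?B (\<lambda>x. sine_kernel x x)\<bar> \<le> e N * (c - (-c))"
      by (rule integral_close) (use c cl in \<open>auto intro!: qc continuous_on_sine_kernel continuous_intros\<close>)
    moreover have "integral ?B (\<lambda>x. sine_kernel x x) = s" using c by (simp add: sine_kernel_refl)
    ultimately have 1: "\<bar>integral ?B (\<lambda>x. q N x x) - s\<bar> \<le> e N * s" using c(2) by simp
    have 2: "\<bar>integral ?B (\<lambda>x. integral ?B (\<lambda>y. (q N x y)\<^sup>2)) - ?I\<bar> \<le> e N * (e N + 2) * (c - (-c)) * (c - (-c))"
    proof (rule integral_close)
      fix x assume x: "x \<in> ?B"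
      show "\<bar>integral ?B (\<lambda>y. (q N x y)\<^sup>2) - integral ?B (\<lambda>y. (sine_kernel x y)\<^sup>2)\<bar> \<le> e N * (e N + 2) * (c - (-c))"
        by (rule integral_close) (use c sq[OF x] in \<open>auto intro!: qc continuous_on_sine_kernel continuous_intros\<close>)
    qed (use c in \<open>auto intro!: qparam continuous_integral_sine_kernel\<close>)
    then show ?case using 1 unfolding diag dbl c(2) by linarith
  qed
  have "(\<lambda>N. e N * s + e N * (e N + 2) * s * s) \<longlonglongrightarrow> 0 * s + 0 * (0 + 2) * s * s"
    by (intro tendsto_intros err)
  then have lim: "(\<lambda>N. e N * s + e N * (e N + 2) * s * s) \<longlonglongrightarrow> 0" by simp
  have "(\<lambda>N. (integral {- (c / \<mu> N)..c / \<mu> N} (\<lambda>t. k N t t)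
      - integral {- (c / \<mu> N)..c / \<mu> N} (\<lambda>t. integral {- (c / \<mu> N)..c / \<mu> N} (\<lambda>u. (k N t u)\<^sup>2))) - (s - ?I)) \<longlonglongrightarrow> 0"
    by (rule Lim_null_comparison[OF main[folded real_norm_def] lim])
  then have "(\<lambda>N. integral {- (c / \<mu> N)..c / \<mu> N} (\<lambda>t. k N t t)
      - integral {- (c / \<mu> N)..c / \<mu> N} (\<lambda>t. integral {- (c / \<mu> N)..c / \<mu> N} (\<lambda>u. (k N t u)\<^sup>2))) \<longlonglongrightarrow> s - ?I"
    by (rule Lim_null[THEN iffD2])
  moreover have "?I = integral {0..s} (\<lambda>\<rho>. integral {0..s} (\<lambda>\<xi>. (sine_kernel \<xi> \<rho>)\<^sup>2))"
  proof -
    have "?I = integral {0..s} (\<lambda>x. integral {0..s} (\<lambda>y. (sine_kernel x y)\<^sup>2))"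
      using double_integral_sine_kernel_shift[of "-c" c c] by (simp add: c_def)
    then show ?thesis by (simp only: sine_kernel_commute)
  qed
  ultimately show ?thesis by (simp only: c_def)
qed

text \<open>The two fractions are equal with sum 1 + \<nu>, so both equal \<open>h\<close>, which is
  also the limit of \<open>\<kappa>\<close> / N. Squaring gives \<eta>^2 and \<zeta>^2 as
  \<open>h^2\<close> times products in a and b; their difference yields the limit of
  \<open>center\<close>, their sum the limit of \<open>radius2\<close> minus the squared
  center.\<close>

lemma endpoint_relations:
  assumes E: "equilibrium_endpoints \<nu> \<eta> a b" and pos: "\<nu> > 0" "\<eta> > 0" "\<nu> + \<eta> < 1"
  defines "\<zeta> \<equiv> 1 - \<eta> - \<nu>" and "h \<equiv> (1 + \<nu>) / 2"
  shows "\<eta> / sqrt ((1 + a) * (1 + b)) = h"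
    and "(\<eta> - \<zeta>) * (\<eta> + \<zeta>) / (4 * h\<^sup>2) = (a + b) / 2"
    and "(\<nu> - (\<eta> - \<zeta>)\<^sup>2 / 4) / h\<^sup>2 = - (a * b)"
proof -
  have ab: "-1 < a" "a < b" "b < 1" using E by (auto simp: equilibrium_endpoints_def)
  have h: "h > 0" using pos by (simp add: h_def)
  have z: "\<zeta> > 0" using pos by (simp add: \<zeta>_def)
  show 1: "\<eta> / sqrt ((1 + a) * (1 + b)) = h"
  proof -
    have "1 + \<nu> = \<eta> / sqrt ((1 + a) * (1 + b)) + (1 - \<eta> - \<nu>) / sqrt ((1 - a) * (1 - b))"
      "\<eta> / sqrt ((1 + a) * (1 + b)) = (1 - \<eta> - \<nu>) / sqrt ((1 - a) * (1 - b))"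
      using E unfolding equilibrium_endpoints_def by blast+
    then have "1 + \<nu> = 2 * (\<eta> / sqrt ((1 + a) * (1 + b)))" by (simp only: mult_2)
    then show ?thesis unfolding h_def by (simp only:) simp
  qed
  have 2: "\<zeta> / sqrt ((1 - a) * (1 - b)) = h"
    using E 1 unfolding equilibrium_endpoints_def \<zeta>_def by metis
  have p: "(1 + a) * (1 + b) > 0" "(1 - a) * (1 - b) > 0" using ab by auto
  have "\<eta>\<^sup>2 / ((1 + a) * (1 + b)) = h\<^sup>2" "\<zeta>\<^sup>2 / ((1 - a) * (1 - b)) = h\<^sup>2"
    using arg_cong[OF 1, of "\<lambda>t. t\<^sup>2"] arg_cong[OF 2, of "\<lambda>t. t\<^sup>2"] p by (simp_all only: power_divide real_sqrt_pow2 less_imp_le)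
  moreover have "X = Y * Q" if "X / Q = Y" "Q > 0" for X Y Q :: real using that by (simp add: field_simps)
  ultimately have e: "\<eta>\<^sup>2 = h\<^sup>2 * ((1 + a) * (1 + b))" "\<zeta>\<^sup>2 = h\<^sup>2 * ((1 - a) * (1 - b))"
    using p by blast+
  have "(\<eta> - \<zeta>) * (\<eta> + \<zeta>) = \<eta>\<^sup>2 - \<zeta>\<^sup>2" by (simp add: algebra_simps power2_eq_square)
  also have "\<dots> = 4 * h\<^sup>2 * ((a + b) / 2)" unfolding e by (simp add: algebra_simps)
  finally show "(\<eta> - \<zeta>) * (\<eta> + \<zeta>) / (4 * h\<^sup>2) = (a + b) / 2" using h by simp
  have sum: "\<eta> + \<zeta> = 1 - \<nu>" by (simp add: \<zeta>_def)
  \<comment> \<open>(1 + \<nu>)^2 / 4 - \<nu> = (1 - \<nu>)^2 / 4, which is where the sum \<eta> +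
    \<zeta> = 1 - \<nu> enters.\<close>
  have "h\<^sup>2 - \<nu> = (\<eta> + \<zeta>)\<^sup>2 / 4" unfolding sum h_def by (simp add: power2_eq_square field_simps)
  moreover have "(\<eta> + \<zeta>)\<^sup>2 / 4 + (\<eta> - \<zeta>)\<^sup>2 / 4 = (\<eta>\<^sup>2 + \<zeta>\<^sup>2) / 2"
    by (simp add: power2_eq_square field_simps)
  ultimately have "\<nu> - (\<eta> - \<zeta>)\<^sup>2 / 4 = h\<^sup>2 - (\<eta>\<^sup>2 + \<zeta>\<^sup>2) / 2"
    by linarith
  also have "\<dots> = h\<^sup>2 * (- (a * b))" unfolding e by (simp add: algebra_simps)
  finally show "(\<nu> - (\<eta> - \<zeta>)\<^sup>2 / 4) / h\<^sup>2 = - (a * b)" using h by simp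
qed

lemma (in jacobi) continuous_kern_pair: "continuous_on UNIV (\<lambda>(x, y). kern n x y)"
proof -
  have "continuous_on UNIV (\<lambda>z :: real \<times> real. phi k (fst z))" for k
    by (rule continuous_on_compose2[OF continuous_phi[of UNIV]]) (auto intro: continuous_intros)
  moreover have "continuous_on UNIV (\<lambda>z :: real \<times> real. phi k (snd z))" for k
    by (rule continuous_on_compose2[OF continuous_phi[of UNIV]]) (auto intro: continuous_intros)
  ultimately show ?thesis unfolding kern_def case_prod_beta by (intro continuous_intros)
qed

theorem mainTheorem4:
  fixes \<nu> \<eta> a b s :: real
    and n x :: "nat \<Rightarrow> nat"
    and M :: "nat \<Rightarrow> 'a measure"
    and Y :: "nat \<Rightarrow> nat \<Rightarrow> 'a \<Rightarrow> real"
  assumes "\<nu> > 0" and "\<eta> > 0" and "\<nu> + \<eta> < 1"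
    and "\<forall>\<^sub>F N in sequentially. 1 \<le> n N \<and> n N < N \<and> 1 \<le> x N \<and> x N \<le> N - n N + 1"
    and "(\<lambda>N. real (n N) / real N) \<longlonglongrightarrow> \<nu>"
    and "(\<lambda>N. (real (x N) - 1) / real N) \<longlonglongrightarrow> \<eta>"
    and "equilibrium_endpoints \<nu> \<eta> a b"
    and "0 \<in> {a<..<b}"
    and "\<forall>\<^sub>F N in sequentially. bus_arrival_times (M N) N (n N) (x N) (Y N)"
    and "s > 0"
  shows "\<exists>H_inf :: real.
    (\<lambda>N. bus_number_variance (M N) (n N) (Y N)
            (s / (real (n N) * equilibrium_density \<nu> \<eta> a b 0))) \<longlonglongrightarrow> H_inf \<and>
    (\<forall>(P :: 'b measure) X c. determinantal_point_process P X sine_kernel \<longrightarrow>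
       prob_space.variance P (\<lambda>\<omega>. real (card (X \<omega> \<inter> {c..c + s}))) = H_inf) \<and>
    H_inf = s - integral {0..s} (\<lambda>\<rho>. integral {0..s} (\<lambda>\<xi>. (sine_kernel \<xi> \<rho>)\<^sup>2))"
proof -
  have pos: "\<nu> > 0" "\<eta> > 0" "\<nu> + \<eta> < 1" by fact+
  define \<zeta> where "\<zeta> = 1 - \<eta> - \<nu>"
  define h where "h = (1 + \<nu>) / 2"
  note rel = endpoint_relations[OF \<open>equilibrium_endpoints \<nu> \<eta> a b\<close> pos, folded \<zeta>_def h_def]
  have z: "\<zeta> > 0" and h: "h > 0" using pos by (auto simp: \<zeta>_def h_def)
  have ab: "-1 < a" "b < 1" "a < 0" "0 < b"
    using \<open>equilibrium_endpoints \<nu> \<eta> a b\<close> \<open>0 \<in> {a<..<b}\<close> by (auto simp: equilibrium_endpoints_def)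
  have nab: "- (a * b) > 0" using ab by (simp add: mult_neg_pos)
  define m0 where "m0 = (a + b) / 2"
  define r where "r = (b - a) / 2"
  have r2: "r\<^sup>2 = m0\<^sup>2 + - (a * b)" by (simp add: m0_def r_def power2_eq_square field_simps)
  define d0 where "d0 = equilibrium_density \<nu> \<eta> a b 0"
  \<comment> \<open>The first endpoint relation rewrites the density at 0 through \<open>h\<close>,
    and ab < 0 because 0 lies between the endpoints.\<close>
  have d0: "d0 = h * sqrt (- (a * b)) / (\<nu> * pi)"
  proof -
    have "d0 = (\<eta> / sqrt ((1 + a) * (1 + b))) * sqrt (- (a * b)) / (\<nu> * pi)"
      using ab by (simp add: d0_def equilibrium_density_def)
    then show ?thesis unfolding rel(1) .
  qed
  have d0_pos: "d0 > 0" unfolding d0 using h nab pos by simp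

  define \<alpha> where "\<alpha> N = x N - 1" for N
  define \<beta> where "\<beta> N = N - x N - (n N - 1)" for N
  define A where "A N = real (n N) / real N" for N
  define B where "B N = (real (x N) - 1) / real N" for N
  have A: "A \<longlonglongrightarrow> \<nu>" and B: "B \<longlonglongrightarrow> \<eta>"
    unfolding A_def B_def by fact+
  have "(\<lambda>N. 1 - B N - A N) \<longlonglongrightarrow> \<zeta>" unfolding \<zeta>_def by (intro tendsto_intros A B)
  then have ev_z: "\<forall>\<^sub>F N in sequentially. 0 < 1 - B N - A N" using z by (rule order_tendstoD)
  have ev_A: "\<forall>\<^sub>F N in sequentially. 0 < A N" using A pos(1) by (rule order_tendstoD)
  have ev_B: "\<forall>\<^sub>F N in sequentially. 0 < B N" using B pos(2) by (rule order_tendstoD)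
  \<comment> \<open>Positivity of the limits \<eta> and \<zeta> makes x at least 2 and x + n at most
    N eventually. From then on the truncated subtractions are exact, both exponents are at least 1,
    and n + \<alpha> + \<beta> = N.\<close>
  have ev: "\<forall>\<^sub>F N in sequentially. N > 0 \<and> n N \<ge> 1 \<and> \<alpha> N \<ge> 1 \<and> \<beta> N \<ge> 1 \<and>
      real (n N) = real N * A N \<and> real (\<alpha> N) = real N * B N \<and> real (\<beta> N) = real N * (1 - B N - A N)"
    using \<open>\<forall>\<^sub>F N in sequentially. 1 \<le> n N \<and> n N < N \<and> 1 \<le> x N \<and> x N \<le> N - n N + 1\<close> ev_z ev_B eventually_gt_at_top[of 0]
  proof eventually_elim
    case (elim N)
    have N: "real N > 0" using elim by simp
    have nA: "real (n N) = real N * A N" and xB: "real (x N) - 1 = real N * B N" using N by (simp_all add: A_def B_def)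
    have "real N * B N > 0" using N elim by simp
    then have x2: "x N \<ge> 2" using xB by simp
    have "real N * (1 - B N - A N) > 0" using N elim by simp
    then have "real N - (real (x N) - 1) - real (n N) > 0" unfolding nA xB by (simp add: algebra_simps)
    then have xn: "x N + n N \<le> N" by linarith
    have "real (\<alpha> N) = real (x N) - 1" using x2 by (simp add: \<alpha>_def of_nat_diff)
    moreover have "real (\<beta> N) = real N - (real (x N) - 1) - real (n N)"
      using xn elim by (simp add: \<beta>_def of_nat_diff)
    then have "real (\<beta> N) = real N * (1 - B N - A N)" unfolding nA xB by (simp add: algebra_simps)
    moreover have "\<alpha> N \<ge> 1" "\<beta> N \<ge> 1" using x2 xn elim by (auto simp: \<alpha>_def \<beta>_def)
    ultimately show ?case using elim nA xB by simp
  qed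

  define \<mu> where "\<mu> N = real (n N) * d0" for N
  define \<kappa> where "\<kappa> N = jacobi.\<kappa> (\<alpha> N) (\<beta> N) (n N)" for N
  define \<phi> where "\<phi> N = jacobi.phi (\<alpha> N) (\<beta> N) (n N)" for N
  define D where "D N = jacobi.dphi (\<alpha> N) (\<beta> N) (n N)" for N
  define c where "c N = jacobi.center (\<alpha> N) (\<beta> N) (n N)" for N
  define \<rho> where "\<rho> N = jacobi.radius2 (\<alpha> N) (\<beta> N) (n N)" for N
  define k where "k N = jacobi.kern (\<alpha> N) (\<beta> N) (n N)" for N

  have ev_k: "\<forall>\<^sub>F N in sequentially. \<kappa> N = real N * ((1 + A N) / 2)"
    using ev
  proof eventually_elim
    case (elim N)
    then have "\<kappa> N = real N * A N + (real N * B N + real N * (1 - B N - A N)) / 2"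
      by (simp only: \<kappa>_def jacobi.\<kappa>_def)
    then show ?case by (simp add: field_simps)
  qed
  have N_lim: "filterlim real at_top sequentially" by (rule filterlim_real_sequentially)
  have kappa_lim: "filterlim \<kappa> at_top sequentially"
  proof -
    have "(\<lambda>N. (1 + A N) / 2) \<longlonglongrightarrow> h" unfolding h_def by (intro tendsto_intros A) simp
    from filterlim_tendsto_pos_mult_at_top[OF this h N_lim]
    have "filterlim (\<lambda>N. real N * ((1 + A N) / 2)) at_top sequentially" by (simp add: mult.commute)
    then show ?thesis using filterlim_cong[OF refl refl ev_k] by blast
  qed
  have mu_lim: "filterlim \<mu> at_top sequentially"
  proof -
    have "(\<lambda>N. A N * d0) \<longlonglongrightarrow> \<nu> * d0" by (intro tendsto_intros A)
    moreover have "\<nu> * d0 > 0" using pos d0_pos by simp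
    ultimately have L: "filterlim (\<lambda>N. A N * d0 * real N) at_top sequentially"
      by (rule filterlim_tendsto_pos_mult_at_top[OF _ _ N_lim])
    have "\<forall>\<^sub>F N in sequentially. \<mu> N = A N * d0 * real N"
      using ev by eventually_elim (simp add: \<mu>_def)
    from filterlim_cong[OF refl refl this] L show ?thesis by simp
  qed
  have c_lim: "c \<longlonglongrightarrow> m0"
  proof -
    \<comment> \<open>With \<alpha> = N B and \<beta> = N (1 - B - A) one has \<alpha> - \<beta> = N
      (2 B + A - 1) and \<alpha> + \<beta> = N (1 - A), so the factor N^2 cancels.\<close>
    have "(\<lambda>N. (2 * B N + A N - 1) * (1 - A N) / (4 * ((1 + A N) / 2)\<^sup>2)) \<longlonglongrightarrow> (2 * \<eta> + \<nu> - 1) * (1 - \<nu>) / (4 * ((1 + \<nu>) / 2)\<^sup>2)"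
      by (intro tendsto_intros A B) (use pos in auto)
    also have "(2 * \<eta> + \<nu> - 1) * (1 - \<nu>) / (4 * ((1 + \<nu>) / 2)\<^sup>2) = (\<eta> - \<zeta>) * (\<eta> + \<zeta>) / (4 * h\<^sup>2)"
      by (simp add: \<zeta>_def h_def)
    also have "\<dots> = m0" unfolding rel(2) m0_def ..
    finally have lim: "(\<lambda>N. (2 * B N + A N - 1) * (1 - A N) / (4 * ((1 + A N) / 2)\<^sup>2)) \<longlonglongrightarrow> m0" .
    have "\<forall>\<^sub>F N in sequentially. (2 * B N + A N - 1) * (1 - A N) / (4 * ((1 + A N) / 2)\<^sup>2) = c N"
      using ev ev_k
    proof eventually_elim
      case (elim N)
      have "c N = (real (\<alpha> N) - real (\<beta> N)) * (real (\<alpha> N) + real (\<beta> N)) / (4 * (\<kappa> N)\<^sup>2)"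
        by (simp only: c_def \<kappa>_def jacobi.center_def)
      also have "\<dots> = (real N * (2 * B N + A N - 1)) * (real N * (1 - A N)) / (4 * (real N * ((1 + A N) / 2))\<^sup>2)"
      proof -
        have "real (\<alpha> N) - real (\<beta> N) = real N * (2 * B N + A N - 1)" "real (\<alpha> N) + real (\<beta> N) = real N * (1 - A N)"
          using elim by (simp_all add: algebra_simps)
        then show ?thesis using elim(2) by (simp only:)
      qed
      also have "\<dots> = (2 * B N + A N - 1) * (1 - A N) / (4 * ((1 + A N) / 2)\<^sup>2)"
      proof -
        have *: "(M * p) * (M * q) / (4 * (M * t)\<^sup>2) = p * q / (4 * t\<^sup>2)" if "M > 0" for M p q t :: real
          using that by (simp add: power2_eq_square)
        show ?thesis by (rule *) (use elim(1) in simp)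
      qed
      finally show ?case ..
    qed
    from Lim_transform_eventually[OF lim this] show ?thesis .
  qed
  have rho_lim: "\<rho> \<longlonglongrightarrow> r\<^sup>2"
  proof -
    have "(\<lambda>N. (A N - (2 * B N + A N - 1)\<^sup>2 / 4) / ((1 + A N) / 2)\<^sup>2) \<longlonglongrightarrow> (\<nu> - (2 * \<eta> + \<nu> - 1)\<^sup>2 / 4) / ((1 + \<nu>) / 2)\<^sup>2"
      by (intro tendsto_intros A B) (use pos in auto)
    also have "2 * \<eta> + \<nu> - 1 = \<eta> - \<zeta>" by (simp add: \<zeta>_def)
    also have "(1 + \<nu>) / 2 = h" by (simp only: h_def)
    also have "(\<nu> - (\<eta> - \<zeta>)\<^sup>2 / 4) / h\<^sup>2 = - (a * b)" by (rule rel(3))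
    finally have lim: "(\<lambda>N. (c N)\<^sup>2 + (A N - (2 * B N + A N - 1)\<^sup>2 / 4) / ((1 + A N) / 2)\<^sup>2) \<longlonglongrightarrow> r\<^sup>2"
      unfolding r2 by (intro tendsto_intros c_lim)
    have "\<forall>\<^sub>F N in sequentially. (c N)\<^sup>2 + (A N - (2 * B N + A N - 1)\<^sup>2 / 4) / ((1 + A N) / 2)\<^sup>2 = \<rho> N"
      using ev ev_k
    proof eventually_elim
      case (elim N)
      have "\<rho> N = (c N)\<^sup>2 + (real (n N) * (real (n N) + real (\<alpha> N) + real (\<beta> N)) - (real (\<alpha> N) - real (\<beta> N))\<^sup>2 / 4) / (\<kappa> N)\<^sup>2"
        by (simp only: \<rho>_def c_def \<kappa>_def jacobi.radius2_def)
      also have "\<dots> = (c N)\<^sup>2 + ((real N * A N) * real N - (real N * (2 * B N + A N - 1))\<^sup>2 / 4) / (real N * ((1 + A N) / 2))\<^sup>2"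
      proof -
        have "real (\<alpha> N) - real (\<beta> N) = real N * (2 * B N + A N - 1)" "real (n N) + real (\<alpha> N) + real (\<beta> N) = real N"
          using elim by (simp_all add: algebra_simps)
        then show ?thesis using elim by (simp only:)
      qed
      also have "((real N * A N) * real N - (real N * (2 * B N + A N - 1))\<^sup>2 / 4) / (real N * ((1 + A N) / 2))\<^sup>2
          = (A N - (2 * B N + A N - 1)\<^sup>2 / 4) / ((1 + A N) / 2)\<^sup>2"
      proof -
        have *: "((M * p) * M - (M * q)\<^sup>2 / 4) / (M * t)\<^sup>2 = (p - q\<^sup>2 / 4) / t\<^sup>2" if "M > 0" for M p q t :: real
        proof -
          have "(M * p) * M - (M * q)\<^sup>2 / 4 = M\<^sup>2 * (p - q\<^sup>2 / 4)"
            by (simp add: power2_eq_square right_diff_distrib)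
          then show ?thesis using that by (simp add: power_mult_distrib)
        qed
        show ?thesis by (rule *) (use elim(1) in simp)
      qed
      finally show ?case ..
    qed
    from Lim_transform_eventually[OF lim this] show ?thesis .
  qed
  \<comment> \<open>The check that unfolding by the equilibrium density is the right one: h / (pi
    \<nu> d0) is 1 / sqrt (- a b), and - a b = r^2 - m0^2.\<close>
  have ratio: "(\<lambda>N. \<kappa> N / (pi * \<mu> N)) \<longlonglongrightarrow> 1 / sqrt (r\<^sup>2 - m0\<^sup>2)"
  proof -
    have "(\<lambda>N. ((1 + A N) / 2) / (pi * (A N * d0))) \<longlonglongrightarrow> ((1 + \<nu>) / 2) / (pi * (\<nu> * d0))"
      by (intro tendsto_intros A) (use pos d0_pos in auto)
    also have "((1 + \<nu>) / 2) / (pi * (\<nu> * d0)) = h / (pi * (\<nu> * d0))" by (simp only: h_def)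
    also have "\<dots> = 1 / sqrt (r\<^sup>2 - m0\<^sup>2)" unfolding d0 r2 using h pos nab by simp
    finally have lim: "(\<lambda>N. ((1 + A N) / 2) / (pi * (A N * d0))) \<longlonglongrightarrow> 1 / sqrt (r\<^sup>2 - m0\<^sup>2)" .
    have "\<forall>\<^sub>F N in sequentially. ((1 + A N) / 2) / (pi * (A N * d0)) = \<kappa> N / (pi * \<mu> N)"
      using ev ev_k
    proof eventually_elim
      case (elim N)
      have "\<kappa> N / (pi * \<mu> N) = real N * ((1 + A N) / 2) / (pi * (real N * A N * d0))"
        using elim by (simp only: \<mu>_def)
      also have "\<dots> = ((1 + A N) / 2) / (pi * (A N * d0))"
      proof -
        have "M * p / (q * (M * t * u)) = p / (q * (t * u))" if "M > 0" for M p q t u :: real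
          using that by simp
        then show ?thesis using elim(1) by simp
      qed
      finally show ?case ..
    qed
    from Lim_transform_eventually[OF lim this] show ?thesis .
  qed

  interpret K: kernel_scaling \<phi> D \<kappa> c \<rho> m0 r k \<mu>
  proof
    show "\<forall>\<^sub>F N in sequentially. oscillator (\<phi> N) (D N) (\<kappa> N) (c N) (\<rho> N)"
      using ev by eventually_elim (simp add: \<phi>_def D_def \<kappa>_def c_def \<rho>_def jacobi.oscillator_phi)
    show "r > 0" "-1 < m0 - r" "m0 + r < 1" "\<bar>m0\<bar> < r"
      using ab by (auto simp: m0_def r_def field_simps abs_less_iff)
    show "\<forall>\<^sub>F N in sequentially. \<forall>x\<in>{-1<..<1}. \<forall>y\<in>{-1<..<1}.
      (2 * \<kappa> N + 1) * ((x - y) * k N x y) = \<phi> N x * D N y - D N x * \<phi> N y - \<kappa> N * (x - y) * (\<phi> N x * \<phi> N y)"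
      using ev by eventually_elim (simp only: \<phi>_def D_def \<kappa>_def k_def jacobi.kern_eq, blast)
    show "\<forall>\<^sub>F N in sequentially. \<forall>y\<in>{-1<..<1}. isCont (\<lambda>x. k N x y) y"
    proof (intro always_eventually allI ballI)
      fix N y
      show "isCont (\<lambda>x. k N x y) y"
        using jacobi.continuous_kern(1)[where A = UNIV] unfolding k_def by (simp add: continuous_on_eq_continuous_at)
    qed
  qed (fact kappa_lim c_lim rho_lim mu_lim ratio)+

  let ?H = "s - integral {0..s} (\<lambda>\<rho>. integral {0..s} (\<lambda>\<xi>. (sine_kernel \<xi> \<rho>)\<^sup>2))"
  have mu_pos: "\<forall>\<^sub>F N in sequentially. \<mu> N > 0"
    using mu_lim unfolding filterlim_at_top_dense by blast
  have lim: "(\<lambda>N. integral {- (s / 2 / \<mu> N)..s / 2 / \<mu> N} (\<lambda>t. k N t t)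
      - integral {- (s / 2 / \<mu> N)..s / 2 / \<mu> N} (\<lambda>t. integral {- (s / 2 / \<mu> N)..s / 2 / \<mu> N} (\<lambda>u. (k N t u)\<^sup>2))) \<longlonglongrightarrow> ?H"
  proof (rule number_variance_limit[OF \<open>s > 0\<close> _ mu_pos K.err_lim])
    show "continuous_on UNIV (\<lambda>(x, y). k N x y)" for N
      unfolding k_def by (rule jacobi.continuous_kern_pair)
    show "\<forall>\<^sub>F N in sequentially. \<forall>\<xi>\<in>{- (s / 2)..s / 2}. \<forall>\<eta>\<in>{- (s / 2)..s / 2}.
       \<bar>k N (\<xi> / \<mu> N) (\<eta> / \<mu> N) / \<mu> N - sine_kernel \<xi> \<eta>\<bar> \<le> K.err (s / 2) N"
      by (rule K.kernel_err) (use \<open>s > 0\<close> in simp)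
  qed
  \<comment> \<open>This makes the rescaled interval shorter than 2, hence contained in the support
    of the weight.\<close>
  have ev_l: "\<forall>\<^sub>F N in sequentially. \<mu> N > s"
    using mu_lim unfolding filterlim_at_top_dense by blast
  have "\<forall>\<^sub>F N in sequentially. integral {- (s / 2 / \<mu> N)..s / 2 / \<mu> N} (\<lambda>t. k N t t)
      - integral {- (s / 2 / \<mu> N)..s / 2 / \<mu> N} (\<lambda>t. integral {- (s / 2 / \<mu> N)..s / 2 / \<mu> N} (\<lambda>u. (k N t u)\<^sup>2))
      = bus_number_variance (M N) (n N) (Y N) (s / (real (n N) * equilibrium_density \<nu> \<eta> a b 0))"
    using \<open>\<forall>\<^sub>F N in sequentially. bus_arrival_times (M N) N (n N) (x N) (Y N)\<close> ev ev_l mu_pos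
  proof eventually_elim
    case (elim N)
    let ?l = "s / \<mu> N"
    have l: "?l < 2" using elim by (simp add: divide_less_eq)
    have e: "- ?l / 2 = - (s / 2 / \<mu> N)" "?l / 2 = s / 2 / \<mu> N" by simp_all
    have "n N \<ge> 1" "x N - 1 \<ge> 1" "N - x N - (n N - 1) \<ge> 1"
      using elim(2) unfolding \<alpha>_def \<beta>_def by blast+
    from bus_variance_kernel[OF elim(1) this l]
    have "bus_number_variance (M N) (n N) (Y N) ?l = integral {- (s / 2 / \<mu> N)..s / 2 / \<mu> N} (\<lambda>t. k N t t)
      - integral {- (s / 2 / \<mu> N)..s / 2 / \<mu> N} (\<lambda>t. integral {- (s / 2 / \<mu> N)..s / 2 / \<mu> N} (\<lambda>u. (k N t u)\<^sup>2))"
      unfolding e \<alpha>_def[symmetric] \<beta>_def[symmetric] k_def .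
    then show ?case unfolding \<mu>_def d0_def ..
  qed
  from Lim_transform_eventually[OF lim this]
  have "(\<lambda>N. bus_number_variance (M N) (n N) (Y N) (s / (real (n N) * equilibrium_density \<nu> \<eta> a b 0))) \<longlonglongrightarrow> ?H" .
  moreover have "\<forall>(P :: 'b measure) X c. determinantal_point_process P X sine_kernel \<longrightarrow>
       prob_space.variance P (\<lambda>\<omega>. real (card (X \<omega> \<inter> {c..c + s}))) = ?H"
    using sine_process_variance \<open>s > 0\<close> by blast
  ultimately show ?thesis by blast
qed

end
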